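(* Let $F$ be a differential field and let $K\supseteq F$ be a differential field algebraic over $F(\theta)$, where $\theta\in K$ is transcendental over $F$ and is either an exponential of a primitive over $F$ or a primitive over $F$. Assume that $F$ is algebraically closed in $K$ and that $F$ and $K$ have the same constants. Let $\psi_1,\dots,\psi_n \in K\setminus\{0\}$ be multiplicatively independent modulo $F_{*}$; when $\theta$ is an exponential of a primitive, assume moreover that $\theta,\psi_1,\dots,\psi_n$ are multiplicatively independent modulo $F_{*}$. If $a_1,\dots,a_n \in F$ and $s \in K$ satisfy $$\sum_{i=1}^n a_i \frac{D\psi_i}{\psi_i} + Ds \in F,$$ then $a_i = 0$ for all $i$.
   Context: All fields have characteristic $0$; $D$ denotes the derivation; a constant is an element $c$ with $Dc=0$. $F_{*}$ is the multiplicative group of $F$. $\theta$ is a primitive over $F$ if $D\theta\in F$; $\theta$ is an exponential of a primitive over $F$ if $\theta\neq0$ and $D\theta/\theta\in F$. Elements $x_1,\dots,x_m\in K\setminus\{0\}$ are multiplicatively independent modulo $F_{*}$ if $x_1^{e_1}\cdots x_m^{e_m}\in F_{*}$ with $e_i\in\mathbb{Z}$ implies all $e_i=0$. The coefficients $a_i$ are not assumed to be constants. *)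

theory Defs
  imports "HOL-Computational_Algebra.Polynomial"
begin

text \<open>
  The big field \<open>K\<close> is the whole type \<open>'a\<close>, of class \<open>field_char_0\<close>; subfields of \<open>K\<close> are sets.
\<close>

definition is_subfield :: "'a::field set \<Rightarrow> bool" where
  "is_subfield F \<longleftrightarrow> 0 \<in> F \<and> 1 \<in> F
     \<and> (\<forall>x\<in>F. \<forall>y\<in>F. x + y \<in> F) \<and> (\<forall>x\<in>F. - x \<in> F)
     \<and> (\<forall>x\<in>F. \<forall>y\<in>F. x * y \<in> F) \<and> (\<forall>x\<in>F. x \<noteq> 0 \<longrightarrow> inverse x \<in> F)"

definition field_adjoin :: "'a::field set \<Rightarrow> 'a \<Rightarrow> 'a set" where
  "field_adjoin F t = \<Inter>{L. is_subfield L \<and> F \<subseteq> L \<and> t \<in> L}"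

definition algebraic_over :: "'a::field set \<Rightarrow> 'a \<Rightarrow> bool" where
  "algebraic_over F x \<longleftrightarrow> (\<exists>p. (\<forall>i. coeff p i \<in> F) \<and> p \<noteq> 0 \<and> poly p x = 0)"

abbreviation transcendental_over :: "'a::field set \<Rightarrow> 'a \<Rightarrow> bool" where
  "transcendental_over F x \<equiv> \<not> algebraic_over F x"

definition algebraically_closed_in_type :: "'a::field set \<Rightarrow> bool" where
  "algebraically_closed_in_type F \<longleftrightarrow> (\<forall>x. algebraic_over F x \<longrightarrow> x \<in> F)"

definition is_derivation :: "('a::field \<Rightarrow> 'a) \<Rightarrow> bool" where
  "is_derivation D \<longleftrightarrow> (\<forall>x y. D (x + y) = D x + D y) \<and> (\<forall>x y. D (x * y) = D x * y + x * D y)"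

definition is_differential_subfield :: "('a::field \<Rightarrow> 'a) \<Rightarrow> 'a set \<Rightarrow> bool" where
  "is_differential_subfield D F \<longleftrightarrow> is_subfield F \<and> (\<forall>x\<in>F. D x \<in> F)"

definition constants_of :: "('a::field \<Rightarrow> 'a) \<Rightarrow> 'a set \<Rightarrow> 'a set" where
  "constants_of D F = {c \<in> F. D c = 0}"

definition primitive_over :: "('a::field \<Rightarrow> 'a) \<Rightarrow> 'a set \<Rightarrow> 'a \<Rightarrow> bool" where
  "primitive_over D F t \<longleftrightarrow> D t \<in> F"

definition exp_of_primitive_over :: "('a::field \<Rightarrow> 'a) \<Rightarrow> 'a set \<Rightarrow> 'a \<Rightarrow> bool" where
  "exp_of_primitive_over D F t \<longleftrightarrow> t \<noteq> 0 \<and> D t / t \<in> F"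

text \<open>
  Used only for families \<open>x\<close> that do not vanish on the finite index set \<open>I\<close>
  (\<open>0 powi e = 0\<close> for \<open>e \<noteq> 0\<close>).
\<close>

definition mult_independent_mod :: "'a::field set \<Rightarrow> 'i set \<Rightarrow> ('i \<Rightarrow> 'a) \<Rightarrow> bool" where
  "mult_independent_mod F I x \<longleftrightarrow>
     (\<forall>e :: 'i \<Rightarrow> int. (\<Prod>i\<in>I. x i powi e i) \<in> F - {0} \<longrightarrow> (\<forall>i\<in>I. e i = 0))"

lemma is_subfield_field_adjoin: "is_subfield (field_adjoin F t)"
  unfolding field_adjoin_def is_subfield_def by auto

lemma subset_field_adjoin: "insert t F \<subseteq> field_adjoin F t"
  unfolding field_adjoin_def by auto

lemma field_adjoin_least: "is_subfield L \<Longrightarrow> insert t F \<subseteq> L \<Longrightarrow> field_adjoin F t \<subseteq> L"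
  unfolding field_adjoin_def by auto

end

theory Submission
  imports Defs "HOL-Algebra.Algebraic_Closure_Type"
begin

text \<open>
  Pass to the algebraic closure of \<open>K\<close> and let \<open>k\<close> be the algebraic closure of \<open>F\<close> in it. The
  derivation \<open>D\<close> extends, and so does \<open>d = d/d\<theta>\<close>. Put \<open>G = \<Sum>i. a i * d (\<psi> i) / \<psi> i + d s\<close>. At each place
  over \<open>k\<close>, expanding in Puiseux series in a parameter \<open>t\<close> compares \<open>d\<close> with \<open>D\<close>: away from the special
  places, \<open>D - D t * d\<close> kills \<open>t\<close> and so does not lower valuations, which transfers the regularity of
  \<open>\<Sum>i. a i * D (\<psi> i) / \<psi> i + D s\<close> to \<open>G\<close>; at the special places (\<open>\<infinity>\<close>, and \<open>0\<close> in the exponential case)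
  the absence of new constants bounds the pole of \<open>s\<close>. Hence \<open>G\<close> (respectively \<open>\<theta> * G\<close>) has no poles
  and lies in \<open>k\<close>. So the form \<open>\<Sum>i. a i * d (\<psi> i) / \<psi> i\<close>, minus a multiple of \<open>d \<theta> / \<theta>\<close> in the
  exponential case, is exact, and its residues give \<open>\<Sum>i. a i * v (\<psi> i) = 0\<close> at every place \<open>v\<close>. If some
  \<open>a i\<close> were nonzero, a \<open>\<rat>\<close>-linear functional would yield a nontrivial power product of the \<open>\<psi> i\<close> (and
  \<open>\<theta>\<close>) without zeros and poles, that is, an element of \<open>k \<inter> K = F\<close>.
\<close>

hide_const (open) Polynomials.degree Polynomials.lead_coeff up_ring.coeff up_ring.monom module.smult

section \<open>Valuation rings and algebraic elements\<close>

text \<open>For \<open>D\<close> the coefficients \<open>a i\<close> are not constants, so the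
  residue argument for logarithmic forms cannot be run with \<open>D\<close>. For \<open>d\<close>,
  which vanishes on \<open>k\<close>, they are constants; the local analysis exists to carry the
  hypothesis from \<open>D\<close> to \<open>d\<close>. In the closure the residue field at every
  place is \<open>k\<close> and every parameter has all rational powers, so ramification shows up
  only as fractional values of a normalised valuation. The price is that neither \<open>d\<close>
  nor the extended \<open>D\<close> is known to be continuous for these valuations: the Puiseux
  expansions are approximations inside the field, and the estimate for derivations has to be
  extracted from a polynomial equation. The hypothesis on constants survives the passage to the
  closure, because a constant there is algebraic over the constants of \<open>K\<close>, which lie
  in \<open>F\<close>. In the primitive case a simple pole of \<open>s\<close> at
  \<open>\<infinity>\<close> cannot be excluded (\<open>s = \<theta>\<close> has one), but
  \<open>d\<close> raises orders by one there. In the exponential case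
  \<open>d \<theta> / \<theta>\<close> has residues at \<open>0\<close> and
  \<open>\<infinity>\<close>, which is why \<open>\<theta>\<close> joins the independent
  family.\<close>

definition is_subring :: "'a::field set \<Rightarrow> bool" where
  "is_subring A \<longleftrightarrow> 0 \<in> A \<and> 1 \<in> A \<and> (\<forall>x\<in>A. \<forall>y\<in>A. x + y \<in> A)
     \<and> (\<forall>x\<in>A. - x \<in> A) \<and> (\<forall>x\<in>A. \<forall>y\<in>A. x * y \<in> A)"

definition poly_over :: "'a::field set \<Rightarrow> 'a poly set" where
  "poly_over A = {p. \<forall>i. coeff p i \<in> A}"

context
  fixes A :: "'a::field set"
  assumes A: "is_subring A"
begin

lemma subring_0: "0 \<in> A" and subring_1: "1 \<in> A"
  and subring_add: "x \<in> A \<Longrightarrow> y \<in> A \<Longrightarrow> x + y \<in> A"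
  and subring_uminus: "x \<in> A \<Longrightarrow> - x \<in> A"
  and subring_mult: "x \<in> A \<Longrightarrow> y \<in> A \<Longrightarrow> x * y \<in> A"
  using A by (auto simp: is_subring_def)

lemma subring_diff: "x \<in> A \<Longrightarrow> y \<in> A \<Longrightarrow> x - y \<in> A"
  using subring_add[of x "- y"] subring_uminus[of y] by simp

lemma subring_power: "x \<in> A \<Longrightarrow> x ^ n \<in> A"
  by (induction n) (auto intro: subring_1 subring_mult)

lemma subring_sum: "(\<And>i. i \<in> I \<Longrightarrow> f i \<in> A) \<Longrightarrow> sum f I \<in> A"
  by (induction I rule: infinite_finite_induct) (auto intro: subring_0 subring_add)

lemma subring_of_nat: "of_nat n \<in> A"
  by (induction n) (auto intro: subring_0 subring_1 subring_add)

lemma poly_in_subring: "p \<in> poly_over A \<Longrightarrow> x \<in> A \<Longrightarrow> poly p x \<in> A"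
  unfolding poly_altdef poly_over_def
  by (auto intro!: subring_sum subring_mult subring_power)

lemma poly_over_0: "0 \<in> poly_over A"
  by (simp add: poly_over_def subring_0)

lemma poly_over_pCons: "pCons a p \<in> poly_over A \<longleftrightarrow> a \<in> A \<and> p \<in> poly_over A"
  unfolding poly_over_def by (auto simp: coeff_pCons split: nat.splits)

lemma poly_over_add: "p \<in> poly_over A \<Longrightarrow> q \<in> poly_over A \<Longrightarrow> p + q \<in> poly_over A"
  by (simp add: poly_over_def subring_add)

lemma poly_over_uminus: "p \<in> poly_over A \<Longrightarrow> - p \<in> poly_over A"
  by (simp add: poly_over_def subring_uminus)

lemma poly_over_diff: "p \<in> poly_over A \<Longrightarrow> q \<in> poly_over A \<Longrightarrow> p - q \<in> poly_over A"
  by (simp add: poly_over_def subring_diff)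

lemma poly_over_mult: "p \<in> poly_over A \<Longrightarrow> q \<in> poly_over A \<Longrightarrow> p * q \<in> poly_over A"
  by (auto simp: poly_over_def coeff_mult intro!: subring_sum subring_mult)

lemma poly_over_smult: "a \<in> A \<Longrightarrow> p \<in> poly_over A \<Longrightarrow> smult a p \<in> poly_over A"
  by (simp add: poly_over_def subring_mult)

lemma poly_over_monom: "a \<in> A \<Longrightarrow> monom a n \<in> poly_over A"
  by (simp add: poly_over_def subring_0)

lemma poly_over_reflect: "p \<in> poly_over A \<Longrightarrow> reflect_poly p \<in> poly_over A"
  by (auto simp: poly_over_def coeff_reflect_poly subring_0)

lemma poly_over_pderiv: "p \<in> poly_over A \<Longrightarrow> pderiv p \<in> poly_over A"
  by (auto simp: poly_over_def coeff_pderiv simp del: of_nat_Suc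
      intro!: subring_mult subring_of_nat)

lemma poly_over_pcompose:
  "p \<in> poly_over A \<Longrightarrow> q \<in> poly_over A \<Longrightarrow> pcompose p q \<in> poly_over A"
proof (induction p)
  case (pCons a p)
  then show ?case
    by (auto simp: pcompose_pCons poly_over_pCons poly_over_0 intro!: poly_over_add poly_over_mult)
qed (simp add: poly_over_0)

lemma is_subring_adjoin: "is_subring {poly p x |p. p \<in> poly_over A}"
  unfolding is_subring_def
proof (intro conjI ballI; (elim CollectE exE conjE)?)
  show "0 \<in> {poly p x |p. p \<in> poly_over A}"
    by (intro CollectI exI[of _ 0]) (simp add: poly_over_0)
  show "1 \<in> {poly p x |p. p \<in> poly_over A}"
    by (intro CollectI exI[of _ 1]) (simp add: poly_over_pCons poly_over_0 subring_1 one_pCons)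
  fix a p assume p: "a = poly p x" "p \<in> poly_over A"
  show "- a \<in> {poly p x |p. p \<in> poly_over A}"
    by (intro CollectI exI[of _ "- p"]) (simp add: p poly_over_uminus)
  fix b q assume q: "b = poly q x" "q \<in> poly_over A"
  show "a + b \<in> {poly p x |p. p \<in> poly_over A}"
    by (intro CollectI exI[of _ "p + q"]) (simp add: p q poly_over_add)
  show "a * b \<in> {poly p x |p. p \<in> poly_over A}"
    by (intro CollectI exI[of _ "p * q"]) (simp add: p q poly_over_mult)
qed

lemma subset_adjoin: "A \<subseteq> {poly p x |p. p \<in> poly_over A}"
proof
  fix a assume "a \<in> A"
  hence "[:a:] \<in> poly_over A" by (simp add: poly_over_pCons poly_over_0)
  thus "a \<in> {poly p x |p. p \<in> poly_over A}"
    by (intro CollectI exI[of _ "[:a:]"]) simp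
qed

lemma in_adjoin: "x \<in> {poly p x |p. p \<in> poly_over A}"
proof -
  have "[:0, 1:] \<in> poly_over A" by (simp add: poly_over_pCons poly_over_0 subring_0 subring_1)
  thus ?thesis by (intro CollectI exI[of _ "[:0, 1:]"]) simp
qed

end

lemma subfield_imp_subring: "is_subfield E \<Longrightarrow> is_subring E"
  unfolding is_subfield_def is_subring_def by blast

lemma subfield_inverse: "is_subfield E \<Longrightarrow> x \<in> E \<Longrightarrow> inverse x \<in> E"
  unfolding is_subfield_def by (metis inverse_zero)

lemma subfield_divide: "is_subfield E \<Longrightarrow> x \<in> E \<Longrightarrow> y \<in> E \<Longrightarrow> x / y \<in> E"
  by (simp add: divide_inverse subfield_inverse subfield_imp_subring subring_mult)

lemma algebraic_over_iff: "algebraic_over E x \<longleftrightarrow> (\<exists>p\<in>poly_over E. p \<noteq> 0 \<and> poly p x = 0)"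
  unfolding algebraic_over_def poly_over_def by auto

lemma algebraic_over_mono: "E \<subseteq> E' \<Longrightarrow> algebraic_over E x \<Longrightarrow> algebraic_over E' x"
  unfolding algebraic_over_def by blast

lemma algebraic_over_self: "is_subfield E \<Longrightarrow> x \<in> E \<Longrightarrow> algebraic_over E x"
  unfolding algebraic_over_iff
  by (intro bexI[of _ "[:- x, 1:]"])
    (auto simp: poly_over_pCons poly_over_0 subring_uminus subring_1 subfield_imp_subring)

section \<open>Valuation rings and Chevalley's existence theorem\<close>

definition valuation_ring :: "'a::field set \<Rightarrow> bool" where
  "valuation_ring V \<longleftrightarrow> is_subring V \<and> (\<forall>x. x \<in> V \<or> inverse x \<in> V)"

lemma valuation_ring_subring: "valuation_ring V \<Longrightarrow> is_subring V"
  by (simp add: valuation_ring_def)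

text \<open>If \<open>x\<close> lay outside \<open>V\<close>, then \<open>inverse x\<close> would
  lie in it, and dividing the equation of \<open>x\<close> by a power of \<open>x\<close> would
  express \<open>x\<close> as a polynomial in \<open>inverse x\<close> over \<open>E\<close>, hence
  as an element of \<open>V\<close>.\<close>

lemma valuation_ring_contains_algebraic:
  assumes V: "valuation_ring V" and E: "is_subfield E" "E \<subseteq> V" and x: "algebraic_over E x"
  shows "x \<in> V"
proof (rule ccontr)
  assume nx: "x \<notin> V"
  have VR: "is_subring V" using V by (simp add: valuation_ring_def)
  have ER: "is_subring E" using E by (simp add: subfield_imp_subring)
  have y: "inverse x \<in> V" using nx V by (auto simp: valuation_ring_def)
  have x0: "x \<noteq> 0" using nx subring_0[OF VR] by auto
  obtain p where p: "p \<in> poly_over E" "p \<noteq> 0" "poly p x = 0"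
    using x by (auto simp: algebraic_over_iff)
  obtain a q where q: "reflect_poly p = pCons a q" by (cases "reflect_poly p")
  have a: "a = lead_coeff p"
    using q coeff_0_reflect_poly[of p] by simp
  have "poly (reflect_poly p) (inverse x) = 0"
    using p x0 by (simp add: poly_reflect_poly_nz)
  hence eq: "a + inverse x * poly q (inverse x) = 0" by (simp add: q)
  have "pCons a q \<in> poly_over E" using poly_over_reflect[OF ER p(1)] q by simp
  hence aq: "a \<in> E" "q \<in> poly_over E" using poly_over_pCons[OF ER] by auto
  have "poly q (inverse x) \<in> V"
    using poly_in_subring[OF VR, of q] aq E y by (auto simp: poly_over_def)
  moreover have "inverse a \<in> V" using aq E subfield_inverse by blast
  ultimately have "- (inverse a * poly q (inverse x)) \<in> V"
    by (intro subring_uminus[OF VR] subring_mult[OF VR])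
  moreover have "x = - (inverse a * poly q (inverse x))"
    using eq x0 a p by (simp add: field_simps add_eq_0_iff)
  ultimately show False using nx by simp
qed

text \<open>A subring that is maximal among those containing \<open>E\<close> and
  \<open>y = inverse x\<close> but not \<open>x\<close> is a valuation ring. Maximality puts
  \<open>x\<close> into every proper enlargement \<open>B[z]\<close>; if neither \<open>z\<close>
  nor \<open>inverse z\<close> were in \<open>B\<close>, the two expressions of \<open>x\<close> of
  least degree could be played against each other.\<close>

lemma chevalley_valuation_ring:
  assumes E: "is_subfield E" and x: "\<not> algebraic_over E x"
  shows "\<exists>V. valuation_ring V \<and> E \<subseteq> V \<and> x \<notin> V"
proof -
  have ER: "is_subring E" using E by (simp add: subfield_imp_subring)
  define y where "y = inverse x"
  have x0: "x \<noteq> 0" using x algebraic_over_self[OF E] subring_0[OF ER] by auto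
  have xy: "x * y = 1" "y * x = 1" using x0 by (auto simp: y_def)
  define S where "S = {B. is_subring B \<and> E \<subseteq> B \<and> y \<in> B \<and> x \<notin> B}"
  define B0 where "B0 = {poly p y |p. p \<in> poly_over E}"
  have "B0 \<in> S"
  proof -
    have "is_subring B0" unfolding B0_def by (rule is_subring_adjoin[OF ER])
    moreover have "E \<subseteq> B0" unfolding B0_def by (rule subset_adjoin[OF ER])
    moreover have "y \<in> B0" unfolding B0_def by (rule in_adjoin[OF ER])
    moreover have "x \<notin> B0"
    proof
      assume "x \<in> B0"
      then obtain p where p: "p \<in> poly_over E" "x = poly p y" unfolding B0_def by auto
      let ?q = "pCons (- 1) p"
      have q: "?q \<in> poly_over E" using p by (simp add: poly_over_pCons ER subring_1 subring_uminus)
      have "poly ?q y = 0" using p(2) xy by simp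
      hence "poly (reflect_poly ?q) x = 0"
        using x0 by (simp add: poly_reflect_poly_nz y_def)
      moreover have "reflect_poly ?q \<noteq> 0" by simp
      ultimately have "algebraic_over E x"
        using poly_over_reflect[OF ER q] unfolding algebraic_over_iff by blast
      thus False using x by simp
    qed
    ultimately show ?thesis by (simp add: S_def)
  qed
  have "\<exists>B\<in>S. \<forall>Y\<in>S. B \<subseteq> Y \<longrightarrow> Y = B"
  proof (rule subset_Zorn_nonempty)
    show "S \<noteq> {}" using \<open>B0 \<in> S\<close> by auto
    fix \<C> assume C: "\<C> \<noteq> {}" "subset.chain S \<C>"
    have CS: "C \<in> S" if "C \<in> \<C>" for C using that C by (auto simp: subset_chain_def)
    have two: "\<exists>C\<in>\<C>. a \<in> C \<and> b \<in> C" if "a \<in> \<Union>\<C>" "b \<in> \<Union>\<C>" for a b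
      using that C(2) unfolding subset_chain_def by blast
    have "is_subring (\<Union>\<C>)" unfolding is_subring_def
    proof (intro conjI ballI)
      fix a b assume "a \<in> \<Union>\<C>" "b \<in> \<Union>\<C>"
      then obtain C' where "C' \<in> \<C>" "a \<in> C'" "b \<in> C'" using two by blast
      moreover have "is_subring C'" using CS[OF \<open>C' \<in> \<C>\<close>] by (simp add: S_def)
      ultimately show "a + b \<in> \<Union>\<C>" "a * b \<in> \<Union>\<C>"
        using subring_add subring_mult by blast+
    qed (use C(1) CS subring_0 subring_1 subring_uminus in \<open>fastforce simp: S_def\<close>)+
    thus "\<Union>\<C> \<in> S" using C(1) CS by (fastforce simp: S_def)
  qed
  then obtain B where B: "B \<in> S" and max: "\<And>Y. Y \<in> S \<Longrightarrow> B \<subseteq> Y \<Longrightarrow> Y = B" by blast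
  have BR: "is_subring B" and EB: "E \<subseteq> B" and yB: "y \<in> B" and xB: "x \<notin> B"
    using B by (auto simp: S_def)
  have adj: "x \<in> {poly p z |p. p \<in> poly_over B}" if "z \<notin> B" for z
  proof (rule ccontr)
    let ?Z = "{poly p z |p. p \<in> poly_over B}"
    assume nx: "x \<notin> ?Z"
    have sub: "B \<subseteq> ?Z" by (rule subset_adjoin[OF BR])
    have "?Z \<in> S" using is_subring_adjoin[OF BR, of z] sub EB yB nx by (auto simp: S_def)
    hence "?Z = B" using max sub by blast
    moreover have "z \<in> ?Z" by (rule in_adjoin[OF BR])
    ultimately show False using that by simp
  qed
  \<comment> \<open>\<open>y\<close> lies in the Jacobson radical of \<open>B\<close>: clearing
    denominators in an expression of \<open>x\<close> through \<open>inverse (1 - y * b)\<close>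
    gives \<open>(1 - y * b') * x \<in> B\<close>, and \<open>x * y = 1\<close> turns this into
    \<open>x \<in> B\<close>.\<close>
  have unit: "inverse (1 - y * b) \<in> B" if b: "b \<in> B" for b
  proof (rule ccontr)
    let ?z = "inverse (1 - y * b)"
    assume nz: "?z \<notin> B"
    then obtain p where p: "p \<in> poly_over B" "x = poly p ?z" using adj by blast
    have z0: "1 - y * b \<noteq> 0" using nz subring_0[OF BR] by auto
    have u: "1 - y * b \<in> B" by (intro subring_diff[OF BR] subring_1[OF BR] subring_mult[OF BR] yB b)
    have "poly (reflect_poly p) (1 - y * b) = (1 - y * b) ^ degree p * x"
      using z0 p by (simp add: poly_reflect_poly_nz)
    moreover have "poly (reflect_poly p) (1 - y * b) \<in> B"
      by (intro poly_in_subring[OF BR] poly_over_reflect[OF BR] p u)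
    moreover have "\<exists>b'\<in>B. (1 - y * b) ^ n = 1 - y * b'" for n
    proof (induction n)
      case 0
      show ?case by (rule bexI[of _ 0]) (auto simp: subring_0[OF BR])
    next
      case (Suc n)
      then obtain b' where b': "b' \<in> B" "(1 - y * b) ^ n = 1 - y * b'" by blast
      have "b + b' - y * b * b' \<in> B"
        by (intro subring_diff[OF BR] subring_add[OF BR] subring_mult[OF BR] b b' yB)
      moreover have "(1 - y * b) ^ Suc n = 1 - y * (b + b' - y * b * b')"
        unfolding power_Suc b'(2) by (simp add: algebra_simps)
      ultimately show ?case by blast
    qed
    ultimately obtain b' where b': "b' \<in> B" "(1 - y * b') * x \<in> B" by metis
    have "(1 - y * b') * x + b' = x" using xy by (simp add: algebra_simps)
    thus False using subring_add[OF BR b'(2) b'(1)] xB by simp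
  qed
  define rep where "rep z n \<longleftrightarrow> (\<exists>p\<in>poly_over B. x = poly p z \<and> degree p \<le> n)" for z n
  \<comment> \<open>The expression in \<open>inverse z\<close> has constant term \<open>q0\<close>.
    As \<open>x - q0 = x * (1 - y * q0)\<close> and \<open>1 - y * q0\<close> is a unit, it can be
    solved for \<open>z ^ d\<close> as a polynomial of smaller degree in \<open>z\<close>, which
    removes the top term of the other expression.\<close>
  have reduce: "\<exists>l<n. rep z l" if z: "z \<noteq> 0" and p: "rep z n" and q: "rep (inverse z) m" and mn: "m \<le> n" for z m n
  proof -
    obtain p where p: "p \<in> poly_over B" "x = poly p z" "degree p \<le> n" using p rep_def by auto
    obtain q where q: "q \<in> poly_over B" "x = poly q (inverse z)" "degree q \<le> m" using q rep_def by auto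
    obtain q0 q1 where qq: "q = pCons q0 q1" by (cases q)
    have q01: "q0 \<in> B" "q1 \<in> poly_over B" using q(1) by (auto simp: qq poly_over_pCons BR)
    have q1: "q1 \<noteq> 0" using q(2) xB q01 by (auto simp: qq)
    hence dq: "degree q = Suc (degree q1)" by (simp add: qq)
    define w where "w = inverse (1 - y * q0)"
    have w: "w \<in> B" unfolding w_def by (rule unit[OF q01(1)])
    have "1 - y * q0 \<noteq> 0"
    proof
      assume "1 - y * q0 = 0"
      hence "x = q0" using xy by (metis eq_iff_diff_eq_0 mult.left_commute mult.right_neutral)
      thus False using xB q01 by simp
    qed
    hence w1: "w * (1 - y * q0) = 1" by (simp add: w_def)
    define d where "d = degree q"
    have "z ^ d * x = z ^ d * q0 + z ^ degree q1 * poly q1 (inverse z)"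
      using z by (subst q(2)) (simp add: qq d_def dq field_simps)
    also have "z ^ degree q1 * poly q1 (inverse z) = poly (reflect_poly q1) z"
      using z by (simp add: poly_reflect_poly_nz)
    finally have "z ^ d * (x - q0) = poly (reflect_poly q1) z" by (simp add: algebra_simps)
    moreover have "x - q0 = x * (1 - y * q0)" using xy by (simp add: algebra_simps)
    ultimately have "z ^ d * (1 - y * q0) = y * poly (reflect_poly q1) z"
      using xy by (metis mult.commute mult.left_commute mult.right_neutral)
    hence zd: "z ^ d = w * y * poly (reflect_poly q1) z"
      using w1 by (metis mult.assoc mult.left_commute mult.right_neutral)
    have dn: "d \<le> n" using q mn by (simp add: d_def)
    show ?thesis
    proof (cases "degree p < n")
      case True
      then show ?thesis using p unfolding rep_def by blast
    next
      case False
      hence pn: "degree p = n" using p by simp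
      define p' where "p' = p - monom (coeff p n) n + smult (coeff p n * w * y) (monom 1 (n - d) * reflect_poly q1)"
      have cB: "coeff p n \<in> B" using p by (simp add: poly_over_def)
      have "p' \<in> poly_over B" unfolding p'_def
        by (intro poly_over_add[OF BR] poly_over_diff[OF BR] poly_over_smult[OF BR] poly_over_mult[OF BR]
            poly_over_monom[OF BR] poly_over_reflect[OF BR] subring_mult[OF BR] cB w yB p q01 subring_1[OF BR])
      moreover have "poly p' z = x"
      proof -
        have "z ^ n = z ^ (n - d) * z ^ d" using dn by (simp flip: power_add)
        thus ?thesis using p(2) zd by (simp add: p'_def poly_monom)
      qed
      moreover have "degree p' < n"
      proof -
        have n0: "n > 0" using dn dq by (simp add: d_def)
        have "degree (p - monom (coeff p n) n) \<le> n - 1"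
          using pn by (intro degree_le) (auto simp: coeff_eq_0)
        moreover have "degree (monom 1 (n - d) * reflect_poly q1) \<le> n - 1"
        proof -
          have "degree (monom 1 (n - d) * reflect_poly q1) \<le> (n - d) + degree q1"
            by (rule order_trans[OF degree_mult_le])
              (intro add_mono degree_monom_le degree_reflect_poly_le)
          also have "\<dots> = n - 1" using dn dq by (simp add: d_def)
          finally show ?thesis .
        qed
        ultimately have "degree p' \<le> n - 1" unfolding p'_def
          by (intro degree_add_le order_trans[OF degree_smult_le])
        thus ?thesis using n0 by simp
      qed
      ultimately show ?thesis unfolding rep_def by blast
    qed
  qed
  have "z \<in> B \<or> inverse z \<in> B" for z
  proof (rule ccontr)
    assume "\<not> ?thesis"
    hence nz: "z \<notin> B" "inverse z \<notin> B" by auto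
    have z0: "z \<noteq> 0" using nz subring_0[OF BR] by auto
    have ex: "\<exists>n. rep z n" "\<exists>n. rep (inverse z) n" using adj[OF nz(1)] adj[OF nz(2)] unfolding rep_def by blast+
    define n where "n = (LEAST n. rep z n)"
    define m where "m = (LEAST n. rep (inverse z) n)"
    have n: "rep z n" and nl: "\<And>l. l < n \<Longrightarrow> \<not> rep z l" unfolding n_def using ex LeastI_ex not_less_Least by blast+
    have m: "rep (inverse z) m" and ml: "\<And>l. l < m \<Longrightarrow> \<not> rep (inverse z) l"
      unfolding m_def using ex LeastI_ex not_less_Least by blast+
    show False
      using reduce[of z n m] reduce[of "inverse z" m n] z0 n m nl ml by (cases "m \<le> n") auto
  qed
  hence "valuation_ring B" using BR by (simp add: valuation_ring_def)
  thus ?thesis using EB xB by blast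
qed

text \<open>Valuation rings over \<open>E\<close> are closed under the ring operations, so this
  description makes sums, products and towers of algebraic elements immediate.\<close>

lemma algebraic_over_iff_valuation_rings:
  assumes "is_subfield E"
  shows "algebraic_over E x \<longleftrightarrow> (\<forall>V. valuation_ring V \<longrightarrow> E \<subseteq> V \<longrightarrow> x \<in> V)"
  using assms valuation_ring_contains_algebraic chevalley_valuation_ring by blast

lemma is_subfield_algebraic:
  fixes E :: "'a::field set"
  assumes E: "is_subfield E"
  shows "is_subfield {x. algebraic_over E x}"
proof -
  note iff = algebraic_over_iff_valuation_rings[OF E]
  \<comment> \<open>Valuation rings are not closed under inversion, so inverses come from the
    reflected polynomial.\<close>
  have inv: "algebraic_over E (inverse x)" if x: "algebraic_over E x" "x \<noteq> 0" for x
  proof -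
    obtain p where p: "p \<in> poly_over E" "p \<noteq> 0" "poly p x = 0"
      using x by (auto simp: algebraic_over_iff)
    have "poly (reflect_poly p) (inverse x) = 0" "reflect_poly p \<noteq> 0"
      using p x by (auto simp: poly_reflect_poly_nz)
    thus ?thesis
      using poly_over_reflect[OF subfield_imp_subring[OF E] p(1)] unfolding algebraic_over_iff by blast
  qed
  have sub: "is_subring V" if "valuation_ring V" for V :: "'a set"
    using that by (simp add: valuation_ring_def)
  show ?thesis
    unfolding is_subfield_def mem_Collect_eq
  proof (intro conjI ballI impI; (elim CollectE)?)
    show "algebraic_over E 0" "algebraic_over E 1"
      unfolding iff using sub subring_0 subring_1 by blast+
    fix x assume x: "algebraic_over E x"
    show "algebraic_over E (- x)" using x unfolding iff using sub subring_uminus by blast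
    show "algebraic_over E (inverse x)" if "x \<noteq> 0" using inv x that by blast
    fix y assume y: "algebraic_over E y"
    show "algebraic_over E (x + y)" using x y unfolding iff using sub subring_add by blast
    show "algebraic_over E (x * y)" using x y unfolding iff using sub subring_mult by blast
  qed
qed

lemma algebraic_over_trans:
  assumes "is_subfield E" "is_subfield E'" "\<forall>y\<in>E'. algebraic_over E y" "algebraic_over E' x"
  shows "algebraic_over E x"
  unfolding algebraic_over_iff_valuation_rings[OF assms(1)]
proof (intro allI impI)
  fix V assume V: "valuation_ring V" "E \<subseteq> V"
  hence "E' \<subseteq> V" using assms valuation_ring_contains_algebraic by blast
  thus "x \<in> V" using V assms valuation_ring_contains_algebraic by blast
qed

section \<open>Elements algebraic over a simple extension\<close>

lemma field_adjoinE:
  assumes E: "is_subfield E" and x: "x \<in> field_adjoin E t"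
  obtains p q where "p \<in> poly_over E" "q \<in> poly_over E" "poly q t \<noteq> 0" "x = poly p t / poly q t"
proof -
  note ER = subfield_imp_subring[OF E]
  define A where "A = {poly p t |p. p \<in> poly_over E}"
  have AR: "is_subring A" unfolding A_def by (rule is_subring_adjoin[OF ER])
  define L where "L = {a / b |a b. a \<in> A \<and> b \<in> A \<and> b \<noteq> 0}"
  have LI: "a / b \<in> L" if "a \<in> A" "b \<in> A" "b \<noteq> 0" for a b
    using that L_def by blast
  have EA: "insert t E \<subseteq> A"
    unfolding A_def using subset_adjoin[OF ER] in_adjoin[OF ER] by blast
  have "is_subfield L"
    unfolding is_subfield_def
  proof (intro conjI ballI impI)
    show "0 \<in> L" using LI[of 0 1] AR by (simp add: subring_0 subring_1)
    show "1 \<in> L" using LI[of 1 1] AR by (simp add: subring_1)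
    fix y assume "y \<in> L"
    then obtain a b where ab: "a \<in> A" "b \<in> A" "b \<noteq> 0" "y = a / b" unfolding L_def by blast
    show "- y \<in> L" using LI[of "- a" b] ab AR by (simp add: subring_uminus)
    { assume "y \<noteq> 0"
      thus "inverse y \<in> L" using LI[of b a] ab by simp }
    fix z assume "z \<in> L"
    then obtain c d where cd: "c \<in> A" "d \<in> A" "d \<noteq> 0" "z = c / d" unfolding L_def by blast
    show "y + z \<in> L" using LI[of "a * d + c * b" "b * d"] ab cd AR
      by (simp add: add_frac_eq subring_add subring_mult)
    show "y * z \<in> L" using LI[of "a * c" "b * d"] ab cd AR
      by (simp add: subring_mult)
  qed
  moreover have "insert t E \<subseteq> L"
    using EA LI[of _ 1] subring_1[OF AR] by auto
  ultimately have "x \<in> L" using field_adjoin_least x by blast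
  thus ?thesis using that unfolding L_def A_def by auto
qed

lemma poly_eq_sum_le: "degree (p :: 'a::field poly) \<le> n \<Longrightarrow> poly p x = (\<Sum>i\<le>n. coeff p i * x ^ i)"
  unfolding poly_altdef by (rule sum.mono_neutral_left) (auto simp: coeff_eq_0)

text \<open>Clearing denominators makes the relation polynomial in \<open>t\<close> and
  \<open>x\<close> alike. The symmetry gives the exchange property, and the finite list of monomials
  later pins down the value of \<open>x\<close> at a place. The top coefficient of \<open>P\<close>
  keeps the array \<open>c\<close> from vanishing.\<close>

lemma algebraic_over_adjoin_relation:
  assumes E: "is_subfield E" and x: "algebraic_over (field_adjoin E t) x"
  obtains c N where "\<And>i j. c i j \<in> E" "\<exists>i\<le>N. \<exists>j\<le>N. c i j \<noteq> 0"
    "(\<Sum>i\<le>N. \<Sum>j\<le>N. c i j * t ^ i * x ^ j) = 0"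
proof -
  note ER = subfield_imp_subring[OF E]
  obtain P where P: "P \<in> poly_over (field_adjoin E t)" "P \<noteq> 0" "poly P x = 0"
    using x by (auto simp: algebraic_over_iff)
  have "\<exists>q\<in>poly_over E. poly q t \<noteq> 0 \<and> (\<forall>i. \<exists>p\<in>poly_over E. coeff P i * poly q t = poly p t)"
    using P(1)
  proof (induction P)
    case 0
    show ?case
      by (rule bexI[of _ 1]) (auto simp: poly_over_pCons poly_over_0 ER subring_1 one_pCons
          intro!: bexI[of _ 0])
  next
    case (pCons a P)
    have a: "a \<in> field_adjoin E t" and PP: "P \<in> poly_over (field_adjoin E t)"
      using pCons.prems poly_over_pCons[OF subfield_imp_subring[OF is_subfield_field_adjoin]] by auto
    obtain p0 q0 where p0: "p0 \<in> poly_over E" "q0 \<in> poly_over E" "poly q0 t \<noteq> 0" "a = poly p0 t / poly q0 t"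
      using field_adjoinE[OF E a] by metis
    obtain q where q: "q \<in> poly_over E" "poly q t \<noteq> 0"
        "\<And>i. \<exists>p\<in>poly_over E. coeff P i * poly q t = poly p t"
      using pCons.IH[OF PP] by blast
    have "\<exists>p\<in>poly_over E. coeff (pCons a P) i * poly (q0 * q) t = poly p t" for i
    proof (cases i)
      case 0
      thus ?thesis using p0 q(1,2) by (intro bexI[of _ "p0 * q"]) (auto simp: poly_over_mult ER)
    next
      case (Suc j)
      obtain p where "p \<in> poly_over E" "coeff P j * poly q t = poly p t" using q by blast
      thus ?thesis using Suc p0 by (intro bexI[of _ "q0 * p"]) (auto simp: poly_over_mult ER mult_ac)
    qed
    moreover have "q0 * q \<in> poly_over E" "poly (q0 * q) t \<noteq> 0"
      using p0 q(1,2) by (auto simp: poly_over_mult ER)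
    ultimately show ?case by blast
  qed
  then obtain q where q: "q \<in> poly_over E" "poly q t \<noteq> 0"
    "\<forall>i. \<exists>p. p \<in> poly_over E \<and> coeff P i * poly q t = poly p t" by blast
  from choice[OF q(3)] obtain p where p: "\<And>i. p i \<in> poly_over E" "\<And>i. coeff P i * poly q t = poly (p i) t"
    by blast
  define N where "N = Max (insert (degree P) ((\<lambda>i. degree (p i)) ` {..degree P}))"
  have N: "degree P \<le> N" "\<And>i. i \<le> degree P \<Longrightarrow> degree (p i) \<le> N"
    unfolding N_def by (rule Max_ge; simp)+
  define c where "c i j = (if j \<le> degree P then coeff (p j) i else 0)" for i j
  have "c i j \<in> E" for i j using p(1) by (auto simp: c_def poly_over_def subring_0 ER)
  moreover have "\<exists>i\<le>N. \<exists>j\<le>N. c i j \<noteq> 0"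
  proof -
    have "poly (p (degree P)) t \<noteq> 0" using p(2)[of "degree P"] P(2) q(2) by (metis leading_coeff_0_iff mult_eq_0_iff)
    hence "p (degree P) \<noteq> 0" by auto
    hence "c (degree (p (degree P))) (degree P) \<noteq> 0" by (simp add: c_def)
    thus ?thesis using N by blast
  qed
  moreover have "(\<Sum>i\<le>N. \<Sum>j\<le>N. c i j * t ^ i * x ^ j) = 0"
  proof -
    have *: "(\<Sum>i\<le>N. c i j * t ^ i) = coeff P j * poly q t" if "j \<le> N" for j
    proof (cases "j \<le> degree P")
      case True
      thus ?thesis using poly_eq_sum_le[OF N(2)[OF True], of t] p(2)[of j] by (simp add: c_def)
    qed (simp add: c_def coeff_eq_0)
    have "(\<Sum>i\<le>N. \<Sum>j\<le>N. c i j * t ^ i * x ^ j) = (\<Sum>j\<le>N. (\<Sum>i\<le>N. c i j * t ^ i) * x ^ j)"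
      by (subst sum.swap) (simp add: sum_distrib_right)
    also have "\<dots> = (\<Sum>j\<le>N. coeff P j * poly q t * x ^ j)"
      using * by (intro sum.cong) auto
    also have "\<dots> = poly q t * poly P x"
      unfolding poly_eq_sum_le[OF N(1)] by (simp add: sum_distrib_left mult_ac)
    finally show ?thesis using P by simp
  qed
  ultimately show ?thesis by (rule that)
qed

text \<open>The relation between \<open>\<theta>\<close> and \<open>x\<close> is reread as a
  polynomial in \<open>\<theta>\<close> over \<open>k(x)\<close>; its coefficient in degree
  \<open>i0\<close> is nonzero because \<open>x\<close> is transcendental.\<close>

lemma algebraic_over_adjoin_exchange:
  assumes k: "is_subfield k" and alg: "\<And>x. algebraic_over (field_adjoin k \<theta>) x"
    and x: "\<not> algebraic_over k x"
  shows "algebraic_over (field_adjoin k x) y"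
proof -
  note kR = subfield_imp_subring[OF k]
  let ?E = "field_adjoin k x"
  have E: "is_subfield ?E" by (rule is_subfield_field_adjoin)
  note ER = subfield_imp_subring[OF E]
  have kE: "k \<subseteq> ?E" and xE: "x \<in> ?E" using subset_field_adjoin[of x k] by auto
  obtain c N where c: "\<And>i j. c i j \<in> k" "\<exists>i\<le>N. \<exists>j\<le>N. c i j \<noteq> 0"
    "(\<Sum>i\<le>N. \<Sum>j\<le>N. c i j * \<theta> ^ i * x ^ j) = 0"
    by (rule algebraic_over_adjoin_relation[OF k alg[of x]]) blast
  obtain i0 j0 where ij: "i0 \<le> N" "j0 \<le> N" "c i0 j0 \<noteq> 0" using c(2) by blast
  define e where "e i = (\<Sum>j\<le>N. c i j * x ^ j)" for i
  have eE: "e i \<in> ?E" for i unfolding e_def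
    using c(1) kE xE by (auto intro!: subring_sum[OF ER] subring_mult[OF ER] subring_power[OF ER])
  have e0: "e i0 \<noteq> 0"
  proof
    assume e0: "e i0 = 0"
    let ?p = "\<Sum>j\<le>N. monom (c i0 j) j"
    have cp: "coeff ?p j = (if j \<le> N then c i0 j else 0)" for j
      by (simp add: coeff_sum)
    hence "?p \<in> poly_over k" using c(1) subring_0[OF kR] by (simp add: poly_over_def)
    moreover have "coeff ?p j0 \<noteq> 0" unfolding cp using ij by simp
    hence "?p \<noteq> 0" by auto
    moreover have "poly ?p x = 0" using e0 by (simp add: poly_sum poly_monom e_def)
    ultimately show False using x unfolding algebraic_over_iff by blast
  qed
  let ?q = "\<Sum>i\<le>N. monom (e i) i"
  have cq: "coeff ?q i = (if i \<le> N then e i else 0)" for i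
    by (simp add: coeff_sum)
  hence "?q \<in> poly_over ?E" using eE subring_0[OF ER] by (simp add: poly_over_def)
  moreover have "coeff ?q i0 \<noteq> 0" unfolding cq using ij e0 by simp
  hence "?q \<noteq> 0" by auto
  moreover have "poly ?q \<theta> = 0"
    using c(3) by (simp add: poly_sum poly_monom e_def sum_distrib_left mult_ac)
  ultimately have th: "algebraic_over ?E \<theta>" unfolding algebraic_over_iff by blast
  have "field_adjoin k \<theta> \<subseteq> {z. algebraic_over ?E z}"
    using th kE algebraic_over_self[OF E]
    by (intro field_adjoin_least is_subfield_algebraic[OF E]) auto
  thus ?thesis
    using algebraic_over_trans[OF E is_subfield_field_adjoin _ alg] by blast
qed

section \<open>Extension of derivations\<close>

lemma derivation_add: "is_derivation D \<Longrightarrow> D (x + y) = D x + D y"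
  and derivation_mult: "is_derivation D \<Longrightarrow> D (x * y) = D x * y + x * D y"
  by (simp_all add: is_derivation_def)

lemma derivation_0: "is_derivation D \<Longrightarrow> D 0 = 0"
  by (metis add_0 add_cancel_right_right derivation_add)

lemma derivation_1: "is_derivation D \<Longrightarrow> D 1 = 0"
  by (metis mult_1 mult_1_right add_cancel_right_right derivation_mult)

lemma derivation_uminus: "is_derivation D \<Longrightarrow> D (- x) = - D x"
  using derivation_add[of D x "- x"] derivation_0[of D] by (simp add: add_eq_0_iff)

lemma derivation_diff: "is_derivation D \<Longrightarrow> D (x - y) = D x - D y"
  using derivation_add[of D x "- y"] derivation_uminus[of D y] by simp

lemma derivation_sum: "is_derivation D \<Longrightarrow> D (sum f I) = (\<Sum>i\<in>I. D (f i))"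
  by (induction I rule: infinite_finite_induct) (auto simp: derivation_0 derivation_add)

lemma derivation_inverse: "is_derivation D \<Longrightarrow> x \<noteq> 0 \<Longrightarrow> D (inverse x) = - D x / x\<^sup>2"
proof -
  assume D: "is_derivation D" and x: "x \<noteq> 0"
  have "D x * inverse x + x * D (inverse x) = 0"
    using derivation_mult[OF D, of x "inverse x"] derivation_1[OF D] x by simp
  thus ?thesis using x by (simp add: field_simps power2_eq_square add_eq_0_iff)
qed

lemma derivation_poly:
  assumes "is_derivation D"
  shows "D (poly p x) = poly (map_poly D p) x + poly (pderiv p) x * D x"
proof (induction p)
  case (pCons a p)
  thus ?case
    by (simp add: map_poly_pCons derivation_0 derivation_add derivation_mult assms pderiv_pCons algebra_simps)
qed (simp add: derivation_0 assms)

text \<open>The pairs \<open>(x, D x)\<close> are handled as dual numbers: a derivation on a subfield is a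
  set of pairs closed under the dual-number operations in which \<open>0\<close> has derivative \<open>0\<close> only.\<close>

definition derivation_graph :: "('a::field \<times> 'a) set \<Rightarrow> bool" where
  "derivation_graph G \<longleftrightarrow> (0, 0) \<in> G \<and> (1, 0) \<in> G
     \<and> (\<forall>x x' y y'. (x, x') \<in> G \<longrightarrow> (y, y') \<in> G \<longrightarrow> (x + y, x' + y') \<in> G)
     \<and> (\<forall>x x'. (x, x') \<in> G \<longrightarrow> (- x, - x') \<in> G)
     \<and> (\<forall>x x' y y'. (x, x') \<in> G \<longrightarrow> (y, y') \<in> G \<longrightarrow> (x * y, x' * y + x * y') \<in> G)
     \<and> (\<forall>x x'. (x, x') \<in> G \<longrightarrow> x \<noteq> 0 \<longrightarrow> (inverse x, - x' / x\<^sup>2) \<in> G)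
     \<and> (\<forall>y. (0, y) \<in> G \<longrightarrow> y = 0)"

text \<open>\<open>q\<close> collects the derivatives of the coefficients of \<open>p\<close>. A
  relation is used because the derivation is defined only on the domain of \<open>G\<close>.\<close>

definition pair_over :: "('a::field \<times> 'a) set \<Rightarrow> 'a poly \<Rightarrow> 'a poly \<Rightarrow> bool" where
  "pair_over G p q \<longleftrightarrow> (\<forall>i. (coeff p i, coeff q i) \<in> G)"

context
  fixes G :: "('a::field \<times> 'a) set"
  assumes G: "derivation_graph G"
begin

lemma graph_0: "(0, 0) \<in> G" and graph_1: "(1, 0) \<in> G"
  and graph_add: "(x, x') \<in> G \<Longrightarrow> (y, y') \<in> G \<Longrightarrow> (x + y, x' + y') \<in> G"
  and graph_uminus: "(x, x') \<in> G \<Longrightarrow> (- x, - x') \<in> G"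
  and graph_mult: "(x, x') \<in> G \<Longrightarrow> (y, y') \<in> G \<Longrightarrow> (x * y, x' * y + x * y') \<in> G"
  and graph_inverse: "(x, x') \<in> G \<Longrightarrow> x \<noteq> 0 \<Longrightarrow> (inverse x, - x' / x\<^sup>2) \<in> G"
  and graph_single0: "(0, y) \<in> G \<Longrightarrow> y = 0"
  using G unfolding derivation_graph_def by - (elim conjE; simp)+

lemma graph_single: "(x, y) \<in> G \<Longrightarrow> (x, z) \<in> G \<Longrightarrow> y = z"
  using graph_add[of x y "- x" "- z"] graph_uminus[of x z] graph_single0[of "y - z"] by simp

lemma graph_sum: "(\<And>i. i \<in> I \<Longrightarrow> (f i, g i) \<in> G) \<Longrightarrow> (sum f I, sum g I) \<in> G"
  by (induction I rule: infinite_finite_induct) (auto intro: graph_0 graph_add)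

lemma is_subfield_Domain: "is_subfield (Domain G)"
  unfolding is_subfield_def
proof (intro conjI ballI impI; (elim DomainE)?)
  show "0 \<in> Domain G" "1 \<in> Domain G" using graph_0 graph_1 by (auto intro: DomainI)
  fix x x' assume x: "(x, x') \<in> G"
  show "- x \<in> Domain G" using graph_uminus[OF x] by (rule DomainI)
  show "inverse x \<in> Domain G" if "x \<noteq> 0" using graph_inverse[OF x that] by (rule DomainI)
  fix y y' assume y: "(y, y') \<in> G"
  show "x + y \<in> Domain G" using graph_add[OF x y] by (rule DomainI)
  show "x * y \<in> Domain G" using graph_mult[OF x y] by (rule DomainI)
qed

lemma pair_add: "pair_over G p q \<Longrightarrow> pair_over G p' q' \<Longrightarrow> pair_over G (p + p') (q + q')"
  and pair_uminus: "pair_over G p q \<Longrightarrow> pair_over G (- p) (- q)"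
  and pair_0: "pair_over G 0 0"
  by (auto simp: pair_over_def graph_add graph_uminus graph_0)

lemma pair_mult: "pair_over G p q \<Longrightarrow> pair_over G p' q' \<Longrightarrow> pair_over G (p * p') (q * p' + p * q')"
  unfolding pair_over_def coeff_mult coeff_add sum.distrib[symmetric]
  by (intro allI graph_sum graph_mult) auto

lemma pair_pCons: "pair_over G (pCons a p) (pCons b q) \<longleftrightarrow> (a, b) \<in> G \<and> pair_over G p q"
  unfolding pair_over_def by (auto simp: coeff_pCons split: nat.splits)

lemma pair_single: "pair_over G 0 q \<Longrightarrow> q = 0"
  by (intro poly_eqI) (auto simp: pair_over_def intro: graph_single0)

text \<open>\<open>u\<close> is a legitimate derivative of \<open>x\<close> as soon as every
  polynomial relation for \<open>x\<close> stays true after formal differentiation. The set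
  \<open>A\<close> holds the values on polynomials in \<open>x\<close>, and \<open>H\<close> those
  on fractions by the quotient rule; \<open>compat\<close> is single-valuedness at
  \<open>0\<close>.\<close>

lemma derivation_graph_extend:
  assumes compat: "\<And>p q. pair_over G p q \<Longrightarrow> poly p x = 0 \<Longrightarrow> poly q x + poly (pderiv p) x * u = 0"
  shows "\<exists>H. derivation_graph H \<and> G \<subseteq> H \<and> (x, u) \<in> H"
proof -
  define A where "A = {(poly p x, poly q x + poly (pderiv p) x * u) |p q. pair_over G p q}"
  have AI: "(a, a') \<in> A" if "pair_over G p q" "a = poly p x" "a' = poly q x + poly (pderiv p) x * u" for p q a a'
    using that unfolding A_def by blast
  have AE: "\<exists>p q. pair_over G p q \<and> a = poly p x \<and> a' = poly q x + poly (pderiv p) x * u" if "(a, a') \<in> A" for a a'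
    using that unfolding A_def by blast
  have A_add: "(a + b, a' + b') \<in> A" if ab: "(a, a') \<in> A" "(b, b') \<in> A" for a a' b b'
  proof -
    obtain p q where p: "pair_over G p q" "a = poly p x" "a' = poly q x + poly (pderiv p) x * u"
      using AE[OF ab(1)] by blast
    obtain r s where r: "pair_over G r s" "b = poly r x" "b' = poly s x + poly (pderiv r) x * u"
      using AE[OF ab(2)] by blast
    show ?thesis using p r
      by (intro AI[OF pair_add[OF p(1) r(1)]]) (auto simp: pderiv_add algebra_simps)
  qed
  have A_mult: "(a * b, a' * b + a * b') \<in> A" if ab: "(a, a') \<in> A" "(b, b') \<in> A" for a a' b b'
  proof -
    obtain p q where p: "pair_over G p q" "a = poly p x" "a' = poly q x + poly (pderiv p) x * u"
      using AE[OF ab(1)] by blast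
    obtain r s where r: "pair_over G r s" "b = poly r x" "b' = poly s x + poly (pderiv r) x * u"
      using AE[OF ab(2)] by blast
    show ?thesis using p r
      by (intro AI[OF pair_mult[OF p(1) r(1)]]) (auto simp: pderiv_mult algebra_simps)
  qed
  have A_uminus: "(- a, - a') \<in> A" if ab: "(a, a') \<in> A" for a a'
  proof -
    obtain p q where p: "pair_over G p q" "a = poly p x" "a' = poly q x + poly (pderiv p) x * u"
      using AE[OF ab] by blast
    show ?thesis using p by (intro AI[OF pair_uminus[OF p(1)]]) (auto simp: pderiv_minus)
  qed
  have A_G: "(a, b) \<in> A" if "(a, b) \<in> G" for a b
    using that by (intro AI[of "[:a:]" "[:b:]"]) (auto simp: pair_pCons pair_0 pderiv_pCons)
  have A_x: "(x, u) \<in> A"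
    by (intro AI[of "[:0, 1:]" 0])
      (auto simp: pair_over_def coeff_pCons graph_0 graph_1 pderiv_pCons split: nat.splits)
  have A_single: "b = 0" if "(0, b) \<in> A" for b
    using AE[OF that] compat by metis
  define H where "H = {(a / b, (a' * b - a * b') / b\<^sup>2) |a a' b b'. (a, a') \<in> A \<and> (b, b') \<in> A \<and> b \<noteq> 0}"
  have HI: "(y, y') \<in> H" if "(a, a') \<in> A" "(b, b') \<in> A" "b \<noteq> 0" "y = a / b" "y' = (a' * b - a * b') / b\<^sup>2"
    for y y' a a' b b' using that unfolding H_def by blast
  have HE: "\<exists>a a' b b'. (a, a') \<in> A \<and> (b, b') \<in> A \<and> b \<noteq> 0 \<and> y = a / b \<and> y' = (a' * b - a * b') / b\<^sup>2"
    if "(y, y') \<in> H" for y y' using that unfolding H_def by blast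
  have one: "(1, 0) \<in> A" and zero: "(0, 0) \<in> A" using A_G graph_1 graph_0 by auto
  have A_H: "(a, a') \<in> H" if "(a, a') \<in> A" for a a'
    by (rule HI[OF that one]) auto
  have "derivation_graph H"
    unfolding derivation_graph_def
  proof (intro conjI allI impI)
    show "(0, 0) \<in> H" "(1, 0) \<in> H" using A_H one zero by auto
    fix y y' assume "(y, y') \<in> H"
    then obtain a a' b b' where ab: "(a, a') \<in> A" "(b, b') \<in> A" "b \<noteq> 0" "y = a / b" "y' = (a' * b - a * b') / b\<^sup>2"
      using HE by blast
    show "(- y, - y') \<in> H"
      by (rule HI[OF A_uminus[OF ab(1)] ab(2,3)]) (use ab in \<open>auto simp: field_simps\<close>)
    { assume "y \<noteq> 0"
      hence "a \<noteq> 0" using ab by auto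
      thus "(inverse y, - y' / y\<^sup>2) \<in> H"
        by (intro HI[OF ab(2,1)]) (use ab in \<open>auto simp: field_simps power2_eq_square\<close>) }
    fix z z' assume "(z, z') \<in> H"
    then obtain c c' d d' where cd: "(c, c') \<in> A" "(d, d') \<in> A" "d \<noteq> 0" "z = c / d" "z' = (c' * d - c * d') / d\<^sup>2"
      using HE by blast
    have bd: "b * d \<noteq> 0" using ab cd by simp
    show "(y + z, y' + z') \<in> H"
      by (rule HI[OF A_add[OF A_mult[OF ab(1) cd(2)] A_mult[OF cd(1) ab(2)]] A_mult[OF ab(2) cd(2)] bd])
        (use ab(3) cd(3) in \<open>simp_all add: ab(4,5) cd(4,5) field_simps power2_eq_square\<close>)
    show "(y * z, y' * z + y * z') \<in> H"
      by (rule HI[OF A_mult[OF ab(1) cd(1)] A_mult[OF ab(2) cd(2)] bd])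
        (use ab(3) cd(3) in \<open>simp_all add: ab(4,5) cd(4,5) field_simps power2_eq_square\<close>)
  next
    fix y assume "(0, y) \<in> H"
    then obtain a a' b b' where ab: "(a, a') \<in> A" "b \<noteq> 0" "0 = a / b" "y = (a' * b - a * b') / b\<^sup>2"
      using HE by blast
    thus "y = 0" using A_single by auto
  qed
  moreover have "G \<subseteq> H" using A_H A_G by auto
  ultimately show ?thesis using A_H[OF A_x] by blast
qed

end

text \<open>A transcendental \<open>x\<close> satisfies only the zero relation, so its derivative is
  free and \<open>0\<close> is taken. For an algebraic \<open>x\<close> it is forced by a relation
  of least degree, where characteristic \<open>0\<close> makes \<open>poly (pderiv p) x\<close>
  nonzero; all other relations follow by division with remainder.\<close>

lemma derivation_graph_extend_any:
  fixes G :: "('a::field_char_0 \<times> 'a) set"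
  assumes G: "derivation_graph G"
  shows "\<exists>H u. derivation_graph H \<and> G \<subseteq> H \<and> (x, u) \<in> H"
proof (cases "\<exists>p q. pair_over G p q \<and> p \<noteq> 0 \<and> poly p x = 0")
  case False
  hence "p = 0" if "pair_over G p q" "poly p x = 0" for p q using that by blast
  hence "\<exists>H. derivation_graph H \<and> G \<subseteq> H \<and> (x, 0) \<in> H"
    using pair_single[OF G] by (intro derivation_graph_extend[OF G]) fastforce
  thus ?thesis by blast
next
  case True
  define n where "n = (LEAST n. \<exists>p q. pair_over G p q \<and> p \<noteq> 0 \<and> poly p x = 0 \<and> degree p = n)"
  have "\<exists>n p q. pair_over G p q \<and> p \<noteq> 0 \<and> poly p x = 0 \<and> degree p = n" using True by blast
  from LeastI_ex[OF this] obtain p q where p: "pair_over G p q" "p \<noteq> 0" "poly p x = 0" "degree p = n"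
    unfolding n_def by blast
  have least: "r = 0" if "pair_over G r s" "poly r x = 0" "degree r < n" for r s
    using that not_less_Least[of "degree r" "\<lambda>n. \<exists>p q. pair_over G p q \<and> p \<noteq> 0 \<and> poly p x = 0 \<and> degree p = n"]
    unfolding n_def by blast
  have n0: "n > 0"
  proof (rule ccontr)
    assume "\<not> n > 0"
    then obtain a where "p = [:a:]" using p(4) by (metis degree_eq_zeroE gr0I)
    thus False using p by simp
  qed
  \<comment> \<open>Least degree speaks only of polynomials with coefficients in the domain of
    \<open>G\<close>; this places \<open>pderiv p\<close> among them.\<close>
  have "pair_over G (pderiv p) (pderiv q)"
    unfolding pair_over_def
  proof
    fix i
    have nat: "(of_nat m, 0) \<in> G" for m
      by (induction m) (use graph_add[OF G graph_1[OF G]] graph_0[OF G] in force)+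
    have "(of_nat (Suc i) * coeff p (Suc i), of_nat (Suc i) * coeff q (Suc i)) \<in> G"
      using graph_mult[OF G nat[of "Suc i"], of "coeff p (Suc i)" "coeff q (Suc i)"] p(1)
      by (simp add: pair_over_def del: of_nat_Suc)
    thus "(coeff (pderiv p) i, coeff (pderiv q) i) \<in> G"
      by (simp add: coeff_pderiv del: of_nat_Suc)
  qed
  hence dp: "poly (pderiv p) x \<noteq> 0"
    using least[of "pderiv p" "pderiv q"] n0 p by (auto simp: degree_pderiv pderiv_eq_0_iff)
  define u where "u = - poly q x / poly (pderiv p) x"
  have pu: "poly q x + poly (pderiv p) x * u = 0" using dp by (simp add: u_def)
  have "poly s x + poly (pderiv r) x * u = 0" if "pair_over G r s" "poly r x = 0" for r s
    using that
  proof (induction "degree r" arbitrary: r s rule: less_induct)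
    case less
    show ?case
    proof (cases "r = 0")
      case True
      hence "s = 0" using less.prems(1) pair_single[OF G, of s] by simp
      thus ?thesis using True by simp
    next
      case False
      hence rn: "degree r \<ge> n" using least less.prems by (meson linorder_not_less)
      obtain l l' where l: "l = lead_coeff r / lead_coeff p" "(l, l') \<in> G"
      proof -
        have "lead_coeff r \<in> Domain G" "lead_coeff p \<in> Domain G"
          using p(1) less.prems(1) by (auto simp: pair_over_def)
        hence "lead_coeff r / lead_coeff p \<in> Domain G"
          using subfield_divide[OF is_subfield_Domain[OF G]] by blast
        thus ?thesis using that by auto
      qed
      define m where "m = monom l (degree r - n)"
      define m' where "m' = monom l' (degree r - n)"
      have mm: "pair_over G m m'" using l graph_0[OF G] by (auto simp: pair_over_def m_def m'_def)
      \<comment> \<open>One division step: \<open>r1\<close> has lost the top term of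
        \<open>r\<close>, and \<open>s1\<close> is the matching companion of \<open>r1\<close> by
        the product rule.\<close>
      define r1 where "r1 = r + - (m * p)"
      define s1 where "s1 = s + - (m' * p + m * q)"
      have rs1: "pair_over G r1 s1" unfolding r1_def s1_def
        by (intro pair_add[OF G] pair_uminus[OF G] pair_mult[OF G] mm p less.prems)
      have r1x: "poly r1 x = 0" using less.prems p by (simp add: r1_def)
      have "degree r1 < degree r \<or> r1 = 0"
      proof -
        have lp: "lead_coeff p \<noteq> 0" "lead_coeff r \<noteq> 0" using p False by auto
        hence l0: "l \<noteq> 0" using l by simp
        have "degree (m * p) = degree r" using l0 p rn by (simp add: m_def degree_mult_eq degree_monom_eq)
        moreover have "lead_coeff (m * p) = lead_coeff r"
          using lp l by (simp add: lead_coeff_mult m_def degree_monom_eq)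
        ultimately have d: "degree r1 \<le> degree r" "coeff r1 (degree r) = 0"
          using degree_add_le[of r "degree r" "- (m * p)"] by (auto simp: r1_def)
        show ?thesis
        proof (cases "degree r1 = degree r")
          case True
          hence "lead_coeff r1 = 0" using d by simp
          thus ?thesis by simp
        qed (use d in auto)
      qed
      hence "poly s1 x + poly (pderiv r1) x * u = 0"
      proof
        assume "degree r1 < degree r"
        thus ?thesis using less.hyps rs1 r1x by blast
      next
        assume "r1 = 0"
        moreover from this have "s1 = 0" using rs1 pair_single[OF G, of s1] by simp
        ultimately show ?thesis by simp
      qed
      moreover have "poly s x + poly (pderiv r) x * u
          = poly s1 x + poly (pderiv r1) x * u + poly m x * (poly q x + poly (pderiv p) x * u)"
        using p(3) by (simp add: r1_def s1_def pderiv_add pderiv_minus pderiv_diff pderiv_mult algebra_simps)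
      ultimately show ?thesis using pu by simp
    qed
  qed
  hence "\<exists>H. derivation_graph H \<and> G \<subseteq> H \<and> (x, u) \<in> H"
    by (rule derivation_graph_extend[OF G])
  thus ?thesis by blast
qed

lemma derivation_graph_extends_to_derivation:
  fixes G :: "('a::field_char_0 \<times> 'a) set"
  assumes G: "derivation_graph G"
  obtains D where "is_derivation D" "\<And>x y. (x, y) \<in> G \<Longrightarrow> D x = y"
proof -
  define S where "S = {H. derivation_graph H \<and> G \<subseteq> H}"
  have "\<exists>H\<in>S. \<forall>Y\<in>S. H \<subseteq> Y \<longrightarrow> Y = H"
  proof (rule subset_Zorn_nonempty)
    show "S \<noteq> {}" using G by (auto simp: S_def)
    fix \<C> assume C: "\<C> \<noteq> {}" "subset.chain S \<C>"
    have "\<C> \<subseteq> S" using C(2) by (simp add: subset_chain_def)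
    hence CS: "derivation_graph C" "G \<subseteq> C" if "C \<in> \<C>" for C
      using that by (auto simp: S_def)
    have two: "\<exists>C\<in>\<C>. a \<in> C \<and> b \<in> C" if "a \<in> \<Union>\<C>" "b \<in> \<Union>\<C>" for a b
      using that C(2) unfolding subset_chain_def by blast
    have "derivation_graph (\<Union>\<C>)" unfolding derivation_graph_def
    proof (intro conjI allI impI)
      obtain C' where C': "C' \<in> \<C>" using C(1) by blast
      show "(0, 0) \<in> \<Union>\<C>" by (rule UnionI[OF C' graph_0[OF CS(1)[OF C']]])
      show "(1, 0) \<in> \<Union>\<C>" by (rule UnionI[OF C' graph_1[OF CS(1)[OF C']]])
      fix x x' assume xx: "(x, x') \<in> \<Union>\<C>"
      then obtain C' where C': "C' \<in> \<C>" "(x, x') \<in> C'" by (rule UnionE)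
      show "(- x, - x') \<in> \<Union>\<C>"
        by (rule UnionI[OF C'(1) graph_uminus[OF CS(1)[OF C'(1)] C'(2)]])
      show "(inverse x, - x' / x\<^sup>2) \<in> \<Union>\<C>" if "x \<noteq> 0"
        by (rule UnionI[OF C'(1) graph_inverse[OF CS(1)[OF C'(1)] C'(2) that]])
      fix y y' assume yy: "(y, y') \<in> \<Union>\<C>"
      obtain C' where C': "C' \<in> \<C>" "(x, x') \<in> C'" "(y, y') \<in> C'" using two[OF xx yy] by (elim bexE conjE)
      show "(x + y, x' + y') \<in> \<Union>\<C>"
        by (rule UnionI[OF C'(1) graph_add[OF CS(1)[OF C'(1)] C'(2,3)]])
      show "(x * y, x' * y + x * y') \<in> \<Union>\<C>"
        by (rule UnionI[OF C'(1) graph_mult[OF CS(1)[OF C'(1)] C'(2,3)]])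
    next
      fix y assume "(0, y) \<in> \<Union>\<C>"
      then obtain C' where C': "C' \<in> \<C>" "(0, y) \<in> C'" by (rule UnionE)
      show "y = 0" by (rule graph_single0[OF CS(1)[OF C'(1)] C'(2)])
    qed
    moreover have "G \<subseteq> \<Union>\<C>" using C(1) CS(2) by blast
    ultimately show "\<Union>\<C> \<in> S" by (simp add: S_def)
  qed
  then obtain H where H: "derivation_graph H" "G \<subseteq> H"
      and max: "\<And>Y. derivation_graph Y \<Longrightarrow> G \<subseteq> Y \<Longrightarrow> H \<subseteq> Y \<Longrightarrow> Y = H"
    unfolding S_def by auto
  have "\<exists>u. (x, u) \<in> H" for x
  proof -
    obtain H' u where H': "derivation_graph H'" "H \<subseteq> H'" "(x, u) \<in> H'"
      using derivation_graph_extend_any[OF H(1), of x] by (elim exE conjE)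
    have "H' = H" using max[OF H'(1) _ H'(2)] H(2) H'(2) by (simp add: order_trans)
    thus ?thesis using H'(3) by auto
  qed
  hence "\<exists>D. \<forall>x. (x, D x) \<in> H" by (intro choice allI)
  then obtain D where "\<forall>x. (x, D x) \<in> H" ..
  hence D: "(x, D x) \<in> H" for x by simp
  have eq: "D x = y" if "(x, y) \<in> H" for x y
    by (rule graph_single[OF H(1) D that])
  have "is_derivation D" unfolding is_derivation_def
    by (intro conjI allI eq graph_add[OF H(1) D D] graph_mult[OF H(1) D D])
  thus ?thesis by (rule that) (use eq H(2) in auto)
qed

text \<open>Formulated along an embedding \<open>f\<close>, because a field and its algebraic
  closure are different types; \<open>D\<close> takes its values in the larger field already, and
  its graph over the image of \<open>f\<close> is extended.\<close>

lemma derivation_extension: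
  fixes D :: "'a::field_char_0 \<Rightarrow> 'b::field_char_0" and f :: "'a \<Rightarrow> 'b"
  assumes f: "f 1 = 1" "\<And>x y. f (x + y) = f x + f y" "\<And>x y. f (x * y) = f x * f y"
    and D: "\<And>x y. D (x + y) = D x + D y" "\<And>x y. D (x * y) = D x * f y + f x * D y"
  obtains D' where "is_derivation D'" "\<And>x. D' (f x) = D x"
proof -
  have f0: "f 0 = 0" using f(2)[of 0 0] by simp
  have fm: "f (- x) = - f x" for x using f(2)[of x "- x"] f0 by (simp add: add_eq_0_iff)
  have D0: "D 0 = 0" using D(1)[of 0 0] by simp
  have Dm: "D (- x) = - D x" for x using D(1)[of x "- x"] D0 by (simp add: add_eq_0_iff)
  have D1: "D 1 = 0" using D(2)[of 1 1] f by simp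
  have fi: "f (inverse x) = inverse (f x)" "f x \<noteq> 0" if "x \<noteq> 0" for x
  proof -
    have "f x * f (inverse x) = 1" using f(3)[of x "inverse x"] that f(1) by simp
    thus "f (inverse x) = inverse (f x)" "f x \<noteq> 0" using inverse_unique by fastforce+
  qed
  have Di: "D (inverse x) = - D x / (f x)\<^sup>2" if "x \<noteq> 0" for x
  proof -
    have "D x * inverse (f x) + f x * D (inverse x) = 0"
      using D(2)[of x "inverse x"] that D1 fi by simp
    thus ?thesis using fi(2)[OF that] by (simp add: field_simps power2_eq_square add_eq_0_iff)
  qed
  define G where "G = range (\<lambda>x. (f x, D x))"
  have GI: "(a, b) \<in> G" if "a = f x" "b = D x" for a b x using that by (auto simp: G_def)
  have "derivation_graph G" unfolding derivation_graph_def
  proof (intro conjI allI impI)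
    show "(0, 0) \<in> G" "(1, 0) \<in> G" using GI[of _ 0] GI[of _ 1] f0 D0 D1 f by auto
    fix a a' assume "(a, a') \<in> G"
    then obtain x where x: "a = f x" "a' = D x" by (auto simp: G_def)
    show "(- a, - a') \<in> G" using x by (intro GI[of _ "- x"]) (auto simp: fm Dm)
    { assume "a \<noteq> 0"
      hence "x \<noteq> 0" using x f0 by auto
      thus "(inverse a, - a' / a\<^sup>2) \<in> G" using x by (intro GI[of _ "inverse x"]) (auto simp: fi Di) }
    fix b b' assume "(b, b') \<in> G"
    then obtain y where y: "b = f y" "b' = D y" by (auto simp: G_def)
    show "(a + b, a' + b') \<in> G" using x y by (intro GI[of _ "x + y"]) (auto simp: f D)
    show "(a * b, a' * b + a * b') \<in> G" using x y by (intro GI[of _ "x * y"]) (auto simp: f D)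
  next
    fix y assume "(0, y) \<in> G"
    then obtain x where "f x = 0" "y = D x" by (auto simp: G_def)
    thus "y = 0" using fi(2)[of x] D0 by auto
  qed
  then obtain D' where "is_derivation D'" "\<And>x y. (x, y) \<in> G \<Longrightarrow> D' x = y"
    using derivation_graph_extends_to_derivation by metis
  thus ?thesis using that GI by blast
qed

text \<open>This is \<open>d/d\<theta>\<close>. The zero derivation on \<open>k\<close> imposes no
  condition on the derivative of a transcendental element, so the value \<open>1\<close> is
  allowed.\<close>

lemma derivation_wrt_transcendental:
  fixes k :: "'a::field_char_0 set"
  assumes k: "is_subfield k" and \<theta>: "\<not> algebraic_over k \<theta>"
  obtains d where "is_derivation d" "\<And>c. c \<in> k \<Longrightarrow> d c = 0" "d \<theta> = 1"
proof -
  note kR = subfield_imp_subring[OF k]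
  define G where "G = k \<times> {0::'a}"
  have G: "derivation_graph G" unfolding derivation_graph_def G_def
    by (auto simp: subring_0 subring_1 subring_add subring_mult subring_uminus kR subfield_inverse k)
  have "\<exists>H. derivation_graph H \<and> G \<subseteq> H \<and> (\<theta>, 1) \<in> H"
  proof (rule derivation_graph_extend[OF G])
    fix p q assume pq: "pair_over G p q" "poly p \<theta> = 0"
    have "p \<in> poly_over k" "q = 0" using pq(1)
      by (auto simp: pair_over_def G_def poly_over_def intro: poly_eqI)
    moreover from this have "p = 0" using \<theta> pq(2) by (auto simp: algebraic_over_iff)
    ultimately show "poly q \<theta> + poly (pderiv p) \<theta> * 1 = 0" by simp
  qed
  then obtain H where H: "derivation_graph H" "G \<subseteq> H" "(\<theta>, 1) \<in> H" by blast
  obtain d where d: "is_derivation d" "\<And>x y. (x, y) \<in> H \<Longrightarrow> d x = y"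
    using derivation_graph_extends_to_derivation[OF H(1)] by metis
  show ?thesis
    by (rule that[OF d(1)]) (use d(2) H(2,3) in \<open>auto simp: G_def\<close>)
qed

section \<open>Valued fields with Puiseux expansions\<close>

lemma of_rat_in_subfield:
  fixes k :: "'a::field_char_0 set"
  assumes k: "is_subfield k"
  shows "of_rat r \<in> k"
proof -
  note kR = subfield_imp_subring[OF k]
  have int: "of_int m \<in> k" for m
    by (cases m) (simp_all add: subring_of_nat[OF kR] subring_uminus[OF kR] subring_diff[OF kR] subring_1[OF kR] del: of_nat_Suc)
  obtain a b where ab: "r = Rat.Fract a b" "b > 0" by (cases r) auto
  show ?thesis unfolding ab(1)
    using ab(2) by (simp add: of_rat_rat subfield_divide[OF k] int)
qed

text \<open>Intended for rational powers: \<open>r \<mapsto> d (T r) / T r\<close> is additive,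
  hence determined by its value at \<open>1\<close>.\<close>

lemma additive_on_rat:
  fixes f :: "rat \<Rightarrow> 'a::field_char_0"
  assumes add: "\<And>r s. f (r + s) = f r + f s"
  shows "f r = of_rat r * f 1"
proof -
  have f0: "f 0 = 0" using add[of 0 0] by simp
  have nat: "f (of_nat n * r) = of_nat n * f r" for n r
    by (induction n) (auto simp: f0 add algebra_simps)
  have minus: "f (- r) = - f r" for r using add[of r "- r"] f0 by (simp add: add_eq_0_iff)
  have int: "f (of_int m) = of_int m * f 1" for m
  proof (cases m)
    case (nonneg n)
    thus ?thesis using nat[of n 1] by simp
  next
    case (neg n)
    have "f (of_int m) = f (- (of_nat (Suc n) * 1))" using neg by simp
    also have "\<dots> = - (of_nat (Suc n) * f 1)" by (simp only: minus nat)
    also have "\<dots> = of_int m * f 1" unfolding neg by (simp add: algebra_simps)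
    finally show ?thesis .
  qed
  obtain a b where ab: "r = Rat.Fract a b" "b > 0" by (cases r) auto
  have b: "of_nat (nat b) = (of_int b :: rat)" "of_nat (nat b) = (of_int b :: 'a)" using ab(2) by simp_all
  have "of_int b * r = of_int a" using ab by (simp add: Fract_of_int_quotient)
  hence "of_int b * f r = of_int a * f 1" using nat[of "nat b" r] int[of a] by (simp add: b)
  thus ?thesis using ab by (simp add: of_rat_rat field_simps)
qed

text \<open>\<open>T r\<close> plays the role of \<open>t\<close> to the power \<open>r\<close> for
  a fixed parameter \<open>t = T 1\<close> of value \<open>1\<close>. The clause
  \<open>leading_term\<close> says that the residue field is \<open>k\<close>; its case
  \<open>x = c * T (v x)\<close> is separate since \<open>v 0\<close> carries no
  information.\<close>

locale puiseux_valuation =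
  fixes k :: "'a::{alg_closed_field, field_char_0} set" and T :: "rat \<Rightarrow> 'a" and v :: "'a \<Rightarrow> rat"
  assumes k: "is_subfield k"
    and T_add: "T (r + s) = T r * T s"
    and T_0: "T 0 = 1"
    and v_mult: "x \<noteq> 0 \<Longrightarrow> y \<noteq> 0 \<Longrightarrow> v (x * y) = v x + v y"
    and v_add: "x \<noteq> 0 \<Longrightarrow> y \<noteq> 0 \<Longrightarrow> x + y \<noteq> 0 \<Longrightarrow> min (v x) (v y) \<le> v (x + y)"
    and v_k: "c \<in> k \<Longrightarrow> c \<noteq> 0 \<Longrightarrow> v c = 0"
    and v_T: "v (T r) = r"
    and leading_term: "x \<noteq> 0 \<Longrightarrow>
      \<exists>c\<in>k. c \<noteq> 0 \<and> (x = c * T (v x) \<or> v (x - c * T (v x)) > v x)"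
    and algebraic: "algebraic_over (field_adjoin k (T 1)) x"
begin

lemmas kR = subfield_imp_subring[OF k]

lemma T_nonzero: "T r \<noteq> 0"
  using T_add[of r "- r"] T_0 by auto

text \<open>\<open>v 0\<close> is a junk value, hence the predicates \<open>vge\<close> and \<open>vgt\<close>, for which \<open>0\<close> has valuation \<open>\<infinity>\<close>.\<close>

definition vge :: "'a \<Rightarrow> rat \<Rightarrow> bool" where "vge x r \<longleftrightarrow> x = 0 \<or> r \<le> v x"
definition vgt :: "'a \<Rightarrow> rat \<Rightarrow> bool" where "vgt x r \<longleftrightarrow> x = 0 \<or> r < v x"

lemma v_1: "v 1 = 0" using v_k[OF subring_1[OF kR]] by simp

lemma v_uminus: "v (- x) = v x"
proof (cases "x = 0")
  case False
  have "v (- 1) = 0" by (rule v_k) (auto intro: subring_uminus[OF kR] subring_1[OF kR])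
  thus ?thesis using v_mult[of "- 1" x] False by simp
qed simp

lemma v_inverse: "x \<noteq> 0 \<Longrightarrow> v (inverse x) = - v x"
  using v_mult[of x "inverse x"] v_1 by simp

lemma v_divide: "x \<noteq> 0 \<Longrightarrow> y \<noteq> 0 \<Longrightarrow> v (x / y) = v x - v y"
  using v_mult[of x "inverse y"] v_inverse[of y] by (simp add: divide_inverse)

lemma vge_0: "vge 0 r" and vgt_0: "vgt 0 r" by (simp_all add: vge_def vgt_def)
lemma vge_v: "vge x (v x)" by (simp add: vge_def)
lemma vge_mono: "vge x r \<Longrightarrow> s \<le> r \<Longrightarrow> vge x s" by (auto simp: vge_def)
lemma vge_imp_vgt: "vge x r \<Longrightarrow> s < r \<Longrightarrow> vgt x s" by (auto simp: vge_def vgt_def)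

lemma vge_uminus: "vge x r \<Longrightarrow> vge (- x) r"
  by (auto simp: vge_def v_uminus)

lemma vge_add: "vge x r \<Longrightarrow> vge y r \<Longrightarrow> vge (x + y) r"
  using v_add[of x y] by (cases "x = 0"; cases "y = 0"; cases "x + y = 0") (auto simp: vge_def)

lemma vgt_add: "vgt x r \<Longrightarrow> vgt y r \<Longrightarrow> vgt (x + y) r"
  using v_add[of x y] by (cases "x = 0"; cases "y = 0"; cases "x + y = 0") (auto simp: vgt_def)

lemma vgt_uminus: "vgt x r \<Longrightarrow> vgt (- x) r"
  by (auto simp: vgt_def v_uminus)

lemma vge_diff: "vge x r \<Longrightarrow> vge y r \<Longrightarrow> vge (x - y) r"
  using vge_add[of x r "- y"] vge_uminus[of y] by simp

lemma vgt_diff: "vgt x r \<Longrightarrow> vgt y r \<Longrightarrow> vgt (x - y) r"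
  using vgt_add[of x r "- y"] vgt_uminus[of y] by simp

lemma vge_mult: "vge x r \<Longrightarrow> vge y s \<Longrightarrow> vge (x * y) (r + s)"
  by (cases "x = 0"; cases "y = 0") (auto simp: vge_def v_mult)

lemma vge_mult0: "vge x 0 \<Longrightarrow> vge y s \<Longrightarrow> vge (x * y) s"
  using vge_mult[of x 0 y s] by simp

lemma vgt_mult: "vge x r \<Longrightarrow> vgt y s \<Longrightarrow> vgt (x * y) (r + s)"
  by (cases "x = 0"; cases "y = 0") (auto simp: vge_def vgt_def v_mult)

lemma vge_divide: "vge x r \<Longrightarrow> y \<noteq> 0 \<Longrightarrow> vge (x / y) (r - v y)"
  by (cases "x = 0") (auto simp: vge_def v_divide)

lemma vge_sum: "(\<And>i. i \<in> I \<Longrightarrow> vge (f i) r) \<Longrightarrow> vge (sum f I) r"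
  by (induction I rule: infinite_finite_induct) (auto intro: vge_add vge_0)

lemma vgt_sum: "(\<And>i. i \<in> I \<Longrightarrow> vgt (f i) r) \<Longrightarrow> vgt (sum f I) r"
  by (induction I rule: infinite_finite_induct) (auto intro: vgt_add vgt_0)

lemma vge_sum_mset: "(\<And>a. a \<in># M \<Longrightarrow> vge (f a) r) \<Longrightarrow> vge (\<Sum>a\<in>#M. f a) r"
  by (induction M) (auto intro: vge_add vge_0)

lemma vge_k: "c \<in> k \<Longrightarrow> vge c 0"
  by (cases "c = 0") (auto simp: vge_def v_k)

lemma vge_T: "vge (T r) r"
  by (simp add: vge_def v_T)

lemma vge_kT: "c \<in> k \<Longrightarrow> vge (c * T r) r"
  by (intro vge_mult0 vge_k vge_T)

lemma v_dominant:
  assumes x: "x \<noteq> 0" and h: "vgt h (v x)"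
  shows "x + h \<noteq> 0" "v (x + h) = v x"
proof -
  show nz: "x + h \<noteq> 0"
  proof
    assume "x + h = 0"
    hence "h = - x" by (simp add: add_eq_0_iff)
    thus False using h x by (simp add: vgt_def v_uminus)
  qed
  show "v (x + h) = v x"
  proof (cases "h = 0")
    case False
    hence "v x < v h" using h by (simp add: vgt_def)
    moreover have "min (v x) (v h) \<le> v (x + h)" by (rule v_add[OF x False nz])
    moreover have "min (v (x + h)) (v (- h)) \<le> v (x + h + - h)"
      by (rule v_add) (use False nz x in auto)
    ultimately show ?thesis by (simp add: v_uminus)
  qed simp
qed

lemma leading_termE:
  assumes "x \<noteq> 0"
  obtains c where "c \<in> k" "c \<noteq> 0" "vgt (x - c * T (v x)) (v x)"
  using leading_term[OF assms] by (auto simp: vgt_def)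

section \<open>Finite Puiseux sums and their closure\<close>

definition puiseux_poly :: "'a set" where
  "puiseux_poly = {\<Sum>r\<in>A. c r * T r |A c. finite A \<and> (\<forall>r. c r \<in> k)}"

lemma puiseux_polyI: "finite A \<Longrightarrow> (\<And>r. c r \<in> k) \<Longrightarrow> (\<Sum>r\<in>A. c r * T r) \<in> puiseux_poly"
  unfolding puiseux_poly_def by blast

lemma puiseux_polyE:
  assumes "q \<in> puiseux_poly"
  obtains A c where "finite A" "\<And>r. c r \<in> k" "\<And>r. r \<notin> A \<Longrightarrow> c r = 0" "q = (\<Sum>r\<in>A. c r * T r)"
proof -
  obtain A c where A: "finite A" "\<And>r. c r \<in> k" "q = (\<Sum>r\<in>A. c r * T r)"
    using assms unfolding puiseux_poly_def by auto
  show ?thesis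
    by (rule that[of A "\<lambda>r. if r \<in> A then c r else 0"]) (use A subring_0[OF kR] in auto)
qed

lemma monomial_in_puiseux_poly: "c \<in> k \<Longrightarrow> c * T r \<in> puiseux_poly"
  using puiseux_polyI[of "{r}" "\<lambda>_. c"] by simp

lemma k_in_puiseux_poly: "c \<in> k \<Longrightarrow> c \<in> puiseux_poly"
  using monomial_in_puiseux_poly[of c 0] by (simp add: T_0)

lemma puiseux_poly_add:
  assumes "p \<in> puiseux_poly" "q \<in> puiseux_poly"
  shows "p + q \<in> puiseux_poly"
proof -
  obtain A c where A: "finite A" "\<And>r. c r \<in> k" "\<And>r. r \<notin> A \<Longrightarrow> c r = 0" "p = (\<Sum>r\<in>A. c r * T r)"
    by (rule puiseux_polyE[OF assms(1)]) blast
  obtain B d where B: "finite B" "\<And>r. d r \<in> k" "\<And>r. r \<notin> B \<Longrightarrow> d r = 0" "q = (\<Sum>r\<in>B. d r * T r)"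
    by (rule puiseux_polyE[OF assms(2)]) blast
  have "p = (\<Sum>r\<in>A \<union> B. c r * T r)" unfolding A(4)
    by (rule sum.mono_neutral_left) (use A B in auto)
  moreover have "q = (\<Sum>r\<in>A \<union> B. d r * T r)" unfolding B(4)
    by (rule sum.mono_neutral_left) (use A B in auto)
  ultimately have "p + q = (\<Sum>r\<in>A \<union> B. (c r + d r) * T r)"
    by (simp add: sum.distrib algebra_simps)
  thus ?thesis using puiseux_polyI[of "A \<union> B" "\<lambda>r. c r + d r"] A B subring_add[OF kR] by simp
qed

lemma puiseux_poly_sum: "(\<And>i. i \<in> I \<Longrightarrow> f i \<in> puiseux_poly) \<Longrightarrow> sum f I \<in> puiseux_poly"
  by (induction I rule: infinite_finite_induct)
    (auto intro: puiseux_poly_add k_in_puiseux_poly subring_0[OF kR])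

lemma puiseux_poly_mult:
  assumes "p \<in> puiseux_poly" "q \<in> puiseux_poly"
  shows "p * q \<in> puiseux_poly"
proof -
  obtain A c where A: "finite A" "\<And>r. c r \<in> k" "p = (\<Sum>r\<in>A. c r * T r)"
    using puiseux_polyE[OF assms(1)] by metis
  obtain B d where B: "finite B" "\<And>r. d r \<in> k" "q = (\<Sum>r\<in>B. d r * T r)"
    using puiseux_polyE[OF assms(2)] by metis
  have "p * q = (\<Sum>r\<in>A. \<Sum>s\<in>B. (c r * d s) * T (r + s))"
    unfolding A B sum_product by (simp add: T_add mult_ac)
  also have "\<dots> \<in> puiseux_poly"
    by (intro puiseux_poly_sum monomial_in_puiseux_poly subring_mult[OF kR] A B)
  finally show ?thesis .
qed

lemma puiseux_poly_subring: "is_subring puiseux_poly"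
  unfolding is_subring_def
proof (intro conjI ballI)
  show "0 \<in> puiseux_poly" "1 \<in> puiseux_poly"
    by (auto intro: k_in_puiseux_poly subring_0[OF kR] subring_1[OF kR])
  fix x assume x: "x \<in> puiseux_poly"
  have "- 1 \<in> puiseux_poly" by (intro k_in_puiseux_poly subring_uminus[OF kR] subring_1[OF kR])
  thus "- x \<in> puiseux_poly" using puiseux_poly_mult[OF _ x, of "- 1"] by simp
qed (auto intro: puiseux_poly_add puiseux_poly_mult)

text \<open>Distinct exponents cannot cancel: the term with the least exponent and nonzero
  coefficient decides the value of the sum.\<close>

lemma puiseux_poly_vge_coeff:
  assumes A: "finite A" and c: "\<And>r. c r \<in> k" and q: "vge (\<Sum>r\<in>A. c r * T r) \<rho>"
    and r: "r \<in> A" "c r \<noteq> 0"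
  shows "\<rho> \<le> r"
proof -
  define B where "B = {r\<in>A. c r \<noteq> 0}"
  have B: "finite B" "B \<noteq> {}" using A r by (auto simp: B_def)
  define r0 where "r0 = Min B"
  have r0: "r0 \<in> B" "\<And>s. s \<in> B \<Longrightarrow> r0 \<le> s" using B by (auto simp: r0_def)
  have "(\<Sum>r\<in>A. c r * T r) = (\<Sum>r\<in>B. c r * T r)"
    by (rule sum.mono_neutral_right) (use A in \<open>auto simp: B_def\<close>)
  also have "\<dots> = c r0 * T r0 + (\<Sum>r\<in>B - {r0}. c r * T r)"
    by (rule sum.remove) (use B r0 in auto)
  finally have eq: "(\<Sum>r\<in>A. c r * T r) = c r0 * T r0 + (\<Sum>r\<in>B - {r0}. c r * T r)" .
  have c0: "c r0 \<noteq> 0" using r0 by (simp add: B_def)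
  have v0: "v (c r0 * T r0) = r0" using c0 T_nonzero v_k[OF c c0] by (simp add: v_mult v_T)
  have h: "vgt (\<Sum>r\<in>B - {r0}. c r * T r) (v (c r0 * T r0))"
    unfolding v0
  proof (intro vgt_sum)
    fix s assume "s \<in> B - {r0}"
    hence "r0 < s" using r0(2)[of s] by auto
    thus "vgt (c s * T s) r0" using vge_kT[OF c] vge_imp_vgt by blast
  qed
  have "c r0 * T r0 \<noteq> 0" using c0 T_nonzero by simp
  from v_dominant[OF this h] q have "\<rho> \<le> r0" unfolding eq vge_def v0 by simp
  also have "r0 \<le> r" using r by (intro r0(2)) (simp add: B_def)
  finally show ?thesis .
qed

text \<open>The topological closure for \<open>v\<close>, taken inside the given field.\<close>

definition puiseux_closure :: "'a set" where
  "puiseux_closure = {x. \<forall>N. \<exists>q\<in>puiseux_poly. vge (x - q) N}"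

lemma puiseux_poly_subset_closure: "q \<in> puiseux_poly \<Longrightarrow> q \<in> puiseux_closure"
  unfolding puiseux_closure_def using vge_0 by (auto intro!: bexI[of _ q])

lemma puiseux_closure_closed:
  assumes "\<And>N. \<exists>y\<in>puiseux_closure. vge (x - y) N"
  shows "x \<in> puiseux_closure"
  unfolding puiseux_closure_def
proof (intro CollectI allI)
  fix N
  obtain y where y: "y \<in> puiseux_closure" "vge (x - y) N" using assms by blast
  obtain q where q: "q \<in> puiseux_poly" "vge (y - q) N" using y(1) unfolding puiseux_closure_def by blast
  have "vge (x - q) N" using vge_add[OF y(2) q(2)] by simp
  thus "\<exists>q\<in>puiseux_poly. vge (x - q) N" using q(1) by blast
qed

lemma puiseux_closureE:
  assumes "x \<in> puiseux_closure"
  obtains q where "q \<in> puiseux_poly" "vge (x - q) N"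
  using assms unfolding puiseux_closure_def by blast

lemma puiseux_closure_subring: "is_subring puiseux_closure"
proof -
  have add: "x + y \<in> puiseux_closure" if x: "x \<in> puiseux_closure" and y: "y \<in> puiseux_closure" for x y
    unfolding puiseux_closure_def
  proof (intro CollectI allI)
    fix N
    obtain p where p: "p \<in> puiseux_poly" "vge (x - p) N" by (rule puiseux_closureE[OF x])
    obtain q where q: "q \<in> puiseux_poly" "vge (y - q) N" by (rule puiseux_closureE[OF y])
    have "vge (x + y - (p + q)) N" using vge_add[OF p(2) q(2)] by (simp add: algebra_simps)
    thus "\<exists>q\<in>puiseux_poly. vge (x + y - q) N" using puiseux_poly_add[OF p(1) q(1)] by blast
  qed
  have mult: "x * y \<in> puiseux_closure" if x: "x \<in> puiseux_closure" and y: "y \<in> puiseux_closure" for x y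
    unfolding puiseux_closure_def
  proof (intro CollectI allI)
    fix N
    obtain p where p: "p \<in> puiseux_poly" "vge (x - p) (N - v y)" by (rule puiseux_closureE[OF x])
    obtain q where q: "q \<in> puiseux_poly" "vge (y - q) (max (N - v x) (v y))" by (rule puiseux_closureE[OF y])
    have "vge (y - (y - q)) (v y)" by (intro vge_diff vge_v vge_mono[OF q(2)]) simp
    hence "vge ((x - p) * q) (N - v y + v y)" by (intro vge_mult p) simp
    moreover have "vge (x * (y - q)) (v x + (N - v x))" by (intro vge_mult vge_v vge_mono[OF q(2)]) simp
    ultimately have "vge (x * (y - q) + (x - p) * q) N" by (intro vge_add) simp_all
    hence "vge (x * y - p * q) N" by (simp add: algebra_simps)
    thus "\<exists>q\<in>puiseux_poly. vge (x * y - q) N" using puiseux_poly_mult[OF p(1) q(1)] by blast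
  qed
  have "- 1 \<in> puiseux_closure" "0 \<in> puiseux_closure" "1 \<in> puiseux_closure"
    by (auto intro!: puiseux_poly_subset_closure subring_0[OF puiseux_poly_subring]
        subring_1[OF puiseux_poly_subring] subring_uminus[OF puiseux_poly_subring])
  moreover have "- x \<in> puiseux_closure" if "x \<in> puiseux_closure" for x
    using mult[OF \<open>- 1 \<in> puiseux_closure\<close> that] by simp
  ultimately show ?thesis unfolding is_subring_def using add mult by simp
qed

lemma archimedean_multiple:
  assumes "(0::rat) < \<delta>"
  obtains n where "N \<le> of_nat n * \<delta>"
  using ex_less_of_nat_mult[OF assms, of N] that less_imp_le by blast

lemma vge_power: "vge x r \<Longrightarrow> vge (x ^ n) (of_nat n * r)"
proof (induction n)
  case 0
  show ?case by (simp add: vge_def v_1)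
next
  case (Suc n)
  thus ?case using vge_mult[of x r "x ^ n" "of_nat n * r"] by (simp add: algebra_simps)
qed

text \<open>After division by its leading term \<open>x\<close> becomes \<open>1 - u\<close> with
  \<open>u\<close> of positive value, and partial sums of the geometric series approximate the
  inverse.\<close>

lemma puiseux_closure_inverse:
  assumes x: "x \<in> puiseux_closure" "x \<noteq> 0"
  shows "inverse x \<in> puiseux_closure"
proof -
  note LR = puiseux_closure_subring
  obtain c where c: "c \<in> k" "c \<noteq> 0" "vgt (x - c * T (v x)) (v x)" by (rule leading_termE[OF x(2)])
  define z where "z = c * T (v x)"
  define w where "w = inverse c * T (- v x)"
  have zw: "z * w = 1" using c T_add[of "v x" "- v x"] by (simp add: z_def w_def T_0 field_simps)
  have wL: "w \<in> puiseux_closure" unfolding w_def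
    by (intro puiseux_poly_subset_closure monomial_in_puiseux_poly subfield_inverse[OF k] c)
  have z0: "z \<noteq> 0" using zw by auto
  have w0: "w \<noteq> 0" using zw by auto
  have vw: "v w = - v x" using c T_nonzero v_k[OF subfield_inverse[OF k c(1)]]
    by (simp add: w_def v_mult v_T)
  define u where "u = 1 - x * w"
  have u: "u = - ((x - z) * w)" using zw by (simp add: u_def algebra_simps)
  have uL: "u \<in> puiseux_closure" unfolding u_def
    by (intro subring_diff[OF LR] subring_mult[OF LR] subring_1[OF LR] x wL)
  have "vgt ((x - z) * w) (v x + v w)"
    using vgt_mult[OF vge_v[of w] c(3)] by (simp add: z_def mult.commute add.commute)
  hence ug: "vgt u 0" using vgt_uminus[of "(x - z) * w"] by (simp add: u vw)
  \<comment> \<open>The rate of convergence must be positive even for \<open>u = 0\<close>, where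
    \<open>v u\<close> is meaningless; then \<open>1\<close> serves.\<close>
  obtain \<delta> where \<delta>: "0 < \<delta>" "vge u \<delta>"
  proof (cases "u = 0")
    case True
    thus ?thesis using that[of 1] by (simp add: vge_0)
  next
    case False
    thus ?thesis using that[of "v u"] ug by (simp add: vgt_def vge_v)
  qed
  have xw: "x * w = 1 - u" by (simp add: u_def)
  have xi: "inverse x = w * inverse (1 - u)" using x(2) w0 by (simp add: xw[symmetric])
  have u1: "1 - u \<noteq> 0" using x(2) w0 by (simp add: xw[symmetric])
  have v1: "v (1 - u) = 0"
    using v_dominant(2)[of 1 "- u"] ug by (simp add: v_1 vgt_uminus)
  show ?thesis
  proof (rule puiseux_closure_closed)
    fix N
    obtain n where n: "N + v x \<le> of_nat n * \<delta>" by (rule archimedean_multiple[OF \<delta>(1)])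
    define y where "y = w * (\<Sum>j<n. u ^ j)"
    have "y \<in> puiseux_closure" unfolding y_def
      by (intro subring_mult[OF LR] subring_sum[OF LR] subring_power[OF LR] wL uL)
    moreover have "inverse x - y = w * (u ^ n / (1 - u))"
    proof -
      have "(1 - u) * (\<Sum>j<n. u ^ j) = 1 - u ^ n" by (simp add: one_diff_power_eq)
      hence "(\<Sum>j<n. u ^ j) = (1 - u ^ n) / (1 - u)" using u1 by (simp add: field_simps)
      moreover have "inverse (1 - u) - (1 - u ^ n) / (1 - u) = u ^ n / (1 - u)"
        by (simp add: diff_divide_distrib inverse_eq_divide)
      ultimately show ?thesis by (simp only: xi y_def flip: right_diff_distrib)
    qed
    moreover have "vge (w * (u ^ n / (1 - u))) (v w + (of_nat n * \<delta> - v (1 - u)))"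
      by (intro vge_mult vge_v vge_divide vge_power \<delta> u1)
    ultimately show "\<exists>y\<in>puiseux_closure. vge (inverse x - y) N"
      using n by (intro bexI[of _ y]) (auto simp: v1 vw elim: vge_mono)
  qed
qed

lemma puiseux_closure_subfield: "is_subfield puiseux_closure"
  using puiseux_closure_subring puiseux_closure_inverse
  unfolding is_subfield_def is_subring_def by simp

end

section \<open>Coefficients of split polynomials\<close>

lemma pcompose_prod_mset:
  "pcompose (\<Prod>a\<in>#M. f a) (p :: 'a::comm_ring_1 poly) = (\<Prod>a\<in>#M. pcompose (f a) p)"
  by (induction M) (simp_all add: pcompose_mult pcompose_1)

lemma prod_mset_smult:
  "(\<Prod>a\<in>#M. smult (f a) (g a)) = smult (\<Prod>a\<in>#M. f a) (\<Prod>a\<in>#M. g a :: 'a::comm_ring_1 poly)"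
  by (induction M) (simp_all add: mult_ac)

text \<open>Vieta's formulas for the two top coefficients; the second will deliver the sum of the
  roots in a cluster.\<close>

lemma prod_mset_linear_coeffs:
  fixes f :: "'b \<Rightarrow> 'a::comm_ring_1"
  defines "P \<equiv> \<lambda>M. \<Prod>a\<in>#M. [:- f a, 1:]"
  shows "coeff (P M) (size M) = 1"
    and "M \<noteq> {#} \<Longrightarrow> coeff (P M) (size M - 1) = - (\<Sum>a\<in>#M. f a)"
proof -
  have rec: "P (add_mset a M) = smult (- f a) (P M) + pCons 0 (P M)" for a M
    by (simp add: P_def)
  have top: "coeff (P M) i = (if i = size M then 1 else 0)" if "i \<ge> size M" for M i
    using that
  proof (induction M arbitrary: i)
    case empty
    show ?case by (simp add: P_def)
  next
    case (add a M)
    obtain j where j: "i = Suc j" using add.prems by (cases i) auto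
    show ?case using add.IH[of "Suc j"] add.IH[of j] add.prems unfolding rec j by simp
  qed
  show "coeff (P M) (size M) = 1"
    using top[of M "size M"] by simp
  show "coeff (P M) (size M - 1) = - (\<Sum>a\<in>#M. f a)" if "M \<noteq> {#}"
    using that
  proof (induction M)
    case (add a M)
    show ?case
    proof (cases "M = {#}")
      case True
      thus ?thesis by (simp add: P_def)
    next
      case False
      then obtain m where m: "size M = Suc m" by (metis size_eq_0_iff_empty not0_implies_Suc)
      show ?thesis using add.IH[OF False] top[of M "Suc m"] m unfolding rec by simp
    qed
  qed simp
qed

context puiseux_valuation
begin

text \<open>A lower bound for the Gauss valuation, phrased without a minimum so that
  \<open>p = 0\<close> needs no convention.\<close>

definition pvge :: "'a poly \<Rightarrow> rat \<Rightarrow> bool" where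
  "pvge p r \<longleftrightarrow> (\<forall>i. vge (coeff p i) r)"

lemma pvge_mult: "pvge p r \<Longrightarrow> pvge q s \<Longrightarrow> pvge (p * q) (r + s)"
  unfolding pvge_def coeff_mult by (intro allI vge_sum vge_mult) simp_all

lemma pvge_add: "pvge p r \<Longrightarrow> pvge q r \<Longrightarrow> pvge (p + q) r"
  unfolding pvge_def coeff_add by (intro allI vge_add) simp_all

lemma pvge_pCons: "pvge (pCons a p) r \<longleftrightarrow> vge a r \<and> pvge p r"
  unfolding pvge_def by (auto simp: coeff_pCons split: nat.splits)

lemma pvge_0: "pvge 0 r"
  by (simp add: pvge_def vge_0)

lemma pvge_mono: "pvge p r \<Longrightarrow> s \<le> r \<Longrightarrow> pvge p s"
  unfolding pvge_def using vge_mono by blast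

lemma pvge_1: "pvge 1 0"
  by (simp add: one_pCons pvge_pCons pvge_0 vge_def v_1)

lemma pvge_prod_monic:
  "(\<And>a. a \<in># M \<Longrightarrow> vge (f a) 0) \<Longrightarrow> pvge (\<Prod>a\<in>#M. [:- f a, 1:]) 0"
proof (induction M)
  case (add a M)
  have "pvge [:- f a, 1:] 0"
    using add.prems[of a] by (simp add: pvge_pCons pvge_0 vge_uminus) (simp add: vge_def v_1)
  from pvge_mult[OF this add.IH] show ?case using add.prems by simp
qed (simp add: pvge_1)

lemma pvge_prod_unit:
  assumes "0 \<le> r" "\<And>a. a \<in># M \<Longrightarrow> vge (f a) r"
  shows "pvge ((\<Prod>a\<in>#M. [:1, - f a:]) - 1) r"
  using assms(2)
proof (induction M)
  case (add a M)
  define p where "p = (\<Prod>a\<in>#M. [:1, - f a:])"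
  have p: "pvge (p - 1) r" unfolding p_def using add by simp
  have "pvge (p - 1 + 1) 0" by (intro pvge_add pvge_1 pvge_mono[OF p] assms(1))
  hence "pvge p 0" by simp
  moreover have "pvge [:0, - f a:] r" using add.prems[of a] by (simp add: pvge_pCons pvge_0 vge_0 vge_uminus)
  ultimately have "pvge ([:0, - f a:] * p) r" using pvge_mult[of "[:0, - f a:]" r p 0] by simp
  from pvge_add[OF p this] show ?case by (simp add: p_def algebra_simps)
qed (simp add: pvge_0)

text \<open>Newton-Puiseux: given \<open>q\<close> in the closure near \<open>x\<close>, let \<open>C\<close> be the roots that are at least
  as close to \<open>x\<close> as \<open>q\<close>. Comparing two adjacent coefficients of the polynomial recentred at \<open>q\<close>
  gives the barycentre of \<open>C\<close> up to an error that is smaller than \<open>x - q\<close> by a definite amount,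
  and once \<open>C\<close> no longer shrinks this contradicts that the valuations of \<open>x - q\<close> are bounded.\<close>

theorem puiseux_closure_eq_UNIV: "x \<in> puiseux_closure"
proof (rule ccontr)
  assume nx: "x \<notin> puiseux_closure"
  let ?L = puiseux_closure
  note L = puiseux_closure_subfield and LR = puiseux_closure_subring
  define V where "V q = v (x - q)" for q
  obtain N where N: "\<And>q. q \<in> ?L \<Longrightarrow> \<not> vge (x - q) N"
    using puiseux_closure_closed[of x] nx by blast
  have xq: "x - q \<noteq> 0" "V q < N" if "q \<in> ?L" for q
    using N[OF that] by (auto simp: vge_def V_def)
  \<comment> \<open>Subtracting the leading term of the error strictly improves an approximation, so
    the supremum \<open>S\<close> below is not attained. It is real because bounded sets of
    rationals need not have a rational supremum.\<close>
  have better: "\<exists>q'\<in>?L. V q < V q'" if q: "q \<in> ?L" for q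
  proof -
    obtain c where c: "c \<in> k" "vgt (x - q - c * T (V q)) (V q)"
      using leading_termE[OF xq(1)[OF q]] unfolding V_def by metis
    have q': "q + c * T (V q) \<in> ?L"
      by (intro subring_add[OF LR] q puiseux_poly_subset_closure monomial_in_puiseux_poly c)
    have "V q < V (q + c * T (V q))"
      using c(2) xq(1)[OF q'] by (simp add: vgt_def V_def algebra_simps)
    thus ?thesis using q' by blast
  qed
  define S where "S = (SUP q\<in>?L. real_of_rat (V q))"
  have bdd: "bdd_above ((\<lambda>q. real_of_rat (V q)) ` ?L)"
    by (rule bdd_aboveI[of _ "real_of_rat N"]) (use xq(2) in \<open>auto simp: of_rat_less_eq less_imp_le\<close>)
  have S_ub: "real_of_rat (V q) < S" if q: "q \<in> ?L" for q
  proof -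
    obtain q' where q': "q' \<in> ?L" "V q < V q'" using better[OF q] by blast
    have "real_of_rat (V q) < real_of_rat (V q')" using q'(2) by (simp add: of_rat_less)
    also have "\<dots> \<le> S" unfolding S_def by (rule cSUP_upper[OF q'(1) bdd])
    finally show ?thesis .
  qed
  have "field_adjoin k (T 1) \<subseteq> ?L"
    using monomial_in_puiseux_poly[OF subring_1[OF kR], of 1] k_in_puiseux_poly
    by (intro field_adjoin_least[OF L]) (auto intro: puiseux_poly_subset_closure)
  hence "algebraic_over ?L x" using algebraic_over_mono algebraic by blast
  then obtain P where P: "P \<in> poly_over ?L" "P \<noteq> 0" "poly P x = 0"
    unfolding algebraic_over_iff by blast
  obtain A where A: "P = smult (lead_coeff P) (\<Prod>a\<in>#A. [:- a, 1:])"
    using alg_closed_imp_factorization[OF P(2)] by blast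
  have xA: "x \<in># A"
  proof -
    have "poly (\<Prod>a\<in>#A. [:- a, 1:]) x = 0" using P A by (metis poly_smult mult_eq_0_iff leading_coeff_0_iff)
    thus ?thesis by (auto simp: poly_prod_mset)
  qed
  define cl where "cl q = filter_mset (\<lambda>a. vge (a - x) (V q)) A" for q
  \<comment> \<open>\<open>q0\<close> minimises the number of roots in its cluster; clusters shrink
    as approximations improve, so from \<open>q0\<close> on they are all equal.\<close>
  have "\<exists>q0. q0 \<in> ?L \<and> (\<forall>q. q \<in> ?L \<longrightarrow> size (cl q0) \<le> size (cl q))"
    by (rule ex_has_least_nat[of _ 0]) (rule subring_0[OF LR])
  then obtain q0 where q0: "q0 \<in> ?L" "\<And>q. q \<in> ?L \<Longrightarrow> size (cl q0) \<le> size (cl q)" by blast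
  have cl_eq: "cl q = cl q0" if q: "q \<in> ?L" "V q0 \<le> V q" for q
  proof -
    have "cl q \<subseteq># cl q0" unfolding cl_def
      by (rule filter_mset_mono_strong) (use q(2) in \<open>auto elim: vge_mono\<close>)
    moreover have "\<not> cl q \<subset># cl q0" using q0(2)[OF q(1)] mset_subset_size by (metis leD)
    ultimately show ?thesis by (simp add: subset_mset.less_le)
  qed
  \<comment> \<open>Beyond the midpoint between \<open>V q0\<close> and \<open>S\<close>, the gap
    \<open>\<gamma>\<close> back to \<open>q0\<close> exceeds what is left up to \<open>S\<close>;
    hence no approximation gains \<open>\<gamma>\<close> over \<open>q\<close>.\<close>
  have "(S + real_of_rat (V q0)) / 2 < S" using S_ub[OF q0(1)] by simp
  then obtain q where q: "q \<in> ?L" "(S + real_of_rat (V q0)) / 2 < real_of_rat (V q)"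
    unfolding S_def using less_cSUP_iff[OF _ bdd] q0(1) by (metis (no_types, lifting) empty_iff)
  define \<nu> where "\<nu> = V q"
  define \<gamma> where "\<gamma> = \<nu> - V q0"
  have "real_of_rat (V q0) < real_of_rat \<nu>" using q(2) S_ub[OF q0(1)] by (simp add: \<nu>_def)
  hence \<gamma>: "0 < \<gamma>" by (simp add: \<gamma>_def of_rat_less)
  have "S < real_of_rat (\<nu> + \<gamma>)" using q(2) unfolding \<nu>_def \<gamma>_def of_rat_add of_rat_diff by simp
  hence gain: "V q' < \<nu> + \<gamma>" if "q' \<in> ?L" for q'
    using S_ub[OF that] by (metis less_trans of_rat_less)
  define C where "C = cl q0"
  define C' where "C' = filter_mset (\<lambda>a. \<not> vge (a - x) (V q0)) A"
  have AC: "A = C + C'" unfolding C_def C'_def cl_def by (rule multiset_partition)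
  have clC: "vge (a - x) (V q'')" if "q'' \<in> ?L" "\<nu> \<le> V q''" "a \<in># C" for q'' a
  proof -
    have "V q0 \<le> V q''" using that(2) \<gamma> by (simp add: \<gamma>_def)
    hence "a \<in># cl q''" using cl_eq[OF that(1)] that(3) by (simp add: C_def)
    thus ?thesis by (simp add: cl_def)
  qed
  have xC: "x \<in># C" using xA by (simp add: C_def cl_def vge_0)
  define r where "r = size C"
  have r0: "r > 0" using xC by (auto simp: r_def nonempty_has_size[symmetric])
  define y where "y = T \<nu>"
  have y0: "y \<noteq> 0" and vy: "v y = \<nu>" by (simp_all add: y_def T_nonzero v_T)
  have yL: "y \<in> ?L" unfolding y_def
    using monomial_in_puiseux_poly[OF subring_1[OF kR], of \<nu>] by (simp add: puiseux_poly_subset_closure)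
  \<comment> \<open>In the variable centred at \<open>q\<close> and scaled by \<open>y\<close>, the
    roots in the cluster become the integral \<open>u a\<close>, while \<open>w a\<close> is the
    reciprocal of a rescaled root outside it and has value at least \<open>\<gamma>\<close>.\<close>
  define u where "u a = (a - q) / y" for a
  define w where "w a = y / (a - q)" for a
  have vxq: "vge (x - q) \<nu>" using vge_v[of "x - q"] by (simp add: \<nu>_def V_def)
  have uC: "vge (u a) 0" if "a \<in># C" for a
  proof -
    have "vge (a - x + (x - q)) \<nu>"
      using clC[OF q(1) _ that] vxq by (intro vge_add) (simp_all add: \<nu>_def)
    hence "vge (a - q) \<nu>" by simp
    from vge_divide[OF this y0] show ?thesis by (simp add: u_def vy)
  qed
  have C': "a - q \<noteq> 0 \<and> vge (w a) \<gamma>" if "a \<in># C'" for a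
  proof -
    have a: "a - x \<noteq> 0" "v (a - x) < V q0" using that by (auto simp: C'_def vge_def)
    have "vgt (x - q) (v (a - x))" using vge_imp_vgt[OF vxq, of "v (a - x)"] a(2) \<gamma> by (simp add: \<gamma>_def)
    from v_dominant[OF a(1) this] have aq: "a - q \<noteq> 0" "v (a - q) = v (a - x)" by simp_all
    have "vge (w a) (\<nu> - v (a - q))" unfolding w_def
      using vge_divide[OF vge_v[of y] aq(1)] by (simp add: vy)
    thus ?thesis using aq a(2) by (auto simp: \<gamma>_def elim: vge_mono)
  qed
  define P1 where "P1 = (\<Prod>a\<in>#C. [:- u a, 1:])"
  define P2 where "P2 = (\<Prod>a\<in>#C'. [:1, - w a:])"
  define Q where "Q = pcompose P [:q, y:]"
  define K where "K = lead_coeff P * (\<Prod>a\<in>#C. y) * (\<Prod>a\<in>#C'. q - a)"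
  have QL: "Q \<in> poly_over ?L" unfolding Q_def
    by (intro poly_over_pcompose[OF LR] P) (simp add: poly_over_pCons LR q yL poly_over_0)
  have K0: "K \<noteq> 0"
  proof -
    have "(\<Prod>a\<in>#C'. q - a) \<noteq> 0" using C' by (force simp: prod_mset_zero_iff)
    moreover have "(\<Prod>a\<in>#C. y) \<noteq> 0" using y0 by (simp add: prod_mset_constant)
    ultimately show ?thesis using P by (simp add: K_def)
  qed
  have QK: "Q = smult K (P1 * P2)"
  proof -
    have "Q = smult (lead_coeff P) (\<Prod>a\<in>#A. [:q - a, y:])"
      unfolding Q_def by (subst A) (simp add: pcompose_smult pcompose_prod_mset pcompose_pCons)
    also have "(\<Prod>a\<in>#A. [:q - a, y:]) = (\<Prod>a\<in>#C. [:q - a, y:]) * (\<Prod>a\<in>#C'. [:q - a, y:])"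
      by (simp add: AC)
    also have "(\<Prod>a\<in>#C. [:q - a, y:]) = (\<Prod>a\<in>#C. smult y [:- u a, 1:])"
      by (rule arg_cong[of _ _ prod_mset], rule image_mset_cong) (use y0 in \<open>simp add: u_def\<close>)
    also have "\<dots> = smult (\<Prod>a\<in>#C. y) P1" unfolding P1_def by (rule prod_mset_smult)
    also have "(\<Prod>a\<in>#C'. [:q - a, y:]) = (\<Prod>a\<in>#C'. smult (q - a) [:1, - w a:])"
    proof (rule arg_cong[of _ _ prod_mset], rule image_mset_cong)
      fix a assume "a \<in># C'"
      hence "a - q \<noteq> 0" using C' by blast
      thus "[:q - a, y:] = smult (q - a) [:1, - w a:]" by (simp add: w_def field_simps)
    qed
    also have "\<dots> = smult (\<Prod>a\<in>#C'. q - a) P2" unfolding P2_def by (rule prod_mset_smult)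
    finally show ?thesis by (simp add: K_def mult_ac)
  qed
  define E where "E = P1 * (P2 - 1)"
  have "pvge P1 0" unfolding P1_def by (rule pvge_prod_monic) (rule uC)
  moreover have "pvge (P2 - 1) \<gamma>" unfolding P2_def by (rule pvge_prod_unit) (use \<gamma> C' in auto)
  ultimately have "pvge E \<gamma>" using pvge_mult[of P1 0 "P2 - 1" \<gamma>] by (simp add: E_def)
  hence E: "vge (coeff E i) \<gamma>" for i by (simp add: pvge_def)
  have PE: "P1 * P2 = P1 + E" by (simp add: E_def algebra_simps)
  define \<sigma> where "\<sigma> = (\<Sum>a\<in>#C. u a)"
  have \<sigma>0: "vge \<sigma> 0" unfolding \<sigma>_def by (rule vge_sum_mset) (rule uC)
  have P1r: "coeff P1 r = 1" unfolding P1_def r_def by (rule prod_mset_linear_coeffs(1))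
  have P1r1: "coeff P1 (r - 1) = - \<sigma>" unfolding P1_def r_def \<sigma>_def
    by (rule prod_mset_linear_coeffs(2)) (use xC in auto)
  define Er Er1 where "Er = coeff E r" and "Er1 = coeff E (r - 1)"
  have Er: "vge Er \<gamma>" "vge Er1 \<gamma>" by (simp_all add: Er_def Er1_def E)
  have "vgt Er (v 1)" using vge_imp_vgt[OF Er(1) \<gamma>] by (simp add: v_1)
  from v_dominant[OF _ this] have e0: "1 + Er \<noteq> 0" and ve: "v (1 + Er) = 0" by (simp_all add: v_1)
  \<comment> \<open>This quotient lies in the closure because \<open>Q\<close> has its coefficients
    there, and it agrees with the sum \<open>\<sigma>\<close> of the \<open>u a\<close> up to an
    error of value \<open>\<gamma>\<close>, since the far roots contribute a factor close to
    \<open>1\<close>.\<close>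
  define \<rho> where "\<rho> = - coeff Q (r - 1) / coeff Q r"
  have \<rho>L: "\<rho> \<in> ?L" unfolding \<rho>_def
    using QL by (intro subfield_divide[OF L] subring_uminus[OF LR]) (simp_all add: poly_over_def)
  have "coeff Q r = K * (1 + Er)" "- coeff Q (r - 1) = K * (\<sigma> - Er1)"
    unfolding QK PE coeff_smult coeff_add P1r P1r1 Er_def Er1_def by (simp_all add: algebra_simps)
  hence \<rho>: "\<rho> = (\<sigma> - Er1) / (1 + Er)" unfolding \<rho>_def using K0 by simp
  have "\<sigma> - \<rho> = (\<sigma> * Er + Er1) / (1 + Er)" unfolding \<rho> using e0 by (simp add: field_simps)
  moreover have "vge (\<sigma> * Er + Er1) \<gamma>" using vge_mult[OF \<sigma>0 Er(1)] Er(2) by (intro vge_add) simp_all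
  ultimately have \<sigma>\<rho>: "vge (\<sigma> - \<rho>) \<gamma>" using vge_divide[OF _ e0, of _ \<gamma>] by (simp add: ve)
  define n where "n = (of_nat r :: 'a)"
  have n0: "n \<noteq> 0" using r0 by (simp add: n_def)
  have nL: "n \<in> ?L" unfolding n_def by (rule subring_of_nat[OF LR])
  have vn: "v n = 0" by (rule v_k[OF _ n0]) (simp add: n_def subring_of_nat[OF kR])
  \<comment> \<open>Dividing by the number of roots in the cluster, possible in characteristic
    \<open>0\<close>, moves \<open>q\<close> close to their barycentre
    \<open>\<tau>\<close>.\<close>
  define q' where "q' = q + y * \<rho> / n"
  have q'L: "q' \<in> ?L" unfolding q'_def
    by (intro subring_add[OF LR] subfield_divide[OF L] subring_mult[OF LR] q yL \<rho>L nL)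
  define \<tau> where "\<tau> = (\<Sum>a\<in>#C. a) / n"
  have sum_shift: "(\<Sum>a\<in>#C. a - z) = (\<Sum>a\<in>#C. a) - n * z" for z
    unfolding n_def r_def by (induction C) (simp_all add: algebra_simps)
  have "y * \<sigma> = (\<Sum>a\<in>#C. a - q)"
    unfolding \<sigma>_def sum_mset_distrib_left using y0 by (simp add: u_def)
  hence "y * \<sigma> = n * (\<tau> - q)" using n0 by (simp add: sum_shift \<tau>_def algebra_simps)
  hence "\<tau> - q' = y * (\<sigma> - \<rho>) / n" using n0 by (simp add: q'_def field_simps)
  hence \<tau>q': "vge (\<tau> - q') (\<nu> + \<gamma>)"
    using vge_divide[OF vge_mult[OF vge_v[of y] \<sigma>\<rho>] n0] by (simp add: vy vn)
  \<comment> \<open>All roots in \<open>C\<close>, hence also \<open>\<tau>\<close>, are at least as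
    close to \<open>x\<close> as any approximation \<open>q''\<close> of precision
    \<open>\<nu>\<close> or more. With \<open>q''\<close> strictly better than \<open>q'\<close>,
    passing from \<open>q'\<close> to \<open>x\<close> through \<open>\<tau>\<close> shows
    \<open>q'\<close> to be closer to \<open>x\<close> than it can be.\<close>
  obtain q'' where q'': "q'' \<in> ?L" "V q' < V q''" "\<nu> \<le> V q''"
  proof (cases "V q' \<le> \<nu>")
    case True
    thus ?thesis using better[OF q(1)] that by (force simp: \<nu>_def)
  next
    case False
    thus ?thesis using better[OF q'L] that by force
  qed
  have "vge (\<Sum>a\<in>#C. a - x) (V q'')" by (rule vge_sum_mset) (rule clC[OF q''(1,3)])
  hence "vge (n * (\<tau> - x)) (V q'')" using n0 by (simp add: sum_shift \<tau>_def algebra_simps)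
  from vge_divide[OF this n0] have "vge (\<tau> - x) (V q'')" using n0 by (simp add: vn)
  hence "vge (\<tau> - q' - (\<tau> - x)) (min (V q'') (\<nu> + \<gamma>))"
    using vge_mono[OF \<tau>q', of "min (V q'') (\<nu> + \<gamma>)"] vge_mono[of "\<tau> - x" "V q''" "min (V q'') (\<nu> + \<gamma>)"]
      vge_diff[of "\<tau> - q'" "min (V q'') (\<nu> + \<gamma>)" "\<tau> - x"] by simp
  hence "min (V q'') (\<nu> + \<gamma>) \<le> V q'" using xq(1)[OF q'L] by (simp add: vge_def V_def)
  thus False using q''(2) gain[OF q'L] by simp
qed

end

context puiseux_valuation
begin

section \<open>The effect of a derivation on values\<close>

lemma puiseux_approximation:
  obtains q where "q \<in> puiseux_poly" "vge (x - q) N"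
  by (rule puiseux_closureE[OF puiseux_closure_eq_UNIV])

text \<open>The loss \<open>C\<close> depends on \<open>p\<close> and \<open>x\<close> but not on
  the perturbation; \<open>0 \<le> N\<close> lets products of two small terms be absorbed.\<close>

lemma poly_lipschitz:
  "\<exists>C. \<forall>h N. 0 \<le> N \<longrightarrow> vge h N \<longrightarrow> vge (poly p (x + h) - poly p x) (N + C)"
proof (induction p)
  case 0
  show ?case by (simp add: vge_0)
next
  case (pCons a p)
  then obtain C where C: "\<And>h N. 0 \<le> N \<Longrightarrow> vge h N \<Longrightarrow> vge (poly p (x + h) - poly p x) (N + C)" by blast
  define C' where "C' = min (v x + C) (min C (v (poly p x)))"
  have "vge (poly (pCons a p) (x + h) - poly (pCons a p) x) (N + C')" if h: "0 \<le> N" "vge h N" for h N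
  proof -
    define e where "e = poly p (x + h) - poly p x"
    have e: "vge e (N + C)" unfolding e_def by (rule C[OF h])
    have "vge (x * e) (N + C')"
      by (rule vge_mono[OF vge_mult[OF vge_v e]]) (simp add: C'_def)
    moreover have "vge (h * e) (N + C')"
      by (rule vge_mono[OF vge_mult[OF h(2) e]]) (use h(1) in \<open>simp add: C'_def\<close>)
    moreover have "vge (h * poly p x) (N + C')"
      by (rule vge_mono[OF vge_mult[OF h(2) vge_v]]) (simp add: C'_def)
    ultimately have "vge (x * e + (h * e + h * poly p x)) (N + C')" by (intro vge_add)
    thus ?thesis by (simp add: e_def algebra_simps)
  qed
  thus ?case by blast
qed

text \<open>With such coefficients \<open>P\<close> takes finite Puiseux sums to finite Puiseux
  sums; least degree makes \<open>x\<close> a simple root.\<close>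

lemma puiseux_annihilating_poly:
  obtains P where "P \<in> poly_over puiseux_poly" "poly P x = 0" "poly (pderiv P) x \<noteq> 0"
proof -
  note RR = puiseux_poly_subring
  obtain c N where c: "\<And>i j. c i j \<in> k" "\<exists>i\<le>N. \<exists>j\<le>N. c i j \<noteq> 0"
    "(\<Sum>i\<le>N. \<Sum>j\<le>N. c i j * T 1 ^ i * x ^ j) = 0"
    by (rule algebraic_over_adjoin_relation[OF k algebraic[of x]]) blast
  obtain i0 j0 where ij: "i0 \<le> N" "j0 \<le> N" "c i0 j0 \<noteq> 0" using c(2) by blast
  have Tn: "T (of_nat i) = T 1 ^ i" for i
    by (induction i) (simp_all add: T_0 T_add)
  define e where "e j = (\<Sum>i\<le>N. c i j * T 1 ^ i)" for j
  \<comment> \<open>Powers of \<open>T 1\<close> are values of \<open>T\<close> at natural numbers,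
    and \<open>nat \<lfloor>r\<rfloor>\<close> recovers the index from the exponent.\<close>
  have e: "e j = (\<Sum>r\<in>rat_of_nat ` {..N}. c (nat \<lfloor>r\<rfloor>) j * T r)" for j
    unfolding e_def by (subst sum.reindex) (auto simp: Tn inj_on_def)
  have eR: "e j \<in> puiseux_poly" for j unfolding e
    by (rule puiseux_polyI) (simp_all add: c(1))
  have e0: "e j0 \<noteq> 0"
  proof
    assume "e j0 = 0"
    hence "vge (e j0) (of_nat i0 + 1)" by (simp add: vge_0)
    hence "rat_of_nat i0 + 1 \<le> of_nat i0"
      unfolding e by (rule puiseux_poly_vge_coeff[rotated 2]) (use ij c(1) in simp_all)
    thus False by simp
  qed
  let ?P = "\<lambda>P. P \<in> poly_over puiseux_poly \<and> P \<noteq> 0 \<and> poly P x = 0"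
  have "?P (\<Sum>j\<le>N. monom (e j) j)"
  proof (intro conjI)
    show "(\<Sum>j\<le>N. monom (e j) j) \<in> poly_over puiseux_poly"
      using eR subring_0[OF RR] by (simp add: poly_over_def coeff_sum)
    have "coeff (\<Sum>j\<le>N. monom (e j) j) j0 \<noteq> 0" using ij e0 by (simp add: coeff_sum)
    thus "(\<Sum>j\<le>N. monom (e j) j) \<noteq> 0" by auto
    have "(\<Sum>j\<le>N. e j * x ^ j) = (\<Sum>i\<le>N. \<Sum>j\<le>N. c i j * T 1 ^ i * x ^ j)"
      unfolding e_def sum_distrib_right by (rule sum.swap)
    thus "poly (\<Sum>j\<le>N. monom (e j) j) x = 0" using c(3) by (simp add: poly_sum poly_monom)
  qed
  hence "\<exists>P. ?P P \<and> (\<forall>Q. ?P Q \<longrightarrow> degree P \<le> degree Q)"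
    by (rule ex_has_least_nat)
  then obtain P where P: "P \<in> poly_over puiseux_poly" "P \<noteq> 0" "poly P x = 0"
    and least: "\<And>Q. Q \<in> poly_over puiseux_poly \<Longrightarrow> Q \<noteq> 0 \<Longrightarrow> poly Q x = 0 \<Longrightarrow> degree P \<le> degree Q"
    by auto
  have dP: "degree P > 0"
  proof (rule ccontr)
    assume "\<not> degree P > 0"
    then obtain a where "P = [:a:]" by (metis degree_eq_zeroE gr0I)
    thus False using P by simp
  qed
  have "poly (pderiv P) x \<noteq> 0"
  proof
    assume "poly (pderiv P) x = 0"
    hence "degree P \<le> degree (pderiv P)"
      using dP by (intro least poly_over_pderiv[OF RR] P) (simp_all add: pderiv_eq_0_iff)
    thus False using dP by (simp add: degree_pderiv)
  qed
  thus ?thesis using that P by blast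
qed

context
  fixes d :: "'a \<Rightarrow> 'a"
  assumes d: "is_derivation d" and dk: "\<And>c. c \<in> k \<Longrightarrow> d c \<in> k" and dT1: "vge (d (T 1)) 1"
begin

lemma derivation_T: "d (T r) = of_rat r * (d (T 1) / T 1) * T r"
proof -
  have "d (T (r + s)) / T (r + s) = d (T r) / T r + d (T s) / T s" for r s
    using T_nonzero[of r] T_nonzero[of s] by (simp add: T_add derivation_mult[OF d] field_simps)
  hence "d (T r) / T r = of_rat r * (d (T 1) / T 1)" by (rule additive_on_rat[where f = "\<lambda>r. d (T r) / T r"])
  thus ?thesis using T_nonzero[of r] by (simp add: field_simps)
qed

lemma derivation_vge_puiseux_poly:
  assumes q: "q \<in> puiseux_poly" "vge q \<rho>"
  shows "vge (d q) \<rho>"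
proof -
  obtain A c where A: "finite A" "\<And>r. c r \<in> k" "\<And>r. r \<notin> A \<Longrightarrow> c r = 0" "q = (\<Sum>r\<in>A. c r * T r)"
    by (rule puiseux_polyE[OF q(1)]) blast
  have dl: "vge (d (T 1) / T 1) 0" using vge_divide[OF dT1 T_nonzero[of 1]] by (simp add: v_T)
  have "vge (d (c r * T r)) \<rho>" if r: "r \<in> A" for r
  proof (cases "c r = 0")
    case True
    thus ?thesis by (simp add: derivation_0[OF d] vge_0)
  next
    case False
    have \<rho>: "\<rho> \<le> r" by (rule puiseux_poly_vge_coeff[OF A(1,2) q(2)[unfolded A(4)] r False])
    have "vge (of_rat r * (d (T 1) / T 1) * T r) r"
      by (rule vge_mult0[OF vge_mult0[OF vge_k[OF of_rat_in_subfield[OF k]] dl] vge_T])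
    hence "vge (d (T r)) r" by (subst derivation_T)
    hence "vge (c r * d (T r)) r" by (rule vge_mult0[OF vge_k[OF A(2)]])
    moreover have "vge (d (c r) * T r) r" by (intro vge_kT dk A(2))
    ultimately have "vge (d (c r * T r)) r" unfolding derivation_mult[OF d] by (intro vge_add)
    thus ?thesis using \<rho> by (rule vge_mono)
  qed
  thus ?thesis unfolding A(4) derivation_sum[OF d] by (rule vge_sum)
qed

text \<open>Since \<open>d\<close> is not known to be continuous, a Puiseux sum \<open>q\<close>
  near \<open>x\<close> says nothing directly about \<open>d x\<close>. But \<open>poly P q\<close>
  is itself a Puiseux sum, of large value, and for it the bound is known; comparing its derivative
  with that of \<open>poly P x = 0\<close> shows that \<open>poly (pderiv P) x * (d q - d x)\<close>
  has large value.\<close>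

theorem derivation_vge:
  assumes x: "vge x \<rho>"
  shows "vge (d x) \<rho>"
proof -
  obtain P where P: "P \<in> poly_over puiseux_poly" "poly P x = 0" "poly (pderiv P) x \<noteq> 0"
    by (rule puiseux_annihilating_poly)
  define P' Pd where "P' = pderiv P" and "Pd = map_poly d P"
  have P'0: "poly P' x \<noteq> 0" using P(3) by (simp add: P'_def)
  obtain C1 where C1: "\<And>h N. 0 \<le> N \<Longrightarrow> vge h N \<Longrightarrow> vge (poly P (x + h) - poly P x) (N + C1)"
    using poly_lipschitz[of P x] by blast
  obtain C2 where C2: "\<And>h N. 0 \<le> N \<Longrightarrow> vge h N \<Longrightarrow> vge (poly Pd (x + h) - poly Pd x) (N + C2)"
    using poly_lipschitz[of Pd x] by blast
  obtain C3 where C3: "\<And>h N. 0 \<le> N \<Longrightarrow> vge h N \<Longrightarrow> vge (poly P' (x + h) - poly P' x) (N + C3)"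
    using poly_lipschitz[of P' x] by blast
  \<comment> \<open>\<open>C\<close> collects the losses of the three Lipschitz estimates, and
    \<open>N\<close> also pays for the later division by \<open>poly P' x\<close>.\<close>
  define C where "C = min C1 (min C2 (C3 + \<rho>))"
  define N where "N = max 0 (max \<rho> (\<rho> - C + v (poly P' x)))"
  obtain q where q: "q \<in> puiseux_poly" "vge (x - q) N" by (rule puiseux_approximation)
  define h where "h = q - x"
  have h: "vge h N" using vge_uminus[OF q(2)] by (simp add: h_def)
  have qx: "x + h = q" by (simp add: h_def)
  have N0: "0 \<le> N" by (simp add: N_def)
  have "vge h \<rho>" by (rule vge_mono[OF h]) (simp add: N_def)
  hence "vge (x + h) \<rho>" by (rule vge_add[OF x])
  hence dq: "vge (d q) \<rho>" unfolding qx by (rule derivation_vge_puiseux_poly[OF q(1)])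
  have "vge (poly P q) (N + C1)" using C1[OF N0 h] P(2) by (simp add: qx)
  hence "vge (d (poly P q)) (N + C1)"
    by (rule derivation_vge_puiseux_poly[OF poly_in_subring[OF puiseux_poly_subring P(1) q(1)]])
  hence 1: "vge (d (poly P q)) (N + C)" by (rule vge_mono) (simp add: C_def)
  have 2: "vge (poly Pd q - poly Pd x) (N + C)"
    by (rule vge_mono[OF C2[OF N0 h, unfolded qx]]) (simp add: C_def)
  have "vge ((poly P' q - poly P' x) * d q) (N + C3 + \<rho>)"
    using vge_mult[OF C3[OF N0 h] dq] by (simp add: qx)
  hence 3: "vge ((poly P' q - poly P' x) * d q) (N + C)" by (rule vge_mono) (simp add: C_def)
  have "poly Pd x + poly P' x * d x = 0"
    using derivation_poly[OF d, of P x] P(2) by (simp add: Pd_def P'_def derivation_0[OF d])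
  hence eq: "poly Pd x = - (poly P' x * d x)" by (simp add: eq_neg_iff_add_eq_0)
  have dP: "d (poly P q) = poly Pd q + poly P' q * d q"
    unfolding Pd_def P'_def by (rule derivation_poly[OF d])
  have "poly P' x * (d q - d x) = d (poly P q) - (poly Pd q - poly Pd x) - (poly P' q - poly P' x) * d q"
    unfolding dP eq by (simp add: algebra_simps)
  hence "vge (poly P' x * (d q - d x)) (N + C)" using vge_diff[OF vge_diff[OF 1 2] 3] by (simp only:)
  from vge_divide[OF this P'0] have "vge (d q - d x) (N + C - v (poly P' x))" using P'0 by simp
  hence "vge (d q - d x) \<rho>" by (rule vge_mono) (simp add: N_def)
  from vge_diff[OF dq this] show ?thesis by simp
qed

lemma derivation_vgt:
  assumes "vgt x \<rho>"
  shows "vgt (d x) \<rho>"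
proof (cases "x = 0")
  case False
  hence "vge (d x) (v x)" "\<rho> < v x" using derivation_vge[OF vge_v] assms by (simp_all add: vgt_def)
  thus ?thesis by (rule vge_imp_vgt)
qed (simp add: derivation_0[OF d] vgt_0)

lemma log_derivative_vge:
  assumes "x \<noteq> 0"
  shows "vge (d x / x) 0"
  using vge_divide[OF derivation_vge[OF vge_v[of x]] assms] by simp

end

text \<open>This is the Euler derivation \<open>t d/dt\<close>: the leading term of \<open>x\<close>
  is an eigenvector with eigenvalue \<open>v x\<close>, and the remainder stays smaller. So the
  value of \<open>x\<close> is the residue of its logarithmic derivative.\<close>

lemma euler_derivation_vgt:
  assumes d: "is_derivation d" "\<And>c. c \<in> k \<Longrightarrow> d c = 0" "d (T 1) = T 1" and x: "x \<noteq> 0"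
  shows "vgt (d x / x - of_rat (v x)) 0"
proof -
  have dk: "\<And>c. c \<in> k \<Longrightarrow> d c \<in> k" using d(2) subring_0[OF kR] by simp
  have dT: "vge (d (T 1)) 1" using vge_T[of 1] d(3) by simp
  obtain c where c: "c \<in> k" "c \<noteq> 0" "vgt (x - c * T (v x)) (v x)" by (rule leading_termE[OF x])
  define h where "h = x - c * T (v x)"
  have h: "vgt h (v x)" using c(3) by (simp add: h_def)
  have "d (c * T (v x)) = of_rat (v x) * (c * T (v x))"
    using derivation_T[OF d(1) dk dT, of "v x"] d(2)[OF c(1)] d(3) T_nonzero[of 1]
    by (simp add: derivation_mult[OF d(1)])
  hence "d x - of_rat (v x) * x = d h - of_rat (v x) * h"
    by (simp add: h_def derivation_diff[OF d(1)] algebra_simps)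
  moreover have "vgt (of_rat (v x) * h) (0 + v x)" by (intro vgt_mult vge_k of_rat_in_subfield k h)
  moreover have "vgt (d h) (v x)" by (rule derivation_vgt[OF d(1) dk dT h])
  ultimately have "vgt (d x - of_rat (v x) * x) (v x)" by (simp add: vgt_diff)
  from vgt_mult[OF vge_v[of "inverse x"] this]
  have "vgt (inverse x * (d x - of_rat (v x) * x)) 0" using x by (simp add: v_inverse)
  moreover have "inverse x * (d x - of_rat (v x) * x) = d x / x - of_rat (v x)"
    using x by (simp add: field_simps)
  ultimately show ?thesis by simp
qed

end

section \<open>The valuation of a valuation ring\<close>

text \<open>If every \<open>x - c\<close> were a unit of \<open>V\<close>, so would be every nonzero
  polynomial over \<open>k\<close> in \<open>x\<close>, because it splits over \<open>k\<close>.
  Then \<open>V\<close> would contain \<open>k(x)\<close> and everything algebraic over it, that is,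
  the whole field.\<close>

lemma valuation_ring_residue:
  fixes k :: "'a::alg_closed_field set"
  assumes k: "is_subfield k" and kac: "algebraically_closed_in_type k"
    and alg: "\<And>x. algebraic_over (field_adjoin k \<theta>) x"
    and V: "valuation_ring V" "k \<subseteq> V" "V \<noteq> UNIV" and x: "x \<in> V"
  shows "\<exists>c\<in>k. x - c = 0 \<or> inverse (x - c) \<notin> V"
proof (rule ccontr)
  assume "\<not> ?thesis"
  hence c: "x - c \<noteq> 0" "inverse (x - c) \<in> V" if "c \<in> k" for c using that by auto
  note VR = valuation_ring_subring[OF V(1)]
  have "x \<notin> k" using c(1)[of x] by auto
  hence nx: "\<not> algebraic_over k x" using kac by (auto simp: algebraically_closed_in_type_def)
  have inv: "inverse (poly p x) \<in> V" if p: "p \<in> poly_over k" "p \<noteq> 0" for p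
  proof -
    obtain A where A: "p = smult (lead_coeff p) (\<Prod>a\<in>#A. [:- a, 1:])"
      using alg_closed_imp_factorization[OF p(2)] by blast
    have Ak: "a \<in> k" if "a \<in># A" for a
    proof -
      have "poly p a = 0" using that by (subst A) (force simp: poly_prod_mset)
      hence "algebraic_over k a" using p unfolding algebraic_over_iff by blast
      thus ?thesis using kac by (simp add: algebraically_closed_in_type_def)
    qed
    hence "inverse (\<Prod>a\<in>#A. x - a) \<in> V"
      by (induction A) (simp_all add: subring_1[OF VR] subring_mult[OF VR] c(2))
    moreover have "inverse (lead_coeff p) \<in> V"
      using p V(2) subfield_inverse[OF k] by (auto simp: poly_over_def)
    ultimately have "inverse (lead_coeff p) * inverse (\<Prod>a\<in>#A. x - a) \<in> V" by (intro subring_mult[OF VR])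
    moreover have "poly p x = lead_coeff p * (\<Prod>a\<in>#A. x - a)"
      by (subst A) (simp add: poly_prod_mset)
    ultimately show ?thesis by simp
  qed
  have "field_adjoin k x \<subseteq> V"
  proof
    fix y assume "y \<in> field_adjoin k x"
    then obtain p q where pq: "p \<in> poly_over k" "q \<in> poly_over k" "poly q x \<noteq> 0" "y = poly p x / poly q x"
      by (rule field_adjoinE[OF k])
    have "q \<noteq> 0" using pq(3) by auto
    have "p \<in> poly_over V" using pq(1) V(2) by (auto simp: poly_over_def)
    hence "poly p x \<in> V" using x by (rule poly_in_subring[OF VR])
    thus "y \<in> V" using inv[OF pq(2) \<open>q \<noteq> 0\<close>] by (simp add: pq(4) divide_inverse subring_mult[OF VR])
  qed
  hence "y \<in> V" for y
    using valuation_ring_contains_algebraic[OF V(1) is_subfield_field_adjoin]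
      algebraic_over_adjoin_exchange[OF k alg nx] by blast
  thus False using V(3) by blast
qed

text \<open>Independently chosen roots would not be compatible, so they form one chain:
  \<open>s n\<close> is a root of \<open>t\<close> of order \<open>fact n\<close>. If
  \<open>r * fact n\<close> is an integer \<open>m\<close>, then \<open>r\<close> gets the value
  \<open>s n powi m\<close>, which does not depend on \<open>n\<close>.\<close>

lemma compatible_roots:
  fixes t :: "'a::{alg_closed_field, field_char_0}"
  assumes t: "t \<noteq> 0"
  obtains T :: "rat \<Rightarrow> 'a" where "\<And>r s. T (r + s) = T r * T s" "T 0 = 1" "T 1 = t"
proof -
  have "\<exists>s. \<forall>n. (n = 0 \<longrightarrow> s n = t) \<and> s (Suc n) ^ Suc n = s n"
  proof -
    have "\<exists>s. \<forall>n. (n = 0 \<longrightarrow> s n = t) \<and> (\<lambda>n a b. b ^ Suc n = a) n (s n) (s (Suc n))"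
      by (rule dependent_nat_choice) (auto intro: nth_root_exists simp del: power_Suc)
    thus ?thesis by simp
  qed
  then obtain s where s0: "s 0 = t" and s: "\<And>n. s (Suc n) ^ Suc n = s n" by metis
  have sf: "s n ^ fact n = t" for n
  proof (induction n)
    case (Suc n)
    have "s (Suc n) ^ fact (Suc n) = (s (Suc n) ^ Suc n) ^ fact n"
      by (simp only: fact_Suc power_mult of_nat_id)
    thus ?case using Suc s[of n] by (simp del: power_Suc)
  qed (simp add: s0)
  have sne: "s n \<noteq> 0" for n
  proof
    assume "s n = 0"
    hence "t = 0 ^ fact n" using sf[of n] by simp
    thus False using t by (simp add: power_0_left)
  qed
  have step: "s m = s n ^ (fact n div fact m)" if "m \<le> n" for m n
    using that
  proof (induction n rule: dec_induct)
    case (step n)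
    have "fact m dvd (fact n :: nat)" using step(1) by (rule fact_dvd)
    hence "fact (Suc n) div fact m = Suc n * (fact n div fact m :: nat)"
      by (simp add: div_mult_swap)
    thus ?case using step s[of n] by (simp add: power_mult del: power_Suc mult_Suc)
  qed simp
  define good where "good r y \<longleftrightarrow> (\<exists>n m. of_int m = r * rat_of_nat (fact n) \<and> y = s n powi m)" for r y
  have ge: "y = z" if "of_int m = r * rat_of_nat (fact n)" "y = s n powi m"
    "of_int m' = r * rat_of_nat (fact n')" "z = s n' powi m'" "n \<le> n'" for r y z n m n' m'
  proof -
    define e :: nat where "e = fact n' div fact n"
    have fe: "fact n' = fact n * e" using fact_dvd[OF that(5), where 'a = nat] by (simp add: e_def)
    have "of_int m' = rat_of_int (m * int e)"
      using that(1,3) by (simp add: fe mult_ac)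
    hence m': "m' = int e * m" using of_int_eq_iff by (metis mult.commute)
    have "s n powi m = (s n' powi int e) powi m" using step[OF that(5)] by (simp add: e_def)
    also have "\<dots> = s n' powi m'" by (simp add: m' power_int_mult)
    finally show ?thesis using that by simp
  qed
  have uniq: "y = z" if "good r y" "good r z" for r y z
  proof -
    obtain n m n' m' where "of_int m = r * rat_of_nat (fact n)" "y = s n powi m"
      "of_int m' = r * rat_of_nat (fact n')" "z = s n' powi m'"
      using \<open>good r y\<close> \<open>good r z\<close> unfolding good_def by auto
    thus ?thesis using ge[of m r n y m' n' z] ge[of m' r n' z m n y] by (cases "n \<le> n'") auto
  qed
  \<comment> \<open>Every denominator divides \<open>fact n\<close> for all large \<open>n\<close>,
    so two exponents can be treated at a common level.\<close>
  have ex: "\<exists>n0. \<forall>n\<ge>n0. \<exists>m. of_int m = r * rat_of_nat (fact n)" for r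
  proof -
    obtain a b where ab: "r = Rat.Fract a b" "b > 0" by (cases r) auto
    have "\<exists>m. of_int m = r * rat_of_nat (fact n)" if "n \<ge> nat b" for n
    proof -
      have "nat b dvd fact n" using that ab(2) by (intro dvd_fact) auto
      then obtain e where e: "fact n = nat b * e" by (rule dvdE)
      have "r * rat_of_nat (fact n) = of_int (a * int e)"
        using ab by (simp add: e Fract_of_int_quotient)
      thus ?thesis by metis
    qed
    thus ?thesis by blast
  qed
  define T where "T r = (SOME y. good r y)" for r
  have T: "good r (T r)" for r
  proof -
    obtain n m where "of_int m = r * rat_of_nat (fact n)" using ex[of r] by blast
    hence "good r (s n powi m)" unfolding good_def by blast
    thus ?thesis unfolding T_def by (rule someI)
  qed
  have TI: "T r = y" if "good r y" for r y using uniq[OF T that] .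
  show ?thesis
  proof (rule that[of T])
    show "T 0 = 1"
    proof (rule TI)
      show "good 0 1" unfolding good_def by (intro exI[of _ 0]) simp
    qed
    show "T 1 = t"
    proof (rule TI)
      show "good 1 t" unfolding good_def by (intro exI[of _ 0] exI[of _ 1]) (simp add: s0)
    qed
    fix r r'
    obtain n0 where n0: "\<And>n. n \<ge> n0 \<Longrightarrow> \<exists>m. of_int m = r * rat_of_nat (fact n)" using ex[of r] by blast
    obtain n1 where n1: "\<And>n. n \<ge> n1 \<Longrightarrow> \<exists>m. of_int m = r' * rat_of_nat (fact n)" using ex[of r'] by blast
    define n where "n = max n0 n1"
    obtain m where m: "of_int m = r * rat_of_nat (fact n)" using n0[of n] by (auto simp: n_def)
    obtain m' where m': "of_int m' = r' * rat_of_nat (fact n)" using n1[of n] by (auto simp: n_def)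
    have "T r = s n powi m" by (rule TI) (use m in \<open>auto simp: good_def\<close>)
    moreover have "T r' = s n powi m'" by (rule TI) (use m' in \<open>auto simp: good_def\<close>)
    moreover have "T (r + r') = s n powi (m + m')"
    proof (rule TI)
      have "of_int (m + m') = (r + r') * rat_of_nat (fact n)" using m m' by (simp add: algebra_simps)
      thus "good (r + r') (s n powi (m + m'))" unfolding good_def by blast
    qed
    ultimately show "T (r + r') = T r * T r'" using sne by (simp add: power_int_add)
  qed
qed

section \<open>Roots and finite sums in a valuation ring\<close>

lemma valuation_ring_root:
  assumes V: "valuation_ring V" and n: "n > 0" and x: "x ^ n \<in> V"
  shows "x \<in> V"
proof (rule ccontr)
  assume nx: "x \<notin> V"
  note VR = valuation_ring_subring[OF V]
  have y: "inverse x \<in> V" using V nx by (auto simp: valuation_ring_def)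
  have x0: "x \<noteq> 0" using nx subring_0[OF VR] by auto
  obtain m where m: "n = Suc m" using n by (cases n) auto
  have "x ^ n * inverse x ^ m \<in> V" by (intro subring_mult[OF VR] subring_power[OF VR] x y)
  moreover have "x ^ n * inverse x ^ m = x" using x0 by (simp add: m field_simps)
  ultimately show False using nx by simp
qed

text \<open>\<open>f i = 0 \<or> inverse (f i) \<notin> V\<close> encodes membership in the maximal
  ideal; the first alternative is there because \<open>inverse 0 = 0\<close> lies in
  \<open>V\<close>.\<close>

lemma valuation_ring_nonunit_sum:
  assumes V: "valuation_ring V" and I: "finite I" and f: "\<And>i. i \<in> I \<Longrightarrow> f i = 0 \<or> inverse (f i) \<notin> V"
  shows "sum f I = 0 \<or> inverse (sum f I) \<notin> V"
proof -
  note VR = valuation_ring_subring[OF V]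
  have add: "x + y = 0 \<or> inverse (x + y) \<notin> V"
    if x: "x = 0 \<or> inverse x \<notin> V" and y: "y = 0 \<or> inverse y \<notin> V" and xy: "x / y \<in> V" for x y
  proof (cases "y = 0")
    case False
    show ?thesis
    proof (rule ccontr)
      assume "\<not> ?thesis"
      hence s: "x + y \<noteq> 0" "inverse (x + y) \<in> V" by auto
      have "inverse (x + y) * (x / y + 1) \<in> V"
        by (intro subring_mult[OF VR] subring_add[OF VR] subring_1[OF VR] s xy)
      moreover have "inverse (x + y) * (x / y + 1) = inverse y"
        using s(1) False by (simp add: field_simps)
      ultimately show False using y False by simp
    qed
  qed (use x in simp)
  have add': "x + y = 0 \<or> inverse (x + y) \<notin> V"
    if x: "x = 0 \<or> inverse x \<notin> V" and y: "y = 0 \<or> inverse y \<notin> V" for x y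
  proof -
    have "x / y \<in> V \<or> y / x \<in> V"
      using V by (metis valuation_ring_def inverse_divide)
    thus ?thesis using add[OF x y] add[OF y x] by (auto simp: add.commute)
  qed
  show ?thesis using I f
  proof (induction I rule: finite_induct)
    case (insert z I)
    have "f z = 0 \<or> inverse (f z) \<notin> V" "sum f I = 0 \<or> inverse (sum f I) \<notin> V"
      using insert.IH insert.prems by blast+
    from add'[OF this] show ?case using insert.hyps by simp
  qed simp
qed

lemma valuation_ring_max_term:
  assumes V: "valuation_ring V" and I: "finite I" "I \<noteq> {}" and f: "\<And>i. i \<in> I \<Longrightarrow> f i \<noteq> 0"
  shows "\<exists>p\<in>I. \<forall>i\<in>I. f i / f p \<in> V"
  using I f
proof (induction I rule: finite_ne_induct)
  case (singleton x)
  thus ?case using subring_1[OF valuation_ring_subring[OF V]] by simp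
next
  case (insert z I)
  note VR = valuation_ring_subring[OF V]
  obtain p where p: "p \<in> I" "\<And>i. i \<in> I \<Longrightarrow> f i / f p \<in> V" using insert.IH insert.prems by blast
  have nz: "f z \<noteq> 0" "f p \<noteq> 0" using insert.prems p by auto
  have "f z / f p \<in> V \<or> f p / f z \<in> V"
    using V by (metis valuation_ring_def inverse_divide)
  thus ?case
  proof
    assume "f z / f p \<in> V"
    thus ?thesis using p by (intro bexI[of _ p]) auto
  next
    assume a: "f p / f z \<in> V"
    have "f i / f z \<in> V" if "i \<in> I" for i
    proof -
      have "f i / f p * (f p / f z) \<in> V" by (intro subring_mult[OF VR] p(2) that a)
      thus ?thesis using nz by simp
    qed
    moreover have "f z / f z \<in> V" using nz subring_1[OF VR] by simp
    ultimately show ?thesis by (intro bexI[of _ z]) auto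
  qed
qed

text \<open>Divided by a dominant term, the other terms add up to \<open>- 1\<close>, a unit; hence
  they are not all in the maximal ideal, and one of them has the order of the dominant term.\<close>

lemma valuation_ring_cancelling_terms:
  assumes V: "valuation_ring V" and I: "finite I" "I \<noteq> {}" and f: "\<And>i. i \<in> I \<Longrightarrow> f i \<noteq> 0"
    and sum: "sum f I = 0"
  obtains p q where "p \<in> I" "q \<in> I" "p \<noteq> q" "f p / f q \<in> V" "f q / f p \<in> V"
proof -
  note VR = valuation_ring_subring[OF V]
  obtain p where p: "p \<in> I" "\<And>i. i \<in> I \<Longrightarrow> f i / f p \<in> V"
    using valuation_ring_max_term[where f = f, OF V I f] by blast
  have fp: "f p \<noteq> 0" using f p by blast
  have "\<exists>q\<in>I - {p}. f p / f q \<in> V"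
  proof (rule ccontr)
    assume no: "\<not> ?thesis"
    have "(\<Sum>q\<in>I - {p}. f q / f p) = 0 \<or> inverse (\<Sum>q\<in>I - {p}. f q / f p) \<notin> V"
      by (rule valuation_ring_nonunit_sum[OF V]) (use I no in \<open>auto simp: inverse_divide\<close>)
    moreover have "(\<Sum>q\<in>I - {p}. f q / f p) = - 1"
    proof -
      have "f p + sum f (I - {p}) = 0" using sum sum.remove[OF I(1) p(1), of f] by simp
      hence "sum f (I - {p}) = - f p" by (simp add: add_eq_0_iff)
      thus ?thesis using fp by (simp flip: sum_divide_distrib)
    qed
    ultimately show False using subring_uminus[OF VR subring_1[OF VR]] by simp
  qed
  then obtain q where "q \<in> I - {p}" "f p / f q \<in> V" by blast
  thus ?thesis using that[of p q] p by auto
qed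

text \<open>Values are measured by the parameter: in a polynomial relation between \<open>t\<close>
  and \<open>x\<close> two monomials must have the same order, and as their exponents of
  \<open>x\<close> differ, \<open>x\<close> is a unit times a rational power of
  \<open>t\<close>.\<close>

lemma valuation_ring_puiseux:
  fixes k :: "'a::{alg_closed_field, field_char_0} set"
  assumes k: "is_subfield k" and V: "valuation_ring V" "k \<subseteq> V"
    and t: "t \<in> V" "inverse t \<notin> V"
    and res: "\<And>x. x \<in> V \<Longrightarrow> \<exists>c\<in>k. x - c = 0 \<or> inverse (x - c) \<notin> V"
    and alg: "\<And>x. algebraic_over (field_adjoin k t) x"
  obtains T v where "puiseux_valuation k T v" "T 1 = t" "\<And>x. x \<in> V \<longleftrightarrow> x = 0 \<or> 0 \<le> v x"
proof -
  note VR = valuation_ring_subring[OF V(1)]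
  have t0: "t \<noteq> 0" using t(2) subring_0[OF VR] by auto
  obtain T :: "rat \<Rightarrow> 'a" where T: "\<And>r s. T (r + s) = T r * T s" and T0: "T 0 = 1" and T1: "T 1 = t"
    using compatible_roots[OF t0] by metis
  have Tm: "T r * T (- r) = 1" for r using T[of r "- r"] T0 by simp
  have Tnz: "T r \<noteq> 0" for r using Tm[of r] by auto
  have Ti: "T (- r) = inverse (T r)" for r using Tm[of r] by (simp add: inverse_unique)
  have Td: "T (r - s) = T r / T s" for r s using T[of r "- s"] by (simp add: Ti divide_inverse)
  have Tp: "T (of_nat n * r) = T r ^ n" for n r
    by (induction n) (simp_all add: T0 T algebra_simps)
  have Tn: "T (of_nat n) = t ^ n" for n using Tp[of n 1] by (simp add: T1)
  have pos: "\<exists>a b. b > 0 \<and> of_nat b * r = of_nat a" if "0 \<le> r" for r :: rat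
  proof -
    obtain a b where ab: "r = Rat.Fract a b" "b > 0" by (cases r) auto
    have "a \<ge> 0" using that ab by (simp add: Rat.zero_le_Fract_iff)
    thus ?thesis using ab
      by (intro exI[of _ "nat a"] exI[of _ "nat b"]) (simp add: Fract_of_int_quotient)
  qed
  have TV: "T r \<in> V \<longleftrightarrow> 0 \<le> r" for r
  proof
    assume "0 \<le> r"
    then obtain a b where ab: "b > 0" "of_nat b * r = of_nat a" using pos by blast
    have "T r ^ b = t ^ a" using Tp[of b r] ab(2) by (simp add: Tn)
    thus "T r \<in> V" using valuation_ring_root[OF V(1) ab(1)] subring_power[OF VR t(1)] by simp
  next
    assume r: "T r \<in> V"
    show "0 \<le> r"
    proof (rule ccontr)
      assume neg: "\<not> 0 \<le> r"
      then obtain a b where ab: "b > 0" "of_nat b * (- r) = of_nat a" using pos[of "- r"] by auto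
      have a: "a > 0" using ab neg by (cases a) auto
      have "inverse t ^ a = inverse (T (- r) ^ b)" using Tp[of b "- r"] ab(2) by (simp add: Tn power_inverse)
      also have "\<dots> = T r ^ b" by (simp add: Ti power_inverse)
      finally have "inverse t ^ a \<in> V" using subring_power[OF VR r] by simp
      thus False using valuation_ring_root[OF V(1) a] t(2) by blast
    qed
  qed
  define val where "val x r \<longleftrightarrow> x / T r \<in> V \<and> T r / x \<in> V" for x r
  have exchange: "\<exists>r. val x r"
    if x: "x \<noteq> 0" and j: "j' < j" and W: "t ^ i * x ^ j / (t ^ i' * x ^ j') \<in> V" "t ^ i' * x ^ j' / (t ^ i * x ^ j) \<in> V"
    for x i j i' j'
  proof -
    define n where "n = j - j'"
    have n: "n > 0" "j = n + j'" using j by (auto simp: n_def)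
    define r where "r = (of_nat i' - of_nat i) / (of_nat n :: rat)"
    have "T r ^ n = T (of_nat i' - of_nat i)" using Tp[of n r] n by (simp add: r_def)
    hence Tr: "T r ^ n = t ^ i' / t ^ i" by (simp add: Td Tn)
    have "(x / T r) ^ n = t ^ i * x ^ j / (t ^ i' * x ^ j')"
      using x t0 by (simp add: power_divide Tr n(2) power_add)
    moreover have "(T r / x) ^ n = t ^ i' * x ^ j' / (t ^ i * x ^ j)"
      using x t0 by (simp add: power_divide Tr n(2) power_add)
    ultimately have "val x r" unfolding val_def
      using W valuation_ring_root[OF V(1) n(1)] by simp
    thus ?thesis by blast
  qed
  have val_ex: "\<exists>r. val x r" if x: "x \<noteq> 0" for x
  proof -
    obtain c N where c: "\<And>i j. c i j \<in> k" "\<exists>i\<le>N. \<exists>j\<le>N. c i j \<noteq> 0"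
      "(\<Sum>i\<le>N. \<Sum>j\<le>N. c i j * t ^ i * x ^ j) = 0"
      by (rule algebraic_over_adjoin_relation[OF k alg[of x]]) blast
    define I where "I = {(i, j). i \<le> N \<and> j \<le> N \<and> c i j \<noteq> 0}"
    define f where "f = (\<lambda>(i, j). c i j * t ^ i * x ^ j)"
    have IS: "I \<subseteq> {..N} \<times> {..N}" by (auto simp: I_def)
    hence fI: "finite I" by (rule finite_subset) simp
    have "I \<noteq> {}" using c(2) by (auto simp: I_def)
    moreover have "f p \<noteq> 0" if "p \<in> I" for p using that x t0 by (auto simp: I_def f_def)
    moreover have "sum f I = 0"
    proof -
      have "sum f I = sum f ({..N} \<times> {..N})"
        by (rule sum.mono_neutral_left) (use IS in \<open>auto simp: I_def f_def\<close>)
      also have "\<dots> = (\<Sum>i\<le>N. \<Sum>j\<le>N. c i j * t ^ i * x ^ j)"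
        by (simp add: sum.cartesian_product f_def)
      finally show ?thesis using c(3) by simp
    qed
    ultimately obtain p q where pq: "p \<in> I" "q \<in> I" "p \<noteq> q" "f p / f q \<in> V" "f q / f p \<in> V"
      using valuation_ring_cancelling_terms[OF V(1) fI] by metis
    obtain i j i' j' where ij: "p = (i, j)" "q = (i', j')" by (cases p; cases q) auto
    have c0: "c i j \<noteq> 0" "c i' j' \<noteq> 0" using pq by (auto simp: ij I_def)
    define W where "W = t ^ i * x ^ j / (t ^ i' * x ^ j')"
    have eqW: "W = c i' j' / c i j * (f p / f q)" "inverse W = c i j / c i' j' * (f q / f p)"
      using c0 by (simp_all add: W_def f_def ij)
    have cV: "c i' j' / c i j \<in> V" "c i j / c i' j' \<in> V"
      using V(2) subfield_divide[OF k c(1) c(1)] by auto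
    have W: "W \<in> V" unfolding eqW(1) by (rule subring_mult[OF VR cV(1) pq(4)])
    have W': "inverse W \<in> V" unfolding eqW(2) by (rule subring_mult[OF VR cV(2) pq(5)])
    consider "j' < j" | "j < j'" | "j = j'" by linarith
    thus ?thesis
    proof cases
      case 1
      show ?thesis by (rule exchange[OF x 1]) (use W W' in \<open>simp_all add: W_def\<close>)
    next
      case 2
      show ?thesis by (rule exchange[OF x 2]) (use W W' in \<open>simp_all add: W_def\<close>)
    next
      case 3
      \<comment> \<open>Equal exponents of \<open>x\<close> would leave a power of \<open>t\<close>
        that is a unit; this forces \<open>i = i'\<close> and contradicts
        \<open>p \<noteq> q\<close>.\<close>
      hence "W = T (of_nat i - of_nat i')" "inverse W = T (of_nat i' - of_nat i)"
        using x by (simp_all add: W_def Td Tn)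
      hence "i = i'" using W W' by (simp add: TV)
      thus ?thesis using 3 pq(3) ij by simp
    qed
  qed
  have val_unique: "r = s" if "x \<noteq> 0" "val x r" "val x s" for x r s
  proof -
    have "T r / x * (x / T s) \<in> V" "T s / x * (x / T r) \<in> V"
      using that(2,3) unfolding val_def by - (rule subring_mult[OF VR]; blast)+
    hence "T (r - s) \<in> V" "T (s - r) \<in> V" using that(1) by (simp_all add: Td)
    thus ?thesis by (simp add: TV)
  qed
  define v where "v x = (if x = 0 then 0 else SOME r. val x r)" for x
  have val: "val x (v x)" if "x \<noteq> 0" for x
    using someI_ex[OF val_ex[OF that]] that by (simp add: v_def)
  have vI: "v x = r" if "x \<noteq> 0" "val x r" for x r
    using val_unique[OF that(1) val that(2)] that(1) by simp
  have key: "x / T s \<in> V \<longleftrightarrow> s \<le> v x" if x: "x \<noteq> 0" for x s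
  proof
    assume a: "x / T s \<in> V"
    have "T (v x) / x * (x / T s) \<in> V" using val[OF x] a unfolding val_def by - (rule subring_mult[OF VR]; blast)+
    hence "T (v x - s) \<in> V" using x by (simp add: Td)
    thus "s \<le> v x" by (simp add: TV)
  next
    assume "s \<le> v x"
    hence "T (v x - s) \<in> V" by (simp add: TV)
    hence "x / T (v x) * T (v x - s) \<in> V" using val[OF x] unfolding val_def by - (rule subring_mult[OF VR]; blast)+
    thus "x / T s \<in> V" using Tnz[of "v x"] by (simp add: Td)
  qed
  have memV: "x \<in> V \<longleftrightarrow> x = 0 \<or> 0 \<le> v x" for x
    using key[of x 0] subring_0[OF VR] by (cases "x = 0") (auto simp: T0)
  have vmult: "v (x * y) = v x + v y" if "x \<noteq> 0" "y \<noteq> 0" for x y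
  proof (rule vI)
    have "x / T (v x) * (y / T (v y)) \<in> V" "T (v x) / x * (T (v y) / y) \<in> V"
      using val[OF that(1)] val[OF that(2)] unfolding val_def by - (rule subring_mult[OF VR]; blast)+
    thus "val (x * y) (v x + v y)" by (simp add: val_def T)
  qed (use that in simp)
  have vT: "v (T r) = r" for r
    by (rule vI[OF Tnz]) (simp add: val_def Tnz subring_1[OF VR])
  have "puiseux_valuation k T v"
  proof
    show "is_subfield k" by (rule k)
    show "T (r + s) = T r * T s" for r s by (rule T)
    show "T 0 = 1" by (rule T0)
    show "v (x * y) = v x + v y" if "x \<noteq> 0" "y \<noteq> 0" for x y by (rule vmult[OF that])
    show "min (v x) (v y) \<le> v (x + y)" if "x \<noteq> 0" "y \<noteq> 0" "x + y \<noteq> 0" for x y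
    proof -
      let ?s = "min (v x) (v y)"
      have "x / T ?s + y / T ?s \<in> V" using key[OF that(1), of ?s] key[OF that(2), of ?s]
        by (intro subring_add[OF VR]) simp_all
      hence "(x + y) / T ?s \<in> V" by (simp add: add_divide_distrib)
      thus ?thesis using key[OF that(3), of ?s] by blast
    qed
    show "v c = 0" if "c \<in> k" "c \<noteq> 0" for c
      by (rule vI[OF that(2)])
        (use that V(2) subfield_inverse[OF k that(1)] in \<open>auto simp: val_def T0 field_simps\<close>)
    show "v (T r) = r" for r by (rule vT)
    show "algebraic_over (field_adjoin k (T 1)) x" for x unfolding T1 by (rule alg)
    show "\<exists>c\<in>k. c \<noteq> 0 \<and> (x = c * T (v x) \<or> v x < v (x - c * T (v x)))" if x: "x \<noteq> 0" for x
    proof -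
      define w where "w = x / T (v x)"
      have w: "w \<in> V" "inverse w \<in> V" using val[OF x] by (auto simp: val_def w_def)
      have xw: "x = w * T (v x)" using Tnz[of "v x"] by (simp add: w_def)
      obtain c where c: "c \<in> k" "w - c = 0 \<or> inverse (w - c) \<notin> V" using res[OF w(1)] by blast
      have w0: "w \<noteq> 0" using xw x by auto
      have c0: "c \<noteq> 0" using c(2) w(2) w0 by auto
      show ?thesis
      proof (cases "w - c = 0")
        case True
        thus ?thesis using c(1) c0 xw by (intro bexI[of _ c]) auto
      next
        case False
        hence i: "inverse (w - c) \<notin> V" using c(2) by blast
        have "w - c \<in> V" using w(1) c(1) V(2) by (intro subring_diff[OF VR]) auto
        hence ge: "0 \<le> v (w - c)" using False memV by blast
        have "v (w - c) + v (inverse (w - c)) = v 1" using vmult[of "w - c" "inverse (w - c)"] False by simp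
        moreover have "v 1 = 0" using vT[of 0] by (simp add: T0)
        moreover have "v (inverse (w - c)) < 0" using i memV[of "inverse (w - c)"] by auto
        ultimately have "0 < v (w - c)" by simp
        moreover have "v (x - c * T (v x)) = v (w - c) + v x"
        proof -
          have "x - c * T (v x) = (w - c) * T (v x)" by (subst (1) xw) (simp add: algebra_simps)
          thus ?thesis using vmult[OF False Tnz] by (simp add: vT)
        qed
        ultimately show ?thesis using c(1) c0 by (intro bexI[of _ c]) auto
      qed
    qed
  qed
  thus ?thesis using that T1 memV by blast
qed

section \<open>Logarithmic derivatives at a place\<close>

lemma derivation_of_rat:
  fixes D :: "'a::field_char_0 \<Rightarrow> 'a"
  assumes D: "is_derivation D"
  shows "D (of_rat r) = 0"
proof -
  have "D (of_rat r) = of_rat r * D (of_rat 1)"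
    by (rule additive_on_rat[where f = "\<lambda>r. D (of_rat r)"]) (simp add: of_rat_add derivation_add[OF D])
  thus ?thesis by (simp add: derivation_1[OF D])
qed

lemma is_derivation_scale: "is_derivation d \<Longrightarrow> is_derivation (\<lambda>x. m * d x)"
  unfolding is_derivation_def by (simp add: algebra_simps)

lemma is_derivation_diff:
  "is_derivation d \<Longrightarrow> is_derivation d' \<Longrightarrow> is_derivation (\<lambda>x. d x - d' x)"
  unfolding is_derivation_def by (simp add: algebra_simps)

lemma sum_log_derivatives_scale:
  fixes m :: "'a::field"
  shows "(\<Sum>i\<in>I. a i * ((m * d (f i)) / f i)) + m * d s = m * ((\<Sum>i\<in>I. a i * (d (f i) / f i)) + d s)"
  by (simp add: sum_distrib_left algebra_simps)

lemma sum_log_derivatives_diff: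
  fixes d :: "'a::field \<Rightarrow> 'a"
  shows "(\<Sum>i\<in>I. a i * ((d (f i) - d' (f i)) / f i)) + (d s - d' s)
    = ((\<Sum>i\<in>I. a i * (d (f i) / f i)) + d s) - ((\<Sum>i\<in>I. a i * (d' (f i) / f i)) + d' s)"
  by (simp add: sum_subtractf algebra_simps diff_divide_distrib)

text \<open>The field is viewed as a vector space over \<open>\<rat>\<close>, and the map sending
  the given nonzero element to \<open>1\<close> is extended linearly. It will turn arbitrary
  coefficients into rational ones.\<close>

lemma rat_linear_functional:
  fixes x :: "'a::field_char_0"
  assumes "x \<noteq> 0"
  obtains g :: "'a \<Rightarrow> rat" where "\<And>x y. g (x + y) = g x + g y" "\<And>r x. g (x * of_rat r) = g x * r" "g x \<noteq> 0"
proof -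
  interpret A: vector_space "\<lambda>r x. of_rat r * x :: 'a"
    by unfold_locales (simp_all add: of_rat_add of_rat_mult algebra_simps)
  interpret B: vector_space "(*) :: rat \<Rightarrow> rat \<Rightarrow> rat"
    by unfold_locales (simp_all add: algebra_simps)
  interpret P: vector_space_pair "\<lambda>r x. of_rat r * x :: 'a" "(*) :: rat \<Rightarrow> rat \<Rightarrow> rat" ..
  have "A.independent {x}" using assms by simp
  from P.linear_independent_extend[OF this, of "\<lambda>_. 1"] obtain g
    where g: "Vector_Spaces.linear (\<lambda>r x. of_rat r * x) (*) g" "g x = 1" by auto
  interpret g: Vector_Spaces.linear "\<lambda>r x. of_rat r * x" "(*)" g by (rule g(1))
  show ?thesis
    by (rule that[of g]) (use g(2) g.add g.scale in \<open>simp_all add: mult.commute\<close>)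
qed

lemma common_denominator:
  fixes r :: "'i \<Rightarrow> rat"
  assumes "finite I"
  shows "\<exists>D e. D \<noteq> 0 \<and> (\<forall>i\<in>I. of_int (e i) = of_int D * r i)"
  using assms
proof (induction I rule: finite_induct)
  case empty
  show ?case by (intro exI[of _ 1]) simp
next
  case (insert j I)
  then obtain D e where D: "D \<noteq> 0" "\<And>i. i \<in> I \<Longrightarrow> of_int (e i) = of_int D * r i" by blast
  obtain a b where ab: "r j = Rat.Fract a b" "b > 0" by (cases "r j") auto
  show ?case
  proof (intro exI[of _ "D * b"] exI[of _ "\<lambda>i. if i = j then D * a else e i * b"] conjI ballI)
    show "D * b \<noteq> 0" using D ab by simp
    fix i assume "i \<in> insert j I"
    thus "of_int (if i = j then D * a else e i * b) = of_int (D * b) * r i"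
      using D(2)[of i] ab by (auto simp: Fract_of_int_quotient)
  qed
qed

section \<open>Residues and regularity at one place\<close>

context puiseux_valuation
begin

lemma vgt_k_imp_0: "c \<in> k \<Longrightarrow> vgt c 0 \<Longrightarrow> c = 0"
  using v_k[of c] by (cases "c = 0") (auto simp: vgt_def)

lemma v_power_int:
  assumes "x \<noteq> 0"
  shows "v (x powi n) = of_int n * v x"
proof -
  have nat: "v (x ^ m) = of_nat m * v x" for m
    by (induction m) (use assms in \<open>simp_all add: v_1 v_mult algebra_simps\<close>)
  show ?thesis
  proof (cases "n \<ge> 0")
    case True
    thus ?thesis using nat[of "nat n"] by (simp add: power_int_def)
  next
    case False
    thus ?thesis using nat[of "nat (- n)"] v_inverse[of "x ^ nat (- n)"] assms
      by (simp add: power_int_def power_inverse)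
  qed
qed

lemma v_prod: "(\<And>i. i \<in> I \<Longrightarrow> f i \<noteq> 0) \<Longrightarrow> v (\<Prod>i\<in>I. f i) = (\<Sum>i\<in>I. v (f i))"
  by (induction I rule: infinite_finite_induct) (simp_all add: v_1 v_mult)

lemma sum_log_derivatives_vge:
  assumes "is_derivation d" "\<And>c. c \<in> k \<Longrightarrow> d c \<in> k" "vge (d (T 1)) 1"
    and "\<And>i. i \<in> I \<Longrightarrow> f i \<noteq> 0" "\<And>i. i \<in> I \<Longrightarrow> a i \<in> k"
  shows "vge (\<Sum>i\<in>I. a i * (d (f i) / f i)) 0"
  by (intro vge_sum vge_mult0[OF vge_k] assms log_derivative_vge[OF assms(1-3)])

context
  fixes d :: "'a \<Rightarrow> 'a" and I :: "'i set" and f a :: "'i \<Rightarrow> 'a" and s G :: 'a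
  assumes d: "is_derivation d" and dk: "\<And>c. c \<in> k \<Longrightarrow> d c = 0"
    and f: "\<And>i. i \<in> I \<Longrightarrow> f i \<noteq> 0" and a: "\<And>i. i \<in> I \<Longrightarrow> a i \<in> k"
  defines "G \<equiv> (\<Sum>i\<in>I. a i * (d (f i) / f i)) + d s"
begin

text \<open>Rescaling \<open>d\<close> by \<open>T 1 / d (T 1)\<close> gives the Euler derivation,
  for which \<open>f i\<close> contributes the residue \<open>v (f i)\<close> and the exact term
  contributes none. So the sum in question is an element of \<open>k\<close> of positive value,
  hence \<open>0\<close>.\<close>

lemma residue_relation:
  assumes dT: "d (T 1) \<noteq> 0" and G: "G = 0"
  shows "(\<Sum>i\<in>I. a i * of_rat (v (f i))) = 0"
proof -
  define m where "m = T 1 / d (T 1)"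
  define E where "E = (\<lambda>x. m * d x)"
  have E: "is_derivation E" unfolding E_def by (rule is_derivation_scale[OF d])
  have Ek0: "E c = 0" if "c \<in> k" for c using dk[OF that] by (simp add: E_def)
  have Ek: "E c \<in> k" if "c \<in> k" for c using Ek0[OF that] subring_0[OF kR] by simp
  have ET: "E (T 1) = T 1" using dT by (simp add: E_def m_def)
  have ET': "vge (E (T 1)) 1" unfolding ET by (rule vge_T)
  have eq: "(\<Sum>i\<in>I. a i * (E (f i) / f i)) + E s = 0"
    using sum_log_derivatives_scale[of a m d f I s] G by (simp add: E_def G_def)
  have "vge (\<Sum>i\<in>I. a i * (E (f i) / f i)) 0"
    by (rule sum_log_derivatives_vge[OF E Ek ET' f a])
  hence Es: "vge (E s) 0"
    using vge_uminus[of "\<Sum>i\<in>I. a i * (E (f i) / f i)" 0] eq by (metis minus_unique)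
  have "vgt (E s) 0"
  proof (cases "s = 0")
    case True
    thus ?thesis by (simp add: derivation_0[OF E] vgt_0)
  next
    case s: False
    note eu = euler_derivation_vgt[OF E Ek0 ET s]
    consider "v s < 0" | "v s = 0" | "v s > 0" by linarith
    thus ?thesis
    proof cases
      case 1
      \<comment> \<open>A pole of \<open>s\<close> would give \<open>E s / s\<close> the nonzero
        residue \<open>v s\<close>, whereas \<open>E s\<close> has no pole and so
        \<open>E s / s\<close> has positive value.\<close>
      have "vgt (E s / s) 0"
        using vge_divide[OF Es s] 1 by (auto intro: vge_imp_vgt)
      from vgt_diff[OF this eu] have "vgt (of_rat (v s)) 0" by simp
      hence "of_rat (v s) = (0::'a)" using vgt_k_imp_0[OF of_rat_in_subfield[OF k]] by blast
      thus ?thesis using 1 by simp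
    next
      case 2
      obtain c where c: "c \<in> k" "vgt (s - c * T (v s)) (v s)" by (rule leading_termE[OF s])
      hence sc: "vgt (s - c) 0" by (simp add: 2 T_0)
      have "vgt (E (s - c)) 0" by (rule derivation_vgt[OF E Ek ET' sc])
      thus ?thesis using Ek0[OF c(1)] by (simp add: derivation_diff[OF E])
    next
      case 3
      hence s0: "vgt s 0" by (simp add: vgt_def)
      show ?thesis by (rule derivation_vgt[OF E Ek ET' s0])
    qed
  qed
  moreover have "vgt (\<Sum>i\<in>I. a i * (E (f i) / f i - of_rat (v (f i)))) 0"
  proof (rule vgt_sum)
    fix i assume i: "i \<in> I"
    show "vgt (a i * (E (f i) / f i - of_rat (v (f i)))) 0"
      using vgt_mult[OF vge_k[OF a[OF i]] euler_derivation_vgt[OF E Ek0 ET f[OF i]]] by simp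
  qed
  ultimately have "vgt (E s + (\<Sum>i\<in>I. a i * (E (f i) / f i - of_rat (v (f i))))) 0" by (rule vgt_add)
  moreover have "E s + (\<Sum>i\<in>I. a i * (E (f i) / f i - of_rat (v (f i))))
      = - (\<Sum>i\<in>I. a i * of_rat (v (f i)))"
    using eq by (simp add: right_diff_distrib sum_subtractf algebra_simps)
  ultimately have "vgt (- (\<Sum>i\<in>I. a i * of_rat (v (f i)))) 0" by simp
  moreover have "- (\<Sum>i\<in>I. a i * of_rat (v (f i))) \<in> k"
    by (intro subring_uminus[OF kR] subring_sum[OF kR] subring_mult[OF kR] a of_rat_in_subfield[OF k])
  ultimately show ?thesis using vgt_k_imp_0 by fastforce
qed

context
  fixes D :: "'a \<Rightarrow> 'a"
  assumes D: "is_derivation D" and Dk: "\<And>c. c \<in> k \<Longrightarrow> D c \<in> k"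
    and h: "(\<Sum>i\<in>I. a i * (D (f i) / f i)) + D s \<in> k"
begin

text \<open>\<open>D' = D - \<kappa> * d\<close> kills the parameter, so it does not lower values,
  and \<open>\<kappa> * G\<close> differs from the given element of \<open>k\<close> only by terms
  in \<open>D'\<close>. Thus \<open>G\<close> has no worse pole than \<open>s\<close>. But
  \<open>d\<close> worsens a pole of \<open>s\<close> by one order, so \<open>s\<close> can have
  none, and then neither has \<open>G\<close>.\<close>

lemma normal_place:
  assumes dT: "d (T 1) = 1" and DT: "D (T 1) \<noteq> 0" "v (D (T 1)) = 0"
  shows "vge G 0"
proof -
  define \<kappa> where "\<kappa> = D (T 1)"
  define D' where "D' = (\<lambda>x. D x - \<kappa> * d x)"
  define E where "E = (\<lambda>x. T 1 * d x)"
  have D': "is_derivation D'" unfolding D'_def by (intro is_derivation_diff is_derivation_scale D d)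
  have D'k: "D' c \<in> k" if "c \<in> k" for c using dk[OF that] Dk[OF that] by (simp add: D'_def)
  have D'T: "vge (D' (T 1)) 1" by (simp add: D'_def \<kappa>_def dT vge_0)
  have E: "is_derivation E" unfolding E_def by (rule is_derivation_scale[OF d])
  have Ek0: "E c = 0" if "c \<in> k" for c using dk[OF that] by (simp add: E_def)
  have Ek: "E c \<in> k" if "c \<in> k" for c using Ek0[OF that] subring_0[OF kR] by simp
  have ET: "E (T 1) = T 1" using dT by (simp add: E_def)
  have ET': "vge (E (T 1)) 1" unfolding ET by (rule vge_T)
  let ?S = "\<lambda>d. \<Sum>i\<in>I. a i * (d (f i) / f i)"
  have "?S D' + D' s = (?S D + D s) - (?S (\<lambda>x. \<kappa> * d x) + \<kappa> * d s)"
    unfolding D'_def by (rule sum_log_derivatives_diff)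
  also have "?S (\<lambda>x. \<kappa> * d x) + \<kappa> * d s = \<kappa> * G"
    unfolding G_def by (rule sum_log_derivatives_scale)
  finally have \<kappa>G: "\<kappa> * G = (?S D + D s) - ?S D' - D' s" by (simp add: algebra_simps)
  have \<kappa>: "\<kappa> \<noteq> 0" "v \<kappa> = 0" using DT by (simp_all add: \<kappa>_def)
  have S: "vge (?S D + D s - ?S D') 0"
    by (intro vge_diff vge_k h sum_log_derivatives_vge[OF D' D'k D'T f a])
  have G_ge: "vge G r" if r: "vge s r" "r \<le> 0" for r
  proof -
    have "vge (\<kappa> * G) r" unfolding \<kappa>G
      by (intro vge_diff vge_mono[OF S r(2)] derivation_vge[OF D' D'k D'T r(1)])
    from vge_divide[OF this \<kappa>(1)] show ?thesis using \<kappa> by simp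
  qed
  have "vge s 0"
  proof (rule ccontr)
    assume "\<not> vge s 0"
    hence s: "s \<noteq> 0" "v s < 0" by (auto simp: vge_def)
    have "vge G (v s)" by (rule G_ge[OF vge_v]) (use s in simp)
    hence "vge (T 1 * G) (1 + v s)" by (rule vge_mult[OF vge_T])
    hence 1: "vgt (T 1 * G) (v s)" by (rule vge_imp_vgt) simp
    have 2: "vgt (?S E) (v s)"
      by (rule vge_imp_vgt[OF sum_log_derivatives_vge[OF E Ek ET' f a] s(2)])
    have "?S E + E s = T 1 * G" unfolding E_def G_def by (rule sum_log_derivatives_scale)
    hence "E s = T 1 * G - ?S E" by (simp add: algebra_simps)
    hence "vgt (E s) (v s)" using vgt_diff[OF 1 2] by simp
    from vgt_mult[OF vge_v[of "inverse s"] this] have "vgt (E s / s) 0"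
      using s(1) by (simp add: v_inverse divide_inverse mult.commute)
    from vgt_diff[OF this euler_derivation_vgt[OF E Ek0 ET s(1)]] have "vgt (of_rat (v s)) 0" by simp
    hence "of_rat (v s) = (0::'a)" using vgt_k_imp_0[OF of_rat_in_subfield[OF k]] by blast
    thus False using s(2) by simp
  qed
  thus ?thesis by (rule G_ge) simp
qed

lemma regular_place_vge:
  assumes DT: "vge (D (T 1)) 1"
  shows "vge (D s) 0"
proof -
  have "vge ((\<Sum>i\<in>I. a i * (D (f i) / f i)) + D s - (\<Sum>i\<in>I. a i * (D (f i) / f i))) 0"
    by (rule vge_diff[OF vge_k[OF h] sum_log_derivatives_vge[OF D Dk DT f a]])
  thus ?thesis by simp
qed

text \<open>If \<open>c * T r\<close> is the leading term of a pole of \<open>s\<close>, its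
  derivative is \<open>z * T r\<close> with \<open>z \<in> k\<close>, and the regularity of
  \<open>D s\<close> forces \<open>z = 0\<close>. Then \<open>c * T r\<close> would be a constant
  outside \<open>k\<close>. Any parameter with logarithmic derivative in \<open>k\<close> is
  allowed, to cover both \<open>0\<close> and \<open>\<infinity>\<close>.\<close>

lemma exponential_place:
  assumes dT: "d (T 1) \<noteq> 0" and DT: "D (T 1) = u * T 1" "u \<in> k"
    and const: "\<And>c. D c = 0 \<Longrightarrow> c \<in> k"
  shows "vge (T 1 / d (T 1) * G) 0"
proof -
  have DT': "vge (D (T 1)) 1" unfolding DT(1) by (rule vge_kT[OF DT(2)])
  have s: "vge s 0"
  proof (rule ccontr)
    assume "\<not> vge s 0"
    hence s: "s \<noteq> 0" "v s < 0" by (auto simp: vge_def)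
    obtain c where c: "c \<in> k" "c \<noteq> 0" "vgt (s - c * T (v s)) (v s)" by (rule leading_termE[OF s(1)])
    define r where "r = v s"
    define z where "z = D c + c * (of_rat r * u)"
    have zk: "z \<in> k" unfolding z_def
      by (intro subring_add[OF kR] subring_mult[OF kR] Dk c DT of_rat_in_subfield[OF k])
    have Dc: "D (c * T r) = z * T r"
      using derivation_T[OF D Dk DT', of r] T_nonzero[of 1]
      by (simp add: derivation_mult[OF D] DT(1) z_def algebra_simps)
    have "vgt (D s) r" using vge_imp_vgt[OF regular_place_vge[OF DT']] s(2) by (simp add: r_def)
    moreover have "vgt (D (s - c * T r)) r"
      using derivation_vgt[OF D Dk DT' c(3)] by (simp add: r_def)
    ultimately have "vgt (D s - D (s - c * T r)) r" by (rule vgt_diff)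
    hence "vgt (z * T r) r" by (simp add: derivation_diff[OF D] Dc)
    hence "z = 0" using v_k[OF zk] T_nonzero[of r] by (cases "z = 0") (simp_all add: vgt_def v_mult v_T)
    hence "c * T r \<in> k" using const Dc by simp
    hence "v (c * T r) = 0" using v_k c(2) T_nonzero[of r] by simp
    thus False using s(2) c(1,2) v_k[OF c(1,2)] T_nonzero[of r] by (simp add: v_mult v_T r_def)
  qed
  define m where "m = T 1 / d (T 1)"
  define E where "E = (\<lambda>x. m * d x)"
  have E: "is_derivation E" unfolding E_def by (rule is_derivation_scale[OF d])
  have Ek: "E c \<in> k" if "c \<in> k" for c using dk[OF that] subring_0[OF kR] by (simp add: E_def)
  have ET: "vge (E (T 1)) 1" using dT vge_T[of 1] by (simp add: E_def m_def)
  have "vge ((\<Sum>i\<in>I. a i * (E (f i) / f i)) + E s) 0"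
    by (intro vge_add sum_log_derivatives_vge[OF E Ek ET f a] derivation_vge[OF E Ek ET s])
  moreover have "(\<Sum>i\<in>I. a i * (E (f i) / f i)) + E s = m * G"
    unfolding E_def G_def by (rule sum_log_derivatives_scale)
  ultimately show ?thesis by (simp add: m_def)
qed

text \<open>Here \<open>T 1\<close> will be \<open>inverse \<theta>\<close>. A simple pole of
  \<open>s\<close> is harmless since \<open>d\<close> raises values by one at this place. A worse
  pole is excluded by comparing two coefficients of the derivative of an expansion of
  \<open>s\<close>, which would produce a solution of \<open>D z = b\<close> in
  \<open>k\<close>.\<close>

lemma primitive_place:
  assumes dT: "d (T 1) = - (T 1)\<^sup>2" and DT: "D (T 1) = - b * (T 1)\<^sup>2" and b: "b \<in> k"
    and no_int: "\<And>z. z \<in> k \<Longrightarrow> D z \<noteq> b"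
  shows "vge G 0"
proof -
  have T2: "vge ((T 1)\<^sup>2) 2" using vge_power[OF vge_T[of 1], of 2] by simp
  have "vge (- b * (T 1)\<^sup>2) 2" by (rule vge_mult0[OF vge_uminus[OF vge_k[OF b]] T2])
  hence DT': "vge (D (T 1)) 1" unfolding DT by (rule vge_mono) simp
  have s: "vge s (- 1)"
  proof (rule ccontr)
    assume s: "\<not> vge s (- 1)"
    obtain q where q: "q \<in> puiseux_poly" "vge (s - q) 0" by (rule puiseux_approximation)
    have "vge (D s - D (s - q)) 0"
      by (intro vge_diff regular_place_vge[OF DT'] derivation_vge[OF D Dk DT' q(2)])
    hence Dq: "vge (D q) 0" by (simp add: derivation_diff[OF D])
    have q': "\<not> vge q (- 1)"
    proof
      assume "vge q (- 1)"
      hence "vge (q + (s - q)) (- 1)" by (intro vge_add vge_mono[OF q(2)]) simp_all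
      thus False using s by simp
    qed
    obtain A c where A: "finite A" "\<And>r. c r \<in> k" "\<And>r. r \<notin> A \<Longrightarrow> c r = 0" "q = (\<Sum>r\<in>A. c r * T r)"
      by (rule puiseux_polyE[OF q(1)]) blast
    \<comment> \<open>The coefficient of \<open>T r\<close> in \<open>D q\<close>: differentiating a
      power of the parameter raises its exponent by one, hence the shifted index.\<close>
    define e where "e r = D (c r) - of_rat (r - 1) * b * c (r - 1)" for r
    define B where "B = A \<union> (\<lambda>r. r + 1) ` A"
    have B: "finite B" using A(1) by (simp add: B_def)
    have ek: "e r \<in> k" for r unfolding e_def
      by (intro subring_diff[OF kR] subring_mult[OF kR] Dk A(2) b of_rat_in_subfield[OF k])
    have Dterm: "D (c r * T r) = D (c r) * T r - of_rat r * b * c r * T (r + 1)" for r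
      using derivation_T[OF D Dk DT', of r] T_nonzero[of 1]
      by (simp add: derivation_mult[OF D] DT T_add power2_eq_square algebra_simps)
    have "(\<Sum>r\<in>A. D (c r) * T r) = (\<Sum>r\<in>B. D (c r) * T r)"
      by (rule sum.mono_neutral_left) (use B A(3) in \<open>auto simp: B_def derivation_0[OF D]\<close>)
    moreover have "(\<Sum>r\<in>A. of_rat r * b * c r * T (r + 1)) = (\<Sum>r\<in>B. of_rat (r - 1) * b * c (r - 1) * T r)"
    proof -
      have "(\<Sum>r\<in>A. of_rat r * b * c r * T (r + 1))
          = (\<Sum>r\<in>(\<lambda>r. r + 1) ` A. of_rat (r - 1) * b * c (r - 1) * T r)"
        by (subst sum.reindex) (auto simp: inj_on_def)
      also have "\<dots> = (\<Sum>r\<in>B. of_rat (r - 1) * b * c (r - 1) * T r)"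
      proof (rule sum.mono_neutral_left)
        show "\<forall>r\<in>B - (\<lambda>r. r + 1) ` A. of_rat (r - 1) * b * c (r - 1) * T r = 0"
        proof
          fix r assume "r \<in> B - (\<lambda>r. r + 1) ` A"
          hence "r - 1 \<notin> A" by force
          thus "of_rat (r - 1) * b * c (r - 1) * T r = 0" using A(3) by simp
        qed
      qed (use B in \<open>auto simp: B_def\<close>)
      finally show ?thesis .
    qed
    ultimately have Dqe: "D q = (\<Sum>r\<in>B. e r * T r)"
      unfolding A(4) derivation_sum[OF D] Dterm
      by (simp add: sum_subtractf e_def left_diff_distrib)
    have e0: "e r = 0" if r: "r < 0" for r
    proof (cases "r \<in> B")
      case True
      show ?thesis
      proof (rule ccontr)
        assume "e r \<noteq> 0"
        from puiseux_poly_vge_coeff[OF B ek Dq[unfolded Dqe] True this] show False using r by simp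
      qed
    next
      case False
      have "r \<notin> A" using False by (simp add: B_def)
      moreover have "r - 1 \<notin> A"
      proof
        assume "r - 1 \<in> A"
        hence "r - 1 + 1 \<in> (\<lambda>r. r + 1) ` A" by (rule imageI)
        thus False using False by (simp add: B_def)
      qed
      ultimately show ?thesis using A(3) by (simp add: e_def derivation_0[OF D])
    qed
    define S where "S = {r\<in>A. c r \<noteq> 0}"
    have S: "\<exists>r\<in>S. r < - 1"
    proof (rule ccontr)
      assume no: "\<not> ?thesis"
      have "vge (c r * T r) (- 1)" if "r \<in> A" for r
      proof (cases "c r = 0")
        case False
        hence "- 1 \<le> r" using no that by (force simp: S_def)
        thus ?thesis by (rule vge_mono[OF vge_kT[OF A(2)]])
      qed (simp add: vge_0)
      thus False using q' unfolding A(4) by (auto intro: vge_sum)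
    qed
    have fS: "finite S" using A(1) by (simp add: S_def)
    obtain r0 where r0: "r0 \<in> S" "\<And>r. r \<in> S \<Longrightarrow> r0 \<le> r"
      using S Min_in[OF fS] Min_le[OF fS] by blast
    \<comment> \<open>The bound \<open>- 1\<close>, stronger than \<open>0\<close>, keeps
      \<open>r0 + 1\<close> negative too, so that both \<open>e r0\<close> and
      \<open>e (r0 + 1)\<close> vanish.\<close>
    have r01: "r0 < - 1" using S r0(2) by force
    have c0: "c r0 \<noteq> 0" using r0(1) by (simp add: S_def)
    have below: "c (r0 - 1) = 0"
    proof (rule ccontr)
      assume n: "c (r0 - 1) \<noteq> 0"
      hence "r0 - 1 \<in> S" using A(3) by (auto simp: S_def)
      thus False using r0(2)[of "r0 - 1"] by simp
    qed
    have Dc0: "D (c r0) = 0" using e0[of r0] r01 below by (simp add: e_def)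
    have Dc1: "D (c (r0 + 1)) = of_rat r0 * b * c r0" using e0[of "r0 + 1"] r01 by (simp add: e_def)
    define y where "y = of_rat r0 * c r0"
    have y0: "y \<noteq> 0" using c0 r01 by (simp add: y_def)
    have yk: "y \<in> k" unfolding y_def by (intro subring_mult[OF kR] A(2) of_rat_in_subfield[OF k])
    have Dy: "D y = 0" by (simp add: y_def derivation_mult[OF D] Dc0 derivation_of_rat[OF D])
    have "D (c (r0 + 1) * inverse y) = b"
      using y0 by (simp add: derivation_mult[OF D] derivation_inverse[OF D] Dy Dc1)
        (simp add: y_def field_simps)
    moreover have "c (r0 + 1) * inverse y \<in> k" by (intro subring_mult[OF kR] A(2) subfield_inverse[OF k] yk)
    ultimately show False using no_int by blast
  qed
  \<comment> \<open>This derivation sends the parameter to \<open>- T 1\<close> and so does not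
    lower values; multiplying back by \<open>T 1\<close> compensates the simple pole of
    \<open>s\<close>.\<close>
  define E where "E = (\<lambda>x. inverse (T 1) * d x)"
  have E: "is_derivation E" unfolding E_def by (rule is_derivation_scale[OF d])
  have Ek: "E c \<in> k" if "c \<in> k" for c using dk[OF that] subring_0[OF kR] by (simp add: E_def)
  have "E (T 1) = - T 1" using T_nonzero[of 1] by (simp add: E_def dT power2_eq_square)
  hence ET: "vge (E (T 1)) 1" using vge_uminus[OF vge_T[of 1]] by simp
  have "vge (\<Sum>i\<in>I. a i * (E (f i) / f i)) (- 1)"
    by (rule vge_mono[OF sum_log_derivatives_vge[OF E Ek ET f a]]) simp_all
  hence "vge ((\<Sum>i\<in>I. a i * (E (f i) / f i)) + E s) (- 1)"
    by (rule vge_add[OF _ derivation_vge[OF E Ek ET s]])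
  moreover have "(\<Sum>i\<in>I. a i * (E (f i) / f i)) + E s = inverse (T 1) * G"
    unfolding E_def G_def by (rule sum_log_derivatives_scale)
  ultimately have "vge (inverse (T 1) * G) (- 1)" by simp
  from vge_mult[OF vge_T[of 1] this] show ?thesis
    using T_nonzero[of 1] by (simp flip: mult.assoc)
qed

end

end

end

section \<open>Algebraically closed fields of transcendence degree one\<close>

locale closed_one_variable_field =
  fixes k :: "'a::{alg_closed_field, field_char_0} set" and \<theta> :: 'a
  assumes k: "is_subfield k" and k_closed: "algebraically_closed_in_type k"
    and \<theta>: "\<theta> \<notin> k" and algebraic: "algebraic_over (field_adjoin k \<theta>) x"
begin

lemmas kR = subfield_imp_subring[OF k]

lemma not_algebraic: "x \<notin> k \<Longrightarrow> \<not> algebraic_over k x"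
  using k_closed by (auto simp: algebraically_closed_in_type_def)

text \<open>The parameter comes from the line with coordinate \<open>\<theta>\<close> and has value
  \<open>1\<close>; ramification over that line appears as fractional values.\<close>

definition at_place :: "(rat \<Rightarrow> 'a) \<Rightarrow> ('a \<Rightarrow> rat) \<Rightarrow> bool" where
  "at_place T v \<longleftrightarrow> puiseux_valuation k T v \<and> ((\<exists>c\<in>k. T 1 = \<theta> - c) \<or> T 1 = inverse \<theta>)"

text \<open>The residue \<open>c\<close> of \<open>\<theta>\<close> gives the parameter
  \<open>\<theta> - c\<close>; if \<open>\<theta>\<close> is not in \<open>V\<close>, the parameter
  is \<open>inverse \<theta>\<close>.\<close>

lemma placeE:
  assumes V: "valuation_ring V" "k \<subseteq> V" "V \<noteq> UNIV"
  obtains T v where "at_place T v" "\<And>x. x \<in> V \<longleftrightarrow> x = 0 \<or> 0 \<le> v x"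
proof -
  note VR = valuation_ring_subring[OF V(1)]
  note res = valuation_ring_residue[OF k k_closed algebraic V]
  have \<theta>0: "\<theta> \<noteq> 0" using \<theta> subring_0[OF kR] by auto
  note thesisI = that
  have place: thesis if t: "t \<in> V" "inverse t \<notin> V" "(\<exists>c\<in>k. t = \<theta> - c) \<or> t = inverse \<theta>" for t
  proof -
    have "t \<notin> k" using t(2) V(2) subfield_inverse[OF k] by blast
    hence nt: "\<not> algebraic_over k t" by (rule not_algebraic)
    obtain T v where Tv: "puiseux_valuation k T v" "T 1 = t" "\<And>x. x \<in> V \<longleftrightarrow> x = 0 \<or> 0 \<le> v x"
      by (rule valuation_ring_puiseux[OF k V(1,2) t(1,2) res
            algebraic_over_adjoin_exchange[OF k algebraic nt]]) blast+
    show thesis by (rule thesisI[of T v]) (use Tv t(3) in \<open>simp_all add: at_place_def\<close>)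
  qed
  show thesis
  proof (cases "\<theta> \<in> V")
    case True
    obtain c where c: "c \<in> k" "\<theta> - c = 0 \<or> inverse (\<theta> - c) \<notin> V" using res[OF True] by blast
    have "\<theta> - c \<noteq> 0" using \<theta> c(1) by auto
    moreover have "\<theta> - c \<in> V" using True c(1) V(2) by (intro subring_diff[OF VR]) auto
    ultimately show thesis using c by (intro place[of "\<theta> - c"]) auto
  next
    case False
    have "inverse \<theta> \<in> V" using False V(1) by (auto simp: valuation_ring_def)
    thus thesis using False by (intro place[of "inverse \<theta>"]) auto
  qed
qed

text \<open>An element outside \<open>k\<close> is transcendental over it, and Chevalley's theorem
  provides a valuation ring over \<open>k\<close> that omits it, hence a place where it has a
  pole.\<close>

lemma in_k_if_regular_everywhere:
  assumes "\<And>T v. at_place T v \<Longrightarrow> x = 0 \<or> 0 \<le> v x"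
  shows "x \<in> k"
proof (rule ccontr)
  assume "x \<notin> k"
  then obtain V where V: "valuation_ring V" "k \<subseteq> V" "x \<notin> V"
    using chevalley_valuation_ring[OF k not_algebraic] by blast
  have "V \<noteq> UNIV" using V(3) by auto
  then obtain T v where "at_place T v" "\<And>x. x \<in> V \<longleftrightarrow> x = 0 \<or> 0 \<le> v x"
    using placeE[OF V(1,2)] by metis
  thus False using assms V(3) by blast
qed

lemma \<theta>_nonzero: "\<theta> \<noteq> 0"
  using \<theta> subring_0[OF kR] by auto

context
  fixes d :: "'a \<Rightarrow> 'a" and I :: "'i set" and f a :: "'i \<Rightarrow> 'a"
  assumes d: "is_derivation d" and dk: "\<And>c. c \<in> k \<Longrightarrow> d c = 0" and d\<theta>: "d \<theta> = 1"
    and f: "\<And>i. i \<in> I \<Longrightarrow> f i \<noteq> 0" and a: "\<And>i. i \<in> I \<Longrightarrow> a i \<in> k"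
begin

lemma d_inverse_\<theta>: "d (inverse \<theta>) = - (inverse \<theta>)\<^sup>2"
  by (simp add: derivation_inverse[OF d \<theta>_nonzero] d\<theta> power_inverse divide_inverse)

lemma d_parameter_nonzero: "at_place T v \<Longrightarrow> d (T 1) \<noteq> 0"
  using \<theta>_nonzero d_inverse_\<theta> by (auto simp: at_place_def derivation_diff[OF d] dk d\<theta>)

text \<open>Residues turn the relation between forms into \<open>\<Sum>i. a i * v (f i) = 0\<close> at every place.
  A \<open>\<rat>\<close>-linear functional that does not vanish on all \<open>a i\<close> makes the coefficients rational,
  and the resulting power product has neither zeros nor poles.\<close>

lemma log_forms_dependent:
  assumes I: "finite I" and eq: "(\<Sum>i\<in>I. a i * (d (f i) / f i)) + d s = 0"
    and j: "j \<in> I" "a j \<noteq> 0"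
  shows "\<exists>e :: 'i \<Rightarrow> int. (\<exists>i\<in>I. e i \<noteq> 0) \<and> (\<Prod>i\<in>I. f i powi e i) \<in> k"
proof -
  obtain g :: "'a \<Rightarrow> rat" where g: "\<And>x y. g (x + y) = g x + g y" "\<And>r x. g (x * of_rat r) = g x * r" "g (a j) \<noteq> 0"
    using rat_linear_functional[OF j(2)] by metis
  have g0: "g 0 = 0" using g(1)[of 0 0] by simp
  have gsum: "g (\<Sum>i\<in>I. h i) = (\<Sum>i\<in>I. g (h i))" for h
    using I by (induction I rule: finite_induct) (simp_all add: g g0)
  obtain C e where e: "C \<noteq> 0" "\<And>i. i \<in> I \<Longrightarrow> of_int (e i) = of_int C * g (a i)"
    using common_denominator[OF I, of "\<lambda>i. g (a i)"] by blast
  have "e j \<noteq> 0" using e(2)[OF j(1)] e(1) g(3) by auto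
  moreover have "(\<Prod>i\<in>I. f i powi e i) \<in> k"
  proof (rule in_k_if_regular_everywhere)
    fix T v assume p: "at_place T v"
    interpret puiseux_valuation k T v using p by (simp add: at_place_def)
    have "g (\<Sum>i\<in>I. a i * of_rat (v (f i))) = g 0"
      by (rule arg_cong[of _ _ g])
        (rule residue_relation[OF d dk f a d_parameter_nonzero[OF p] eq])
    hence r: "(\<Sum>i\<in>I. g (a i) * v (f i)) = 0" by (simp add: gsum g g0)
    have "v (\<Prod>i\<in>I. f i powi e i) = (\<Sum>i\<in>I. of_int (e i) * v (f i))"
      using f by (subst v_prod) (simp_all add: v_power_int)
    also have "\<dots> = of_int C * (\<Sum>i\<in>I. g (a i) * v (f i))"
      by (simp add: sum_distrib_left e(2) mult.assoc)
    finally show "(\<Prod>i\<in>I. f i powi e i) = 0 \<or> 0 \<le> v (\<Prod>i\<in>I. f i powi e i)" by (simp add: r)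
  qed
  ultimately show ?thesis using j(1) by blast
qed

context
  fixes D :: "'a \<Rightarrow> 'a" and s :: 'a
  assumes D: "is_derivation D" and Dk: "\<And>c. c \<in> k \<Longrightarrow> D c \<in> k"
    and const: "\<And>c. D c = 0 \<Longrightarrow> c \<in> k"
    and h: "(\<Sum>i\<in>I. a i * (D (f i) / f i)) + D s \<in> k"
begin

lemma D_inverse_\<theta>: "D (inverse \<theta>) = - D \<theta> * (inverse \<theta>)\<^sup>2"
  by (simp add: derivation_inverse[OF D \<theta>_nonzero] power_inverse divide_inverse)

text \<open>\<open>D \<theta>\<close> has no integral \<open>z\<close> in \<open>k\<close>, since
  \<open>\<theta> - z\<close> would be a constant outside \<open>k\<close>. This is the requirement
  at \<open>\<infinity>\<close>, and at a finite place it makes the derivative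
  \<open>D \<theta> - D c\<close> of the parameter a nonzero element of \<open>k\<close>.\<close>

lemma primitive_regular:
  assumes D\<theta>: "D \<theta> \<in> k"
  shows "(\<Sum>i\<in>I. a i * (d (f i) / f i)) + d s \<in> k"
proof (rule in_k_if_regular_everywhere)
  fix T v assume p: "at_place T v"
  interpret puiseux_valuation k T v using p by (simp add: at_place_def)
  have no_int: "D z \<noteq> D \<theta>" if "z \<in> k" for z
  proof
    assume "D z = D \<theta>"
    hence "\<theta> - z \<in> k" by (intro const) (simp add: derivation_diff[OF D])
    from subring_add[OF kR this that] show False using \<theta> by simp
  qed
  have "vge ((\<Sum>i\<in>I. a i * (d (f i) / f i)) + d s) 0"
  proof (cases "T 1 = inverse \<theta>")
    case True
    show ?thesis
      by (rule primitive_place[OF d dk f a D Dk h _ _ D\<theta> no_int])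
        (simp_all only: True d_inverse_\<theta> D_inverse_\<theta>)
  next
    case False
    then obtain c where c: "c \<in> k" "T 1 = \<theta> - c" using p by (auto simp: at_place_def)
    have dT: "d (T 1) = 1" by (simp add: c derivation_diff[OF d] dk d\<theta>)
    have DT: "D (T 1) = D \<theta> - D c" by (simp add: c derivation_diff[OF D])
    have DT0: "D (T 1) \<noteq> 0" using no_int[OF c(1)] by (simp add: DT)
    have "D (T 1) \<in> k" unfolding DT by (intro subring_diff[OF kR] D\<theta> Dk c)
    hence "v (D (T 1)) = 0" using DT0 by (rule v_k)
    from normal_place[OF d dk f a D Dk h dT DT0 this] show ?thesis by simp
  qed
  thus "(\<Sum>i\<in>I. a i * (d (f i) / f i)) + d s = 0 \<or> 0 \<le> v ((\<Sum>i\<in>I. a i * (d (f i) / f i)) + d s)"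
    by (simp add: vge_def)
qed

text \<open>The factor \<open>\<theta>\<close> is \<open>T 1 / d (T 1)\<close> at \<open>0\<close>
  and, up to sign, at \<open>\<infinity>\<close>; at the other places it is regular.\<close>

lemma exponential_regular:
  assumes D\<theta>: "D \<theta> = u * \<theta>" "u \<in> k"
  shows "\<theta> * ((\<Sum>i\<in>I. a i * (d (f i) / f i)) + d s) \<in> k"
proof (rule in_k_if_regular_everywhere)
  fix T v assume p: "at_place T v"
  interpret puiseux_valuation k T v using p by (simp add: at_place_def)
  let ?G = "(\<Sum>i\<in>I. a i * (d (f i) / f i)) + d s"
  consider (infinity) "T 1 = inverse \<theta>" | (zero) "T 1 = \<theta>" | (normal) c where "c \<in> k" "c \<noteq> 0" "T 1 = \<theta> - c"
    using p unfolding at_place_def by (metis diff_zero)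
  hence "vge (\<theta> * ?G) 0"
  proof cases
    case infinity
    have "D (T 1) = - u * T 1"
      using \<theta>_nonzero by (simp add: infinity D_inverse_\<theta> D\<theta> power2_eq_square)
    moreover have "- u \<in> k" using D\<theta>(2) by (rule subring_uminus[OF kR])
    ultimately have "vge (T 1 / d (T 1) * ?G) 0"
      using exponential_place[OF d dk f a D Dk h d_parameter_nonzero[OF p] _ _ const] by blast
    moreover have "T 1 / d (T 1) = - \<theta>"
      unfolding infinity d_inverse_\<theta> using \<theta>_nonzero by (simp add: power2_eq_square field_simps)
    ultimately have "vge (- (\<theta> * ?G)) 0" by simp
    from vge_uminus[OF this] show ?thesis by simp
  next
    case zero
    have "D (T 1) = u * T 1" by (simp add: zero D\<theta>)
    hence "vge (T 1 / d (T 1) * ?G) 0"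
      using exponential_place[OF d dk f a D Dk h d_parameter_nonzero[OF p] _ D\<theta>(2) const] by blast
    thus ?thesis by (simp add: zero d\<theta>)
  next
    case (normal c)
    \<comment> \<open>The residue of \<open>D (\<theta> - c)\<close>; if it vanished,
      \<open>\<theta> / c\<close> would be a constant outside \<open>k\<close>.\<close>
    define \<kappa> where "\<kappa> = u * c - D c"
    have dT: "d (T 1) = 1" by (simp add: normal derivation_diff[OF d] dk d\<theta>)
    have \<kappa>k: "\<kappa> \<in> k" unfolding \<kappa>_def by (intro subring_diff[OF kR] subring_mult[OF kR] D\<theta> Dk normal)
    have DT: "D (T 1) = \<kappa> + u * T 1" by (simp add: normal derivation_diff[OF D] D\<theta> \<kappa>_def algebra_simps)
    have \<kappa>0: "\<kappa> \<noteq> 0"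
    proof
      assume "\<kappa> = 0"
      hence Dc: "D c = u * c" by (simp add: \<kappa>_def)
      have "D (\<theta> * inverse c) = 0" using normal(2)
        by (simp add: derivation_mult[OF D] derivation_inverse[OF D] Dc D\<theta> power2_eq_square divide_inverse)
      hence "\<theta> * inverse c \<in> k" by (rule const)
      from subring_mult[OF kR this normal(1)] show False
        using \<theta> normal(2) by (simp add: mult.assoc)
    qed
    have "vgt (u * T 1) (v \<kappa>)"
      using vge_imp_vgt[OF vge_kT[OF D\<theta>(2), of 1]] by (simp add: v_k[OF \<kappa>k \<kappa>0])
    from v_dominant[OF \<kappa>0 this] have "D (T 1) \<noteq> 0" "v (D (T 1)) = 0"
      by (simp_all add: DT v_k[OF \<kappa>k \<kappa>0])
    from normal_place[OF d dk f a D Dk h dT this] have "vge ?G 0" by simp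
    moreover have "vge (T 1 + c) 0"
      by (intro vge_add vge_k normal vge_mono[OF vge_T[of 1]]) simp
    ultimately have "vge ((T 1 + c) * ?G) 0" by (rule vge_mult0[rotated])
    thus ?thesis by (simp add: normal)
  qed
  thus "\<theta> * ?G = 0 \<or> 0 \<le> v (\<theta> * ?G)" by (simp add: vge_def)
qed

text \<open>An element \<open>G\<close> of \<open>k\<close> is exact, being
  \<open>d (G * \<theta>)\<close>; absorbing it into \<open>s\<close> leaves a vanishing
  form.\<close>

lemma primitive_dependent:
  assumes I: "finite I" and D\<theta>: "D \<theta> \<in> k" and j: "j \<in> I" "a j \<noteq> 0"
  shows "\<exists>e :: 'i \<Rightarrow> int. (\<exists>i\<in>I. e i \<noteq> 0) \<and> (\<Prod>i\<in>I. f i powi e i) \<in> k"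
proof -
  define G where "G = (\<Sum>i\<in>I. a i * (d (f i) / f i)) + d s"
  have "G \<in> k" unfolding G_def by (rule primitive_regular[OF D\<theta>])
  hence "d (s - G * \<theta>) = d s - G" by (simp add: derivation_diff[OF d] derivation_mult[OF d] dk d\<theta>)
  hence "(\<Sum>i\<in>I. a i * (d (f i) / f i)) + d (s - G * \<theta>) = 0" by (simp add: G_def)
  from log_forms_dependent[OF I this j] show ?thesis .
qed

end

end

text \<open>The form equals \<open>G * d \<theta> / \<theta>\<close> with \<open>G \<in> k\<close>,
  a logarithmic term: \<open>\<theta>\<close> joins the family at the fresh index \<open>l\<close>
  with coefficient \<open>- G\<close>. The nonzero coefficient at \<open>j\<close> is unaffected
  because \<open>j \<noteq> l\<close>.\<close>

lemma exponential_dependent: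
  fixes f a :: "'i \<Rightarrow> 'a"
  assumes d: "is_derivation d" "\<And>c. c \<in> k \<Longrightarrow> d c = 0" "d \<theta> = 1"
    and f: "\<And>i. i \<in> I \<Longrightarrow> f i \<noteq> 0" and a: "\<And>i. i \<in> I \<Longrightarrow> a i \<in> k"
    and D: "is_derivation D" "\<And>c. c \<in> k \<Longrightarrow> D c \<in> k" "\<And>c. D c = 0 \<Longrightarrow> c \<in> k"
    and h: "(\<Sum>i\<in>I. a i * (D (f i) / f i)) + D s \<in> k"
    and I: "finite I" "l \<notin> I" and D\<theta>: "D \<theta> = u * \<theta>" "u \<in> k" and j: "j \<in> I" "a j \<noteq> 0"
  shows "\<exists>e :: 'i \<Rightarrow> int. (\<exists>i\<in>insert l I. e i \<noteq> 0) \<and> (\<Prod>i\<in>insert l I. (f(l := \<theta>)) i powi e i) \<in> k"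
proof -
  define G where "G = \<theta> * ((\<Sum>i\<in>I. a i * (d (f i) / f i)) + d s)"
  define f' where "f' = f(l := \<theta>)"
  define a' where "a' = a(l := - G)"
  have "G \<in> k" unfolding G_def by (rule exponential_regular[OF d f a D h D\<theta>])
  hence a': "a' i \<in> k" if "i \<in> insert l I" for i
    using that a by (auto simp: a'_def subring_uminus[OF kR])
  have f': "f' i \<noteq> 0" if "i \<in> insert l I" for i using that f \<theta>_nonzero by (auto simp: f'_def)
  have "(\<Sum>i\<in>insert l I. a' i * (d (f' i) / f' i)) = - G / \<theta> + (\<Sum>i\<in>I. a' i * (d (f' i) / f' i))"
    using I by (simp add: a'_def f'_def d(3))
  also have "(\<Sum>i\<in>I. a' i * (d (f' i) / f' i)) = (\<Sum>i\<in>I. a i * (d (f i) / f i))"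
    by (rule sum.cong) (use I in \<open>auto simp: a'_def f'_def\<close>)
  finally have eq: "(\<Sum>i\<in>insert l I. a' i * (d (f' i) / f' i)) + d s = 0"
    using \<theta>_nonzero by (simp add: G_def)
  have j': "j \<in> insert l I" "a' j \<noteq> 0" using j I by (auto simp: a'_def)
  have fin: "finite (insert l I)" using I by simp
  show ?thesis
    unfolding f'_def[symmetric] by (rule log_forms_dependent[OF d f' a' fin eq j'])
qed

end

section \<open>Descent from the algebraic closure\<close>

lemma minimal_polynomial:
  assumes E: "is_subfield E" and x: "algebraic_over E x"
  obtains p where "p \<in> poly_over E" "lead_coeff p = 1" "poly p x = 0"
    "\<And>q. q \<in> poly_over E \<Longrightarrow> poly q x = 0 \<Longrightarrow> degree q < degree p \<Longrightarrow> q = 0"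
proof -
  note ER = subfield_imp_subring[OF E]
  let ?P = "\<lambda>p. p \<in> poly_over E \<and> p \<noteq> 0 \<and> poly p x = 0"
  obtain p0 where "?P p0" using x by (auto simp: algebraic_over_iff)
  hence "\<exists>p. ?P p \<and> (\<forall>q. ?P q \<longrightarrow> degree p \<le> degree q)" by (rule ex_has_least_nat)
  then obtain p where p: "p \<in> poly_over E" "p \<noteq> 0" "poly p x = 0"
    and least: "\<And>q. q \<in> poly_over E \<Longrightarrow> q \<noteq> 0 \<Longrightarrow> poly q x = 0 \<Longrightarrow> degree p \<le> degree q" by auto
  let ?p = "smult (inverse (lead_coeff p)) p"
  have l: "inverse (lead_coeff p) \<in> E" using p(1) by (intro subfield_inverse[OF E]) (simp add: poly_over_def)
  show ?thesis
  proof (rule that[of ?p])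
    show "?p \<in> poly_over E" by (intro poly_over_smult[OF ER] l p)
    show "lead_coeff ?p = 1" using p(2) by simp
    show "poly ?p x = 0" using p(3) by simp
    fix q assume q: "q \<in> poly_over E" "poly q x = 0" "degree q < degree ?p"
    show "q = 0" using least[OF q(1) _ q(2)] q(3) p(2) by force
  qed
qed

context
  fixes D :: "'a::field_char_0 \<Rightarrow> 'a" and E :: "'a set"
  assumes D: "is_derivation D" and E: "is_subfield E" and DE: "\<And>x. x \<in> E \<Longrightarrow> D x \<in> E"
begin

lemma map_poly_derivation_over: "p \<in> poly_over E \<Longrightarrow> map_poly D p \<in> poly_over E"
  using DE by (simp add: poly_over_def coeff_map_poly derivation_0[OF D])

lemma degree_map_poly_derivation_less:
  assumes "lead_coeff p = 1" "degree p > 0"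
  shows "degree (map_poly D p) < degree p"
proof -
  have "degree (map_poly D p) \<le> degree p - 1"
  proof (rule degree_le, intro allI impI)
    fix i assume "degree p - 1 < i"
    hence "i = degree p \<or> degree p < i" by linarith
    thus "coeff (map_poly D p) i = 0"
      using assms by (auto simp: coeff_map_poly derivation_0[OF D] derivation_1[OF D] coeff_eq_0)
  qed
  thus ?thesis using assms(2) by linarith
qed

text \<open>Differentiating the minimal equation gives \<open>D x\<close> as a quotient of
  polynomials in \<open>x\<close> over \<open>E\<close>, with nonzero denominator by
  minimality.\<close>

lemma derivation_algebraic:
  assumes x: "algebraic_over E x"
  shows "algebraic_over E (D x)"
proof -
  note ER = subfield_imp_subring[OF E]
  note A = is_subfield_algebraic[OF E]
  obtain p where p: "p \<in> poly_over E" "lead_coeff p = 1" "poly p x = 0"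
    and least: "\<And>q. q \<in> poly_over E \<Longrightarrow> poly q x = 0 \<Longrightarrow> degree q < degree p \<Longrightarrow> q = 0"
    using minimal_polynomial[OF E x] by metis
  have dp: "degree p > 0"
  proof (rule ccontr)
    assume d: "\<not> degree p > 0"
    then obtain c where "p = [:c:]" by (metis degree_eq_zeroE gr0I)
    thus False using p by simp
  qed
  have "poly (pderiv p) x \<noteq> 0"
    using least[OF poly_over_pderiv[OF ER p(1)]] dp by (auto simp: degree_pderiv pderiv_eq_0_iff)
  moreover have "poly (map_poly D p) x + poly (pderiv p) x * D x = 0"
    using derivation_poly[OF D, of p x] p(3) by (simp add: derivation_0[OF D])
  ultimately have "D x = - poly (map_poly D p) x / poly (pderiv p) x"
    by (simp add: field_simps eq_neg_iff_add_eq_0)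
  moreover have "poly q x \<in> {y. algebraic_over E y}" if "q \<in> poly_over E" for q
    by (rule poly_in_subring[OF subfield_imp_subring[OF A]])
      (use that x algebraic_over_self[OF E] in \<open>auto simp: poly_over_def\<close>)
  ultimately have "D x \<in> {y. algebraic_over E y}"
    using map_poly_derivation_over[OF p(1)] poly_over_pderiv[OF ER p(1)]
    by (metis subfield_divide[OF A] subring_uminus[OF subfield_imp_subring[OF A]])
  thus ?thesis by simp
qed

text \<open>Since \<open>D x = 0\<close>, differentiating the coefficients of the minimal polynomial
  gives another annihilator of \<open>x\<close>. The leading coefficient \<open>1\<close>
  disappears, so the degree drops; the new polynomial is zero and all coefficients are
  constants.\<close>

lemma constant_algebraic_over_constants:
  assumes x: "algebraic_over E x" and Dx: "D x = 0"
  shows "algebraic_over {c \<in> E. D c = 0} x"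
proof -
  obtain p where p: "p \<in> poly_over E" "lead_coeff p = 1" "poly p x = 0"
    and least: "\<And>q. q \<in> poly_over E \<Longrightarrow> poly q x = 0 \<Longrightarrow> degree q < degree p \<Longrightarrow> q = 0"
    using minimal_polynomial[OF E x] by metis
  have dp: "degree p > 0"
  proof (rule ccontr)
    assume d: "\<not> degree p > 0"
    then obtain c where "p = [:c:]" by (metis degree_eq_zeroE gr0I)
    thus False using p by simp
  qed
  have "poly (map_poly D p) x = 0"
    using derivation_poly[OF D, of p x] p(3) Dx by (simp add: derivation_0[OF D])
  hence "map_poly D p = 0"
    by (rule least[OF map_poly_derivation_over[OF p(1)] _ degree_map_poly_derivation_less[OF p(2) dp]])
  hence "D (coeff p i) = 0" for i using coeff_map_poly[of D p i] by (simp add: derivation_0[OF D])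
  hence "p \<in> poly_over {c \<in> E. D c = 0}" using p(1) by (simp add: poly_over_def)
  moreover have "p \<noteq> 0" using p(2) by auto
  ultimately show ?thesis using p(3) unfolding algebraic_over_iff by blast
qed

end

section \<open>The embedding into the algebraic closure\<close>

lemma poly_map_to_ac: "poly (map_poly to_ac p) (to_ac x) = to_ac (poly p x)"
  by (induction p) (simp_all add: map_poly_pCons)

lemma to_ac_power_int: "to_ac (x powi n) = to_ac x powi n"
  by (simp add: power_int_def)

lemma is_subfield_to_ac: "is_subfield F \<Longrightarrow> is_subfield (to_ac ` F)"
  unfolding is_subfield_def
  by (auto simp: image_iff simp flip: to_ac_add to_ac_mult to_ac_minus to_ac_inverse to_ac_0 to_ac_1)

text \<open>The direction from the closure downwards, where coefficients are pulled back by
  \<open>of_ac\<close>, is what later identifies \<open>k \<inter> K\<close> with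
  \<open>F\<close>.\<close>

lemma algebraic_over_to_ac:
  "algebraic_over (to_ac ` F) (to_ac x) \<longleftrightarrow> algebraic_over F x"
proof
  assume "algebraic_over F x"
  then obtain p where p: "p \<in> poly_over F" "p \<noteq> 0" "poly p x = 0" by (auto simp: algebraic_over_iff)
  have "map_poly to_ac p \<in> poly_over (to_ac ` F)" using p(1) by (simp add: poly_over_def coeff_map_poly)
  moreover have "map_poly to_ac p \<noteq> 0" using p(2) by (simp add: map_poly_eq_0_iff)
  moreover have "poly (map_poly to_ac p) (to_ac x) = 0" using p(3) by (simp add: poly_map_to_ac)
  ultimately show "algebraic_over (to_ac ` F) (to_ac x)" unfolding algebraic_over_iff by blast
next
  assume "algebraic_over (to_ac ` F) (to_ac x)"
  then obtain p where p: "p \<in> poly_over (to_ac ` F)" "p \<noteq> 0" "poly p (to_ac x) = 0"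
    by (auto simp: algebraic_over_iff)
  define q where "q = map_poly of_ac p"
  have pq: "to_ac (of_ac (coeff p i)) = coeff p i" for i
    using p(1) by (intro to_ac_of_ac) (auto simp: poly_over_def)
  have q: "map_poly to_ac q = p"
    by (rule poly_eqI) (simp add: q_def coeff_map_poly pq)
  have "coeff q i \<in> F" for i
  proof -
    obtain y where "y \<in> F" "coeff p i = to_ac y" using p(1) by (auto simp: poly_over_def)
    thus ?thesis by (simp add: q_def coeff_map_poly)
  qed
  hence "q \<in> poly_over F" by (simp add: poly_over_def)
  moreover have "q \<noteq> 0" using q p(2) by auto
  moreover have "to_ac (poly q x) = 0" using p(3) by (simp add: q flip: poly_map_to_ac)
  ultimately show "algebraic_over F x" unfolding algebraic_over_iff by auto
qed

theorem lemma4p2: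
  fixes D :: "'a::field_char_0 \<Rightarrow> 'a" and F :: "'a set" and \<theta> s :: 'a
    and n :: nat and \<psi> a :: "nat \<Rightarrow> 'a"
  assumes "is_derivation D"
    and "is_differential_subfield D F"
    and "transcendental_over F \<theta>"
    and "\<forall>x. algebraic_over (field_adjoin F \<theta>) x"
    and "exp_of_primitive_over D F \<theta> \<or> primitive_over D F \<theta>"
    and "algebraically_closed_in_type F"
    and "constants_of D F = constants_of D UNIV"
    and "\<forall>i\<in>{1..n}. \<psi> i \<noteq> 0"
    and "mult_independent_mod F {1..n} \<psi>"
    and "exp_of_primitive_over D F \<theta> \<longrightarrow> mult_independent_mod F {0..n} (\<psi>(0 := \<theta>))"
    and "\<forall>i\<in>{1..n}. a i \<in> F"
    and "(\<Sum>i=1..n. a i * (D (\<psi> i) / \<psi> i)) + D s \<in> F"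
  shows "\<forall>i\<in>{1..n}. a i = 0"
proof (rule ccontr)
  assume "\<not> ?thesis"
  then obtain j where j: "j \<in> {1..n}" "a j \<noteq> 0" by blast
  note D = assms(1)
  have F: "is_subfield F" and DF: "\<And>x. x \<in> F \<Longrightarrow> D x \<in> F"
    using assms(2) by (auto simp: is_differential_subfield_def)
  define \<iota> :: "'a \<Rightarrow> 'a alg_closure" where "\<iota> = to_ac"
  obtain \<Delta> where \<Delta>: "is_derivation \<Delta>" and \<Delta>\<iota>: "\<And>x. \<Delta> (\<iota> x) = \<iota> (D x)"
    by (rule derivation_extension[of \<iota> "\<lambda>x. \<iota> (D x)"])
      (simp_all add: \<iota>_def derivation_add[OF D] derivation_mult[OF D])
  have F': "is_subfield (\<iota> ` F)" unfolding \<iota>_def by (rule is_subfield_to_ac[OF F])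
  define k where "k = {x. algebraic_over (\<iota> ` F) x}"
  have k: "is_subfield k" unfolding k_def by (rule is_subfield_algebraic[OF F'])
  have Fk: "\<iota> x \<in> k" if "x \<in> F" for x
    unfolding k_def using algebraic_over_self[OF F'] that by simp
  have k\<iota>: "x \<in> F" if "\<iota> x \<in> k" for x
    using that assms(6) algebraic_over_to_ac[of F x]
    by (simp add: k_def \<iota>_def algebraically_closed_in_type_def)
  have k_closed: "algebraically_closed_in_type k"
    unfolding algebraically_closed_in_type_def
    using algebraic_over_trans[OF F' k] by (auto simp: k_def)
  have \<theta>k: "\<iota> \<theta> \<notin> k" using assms(3) algebraic_over_to_ac[of F \<theta>] by (simp add: k_def \<iota>_def)
  have range: "is_subfield (range \<iota>)"
    using is_subfield_to_ac[of "UNIV :: 'a set"] by (simp add: \<iota>_def is_subfield_def)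
  have over_range: "algebraic_over (range \<iota>) x" for x
  proof -
    obtain p :: "'a poly" where p: "p \<noteq> 0" "poly (map_poly to_ac p) x = 0" by (rule alg_closure_algebraic)
    have "map_poly to_ac p \<in> poly_over (range \<iota>)" by (simp add: poly_over_def coeff_map_poly \<iota>_def)
    moreover have "map_poly to_ac p \<noteq> 0" using p(1) by (simp add: map_poly_eq_0_iff)
    ultimately show ?thesis using p(2) unfolding algebraic_over_iff by blast
  qed
  have alg: "algebraic_over (field_adjoin k (\<iota> \<theta>)) x" for x
  proof -
    let ?M = "field_adjoin k (\<iota> \<theta>)"
    have M: "is_subfield ?M" by (rule is_subfield_field_adjoin)
    have kM: "insert (\<iota> \<theta>) k \<subseteq> ?M" by (rule subset_field_adjoin)
    \<comment> \<open>Pulling \<open>?M\<close> back along \<open>\<iota>\<close> lets the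
      minimality of \<open>field_adjoin F \<theta>\<close> do the work.\<close>
    define L where "L = {y. \<iota> y \<in> ?M}"
    have "is_subfield L"
      using M unfolding is_subfield_def L_def \<iota>_def by simp
    moreover have "insert \<theta> F \<subseteq> L" using kM Fk by (auto simp: L_def)
    ultimately have "field_adjoin F \<theta> \<subseteq> L" by (rule field_adjoin_least)
    hence "\<iota> ` field_adjoin F \<theta> \<subseteq> ?M" by (auto simp: L_def)
    moreover have "algebraic_over (\<iota> ` field_adjoin F \<theta>) (\<iota> y)" for y
      using assms(4) algebraic_over_to_ac[of "field_adjoin F \<theta>" y] by (simp add: \<iota>_def)
    ultimately have "\<forall>y\<in>range \<iota>. algebraic_over ?M y" using algebraic_over_mono by blast
    from algebraic_over_trans[OF M range this over_range] show ?thesis .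
  qed
  interpret closed_one_variable_field k "\<iota> \<theta>"
    by unfold_locales (rule k k_closed \<theta>k alg)+
  have \<Delta>F: "\<Delta> x \<in> \<iota> ` F" if "x \<in> \<iota> ` F" for x using that DF by (auto simp: \<Delta>\<iota>)
  have \<Delta>range: "\<Delta> x \<in> range \<iota>" if "x \<in> range \<iota>" for x using that by (auto simp: \<Delta>\<iota>)
  have \<Delta>k: "\<Delta> c \<in> k" if "c \<in> k" for c
    using derivation_algebraic[OF \<Delta> F' \<Delta>F, of c] that by (simp add: k_def)
  \<comment> \<open>A constant of the closure is algebraic over the constants of \<open>K\<close>;
    these lie in \<open>F\<close> by hypothesis.\<close>
  have const: "c \<in> k" if c: "\<Delta> c = 0" for c
  proof -
    have "algebraic_over {y \<in> range \<iota>. \<Delta> y = 0} c"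
      by (rule constant_algebraic_over_constants[OF \<Delta> range \<Delta>range over_range c])
    moreover have "{y \<in> range \<iota>. \<Delta> y = 0} \<subseteq> \<iota> ` F"
    proof
      fix y assume "y \<in> {y \<in> range \<iota>. \<Delta> y = 0}"
      then obtain z where z: "y = \<iota> z" "\<iota> (D z) = 0" by (auto simp: \<Delta>\<iota>)
      hence "z \<in> constants_of D UNIV" by (simp add: constants_of_def \<iota>_def)
      hence "z \<in> F" using assms(7) by (auto simp: constants_of_def)
      thus "y \<in> \<iota> ` F" using z by blast
    qed
    ultimately show ?thesis unfolding k_def using algebraic_over_mono by blast
  qed
  obtain d where d: "is_derivation d" "\<And>c. c \<in> k \<Longrightarrow> d c = 0" "d (\<iota> \<theta>) = 1"
    using derivation_wrt_transcendental[OF k not_algebraic[OF \<theta>k]] by metis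
  let ?f = "\<lambda>i. \<iota> (\<psi> i)" and ?a = "\<lambda>i. \<iota> (a i)"
  have f: "?f i \<noteq> 0" if "i \<in> {1..n}" for i using assms(8) that by (simp add: \<iota>_def)
  have a: "?a i \<in> k" if "i \<in> {1..n}" for i using assms(11) that Fk by simp
  have "(\<Sum>i=1..n. ?a i * (\<Delta> (?f i) / ?f i)) + \<Delta> (\<iota> s)
      = \<iota> ((\<Sum>i=1..n. a i * (D (\<psi> i) / \<psi> i)) + D s)"
    unfolding \<Delta>\<iota> by (simp add: \<iota>_def to_ac_sum)
  hence h: "(\<Sum>i=1..n. ?a i * (\<Delta> (?f i) / ?f i)) + \<Delta> (\<iota> s) \<in> k"
    using Fk[OF assms(12)] by simp
  have j': "j \<in> {1..n}" "?a j \<noteq> 0" using j by (simp_all add: \<iota>_def)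
  \<comment> \<open>A power product that lands in \<open>k\<close> comes from \<open>K\<close>, so
    it lies in \<open>F\<close>; a nontrivial one contradicts independence.\<close>
  have contra: False
    if ind: "mult_independent_mod F I x" and I: "finite I" and x: "\<And>i. i \<in> I \<Longrightarrow> x i \<noteq> 0"
      and e: "\<exists>i\<in>I. e i \<noteq> 0" "(\<Prod>i\<in>I. \<iota> (x i) powi e i) \<in> k" for I x and e :: "nat \<Rightarrow> int"
  proof -
    have "(\<Prod>i\<in>I. \<iota> (x i) powi e i) = \<iota> (\<Prod>i\<in>I. x i powi e i)"
      by (simp add: \<iota>_def to_ac_prod to_ac_power_int)
    hence "(\<Prod>i\<in>I. x i powi e i) \<in> F" using e(2) k\<iota> by simp
    moreover have "(\<Prod>i\<in>I. x i powi e i) \<noteq> 0" using I x by simp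
    ultimately show False using ind e(1) unfolding mult_independent_mod_def by blast
  qed
  show False
  proof (cases "exp_of_primitive_over D F \<theta>")
    case True
    hence \<theta>0: "\<theta> \<noteq> 0" and u: "D \<theta> / \<theta> \<in> F" by (simp_all add: exp_of_primitive_over_def)
    have "D \<theta> = (D \<theta> / \<theta>) * \<theta>" using \<theta>0 by simp
    hence "\<iota> (D \<theta>) = \<iota> (D \<theta> / \<theta>) * \<iota> \<theta>" unfolding \<iota>_def by (metis to_ac_mult)
    hence D\<theta>: "\<Delta> (\<iota> \<theta>) = \<iota> (D \<theta> / \<theta>) * \<iota> \<theta>" by (simp only: \<Delta>\<iota>)
    \<comment> \<open>The index \<open>0\<close> is free, and it is the position of
      \<open>\<theta>\<close> in the independence hypothesis.\<close>
    have I: "finite {1..n}" "0 \<notin> {1..n}" by simp_all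
    have ins: "insert 0 {1..n} = {0..n}" by auto
    have "\<exists>e :: nat \<Rightarrow> int. (\<exists>i\<in>insert 0 {1..n}. e i \<noteq> 0)
        \<and> (\<Prod>i\<in>insert 0 {1..n}. (?f(0 := \<iota> \<theta>)) i powi e i) \<in> k"
      by (rule exponential_dependent[OF d f a \<Delta> \<Delta>k const h I D\<theta> Fk[OF u] j'])
    moreover have "?f(0 := \<iota> \<theta>) = (\<lambda>i. \<iota> ((\<psi>(0 := \<theta>)) i))" by auto
    ultimately obtain e :: "nat \<Rightarrow> int" where e: "\<exists>i\<in>{0..n}. e i \<noteq> 0"
        "(\<Prod>i\<in>{0..n}. \<iota> ((\<psi>(0 := \<theta>)) i) powi e i) \<in> k"
      unfolding ins by auto
    have nz: "(\<psi>(0 := \<theta>)) i \<noteq> 0" if "i \<in> {0..n}" for i using that assms(8) \<theta>0 by auto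
    have ind: "mult_independent_mod F {0..n} (\<psi>(0 := \<theta>))" using assms(10) True by blast
    show False by (rule contra[OF ind _ nz e]) simp_all
  next
    case False
    hence "\<Delta> (\<iota> \<theta>) \<in> k" using assms(5) Fk by (auto simp: primitive_over_def \<Delta>\<iota>)
    from primitive_dependent[OF d f a \<Delta> \<Delta>k const h _ this j']
    obtain e :: "nat \<Rightarrow> int" where e: "\<exists>i\<in>{1..n}. e i \<noteq> 0" "(\<Prod>i\<in>{1..n}. \<iota> (\<psi> i) powi e i) \<in> k"
      by auto
    show False by (rule contra[OF assms(9) _ _ e]) (use assms(8) in auto)
  qed
qed

end
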